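(* Let $H$ be a finite dimensional Frobenius weak Hopf algebra over a field $k$ such that $S^2|_{H_{\min}}=\mathrm{id}$. Let $\ell\in\int_H^l$ and $\lambda\in\int_{H^*}^l$ be a pair of dual left integrals, i.e. $\lambda\rightharpoonup\ell=1$ and $\ell\rightharpoonup\lambda=\epsilon$, and let $\alpha=\lambda\leftharpoonup\ell\in G(H^* )$ and $a=\ell\leftharpoonup\lambda\in G(H)$ be the associated distinguished group-like elements. Then for all $h\in H$ $$S^4(h)=a^{-1}(\alpha\rightharpoonup h\leftharpoonup\alpha^{-1})a.$$
   Context: A weak Hopf algebra over a field $k$ is a $k$-vector space $H$ with an associative unital algebra structure $(m,1)$, a coassociative counital coalgebra structure $(\Delta,\epsilon)$ (Sweedler notation $\Delta(h)=h_{(1)}\otimes h_{(2)}$) and a linear map $S:H\to H$ (antipode) such that for all $f,g,h\in H$: $\Delta(hg)=\Delta(h)\Delta(g)$; $(\Delta\otimes\mathrm{id})\Delta(1)=(\Delta(1)\otimes1)(1\otimes\Delta(1))=(1\otimes\Delta(1))(\Delta(1)\otimes1)$; $\epsilon(fgh)=\epsilon(fg_{(1)})\epsilon(g_{(2)}h)=\epsilon(fg_{(2)})\epsilon(g_{(1)}h)$; $m(\mathrm{id}\otimes S)\Delta(h)=(\epsilon\otimes\mathrm{id})(\Delta(1)(h\otimes1))$; $m(S\otimes\mathrm{id})\Delta(h)=(\mathrm{id}\otimes\epsilon)((1\otimes h)\Delta(1))$; $S(h)=S(h_{(1)})h_{(2)}S(h_{(3)})$. ($\Delta(1)\neq1\otimes1$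 in general.) Counital maps: $\varepsilon_t(h)=\epsilon(1_{(1)}h)1_{(2)}$, $\varepsilon_s(h)=1_{(1)}\epsilon(h1_{(2)})$; bases $H_t=\varepsilon_t(H)$, $H_s=\varepsilon_s(H)$ (commuting separable subalgebras); $H_{\min}=H_tH_s$. If $\dim_kH<\infty$, $H^*$ is a weak Hopf algebra via $\langle\phi\psi,h\rangle=\langle\phi\otimes\psi,\Delta(h)\rangle$, $\langle\Delta(\phi),h\otimes g\rangle=\langle\phi,hg\rangle$, $\langle S(\phi),h\rangle=\langle\phi,S(h)\rangle$, with unit $\epsilon$ and counit $\phi\mapsto\langle\phi,1\rangle$. Sweedler arrows: $\phi\rightharpoonup h=h_{(1)}\langle\phi,h_{(2)}\rangle$, $h\leftharpoonup\phi=\langle\phi,h_{(1)}\rangle h_{(2)}$, $h\rightharpoonup\phi=\phi_{(1)}\langle\phi_{(2)},h\rangle$, $\phi\leftharpoonup h=\langle\phi_{(1)},h\rangle\phi_{(2)}$. A left integral in $H$ is $\ell\in H$ with $h\ell=\varepsilon_t(h)\ell$ for all $h\in H$; $\int_H^l$ is the space of left integrals. $H$ is called Frobenius if it is a Frobenius algebra (equivalently, it has an integral that is non-degenerate as a functional on $H^*$); then dual pairs of left integrals exist. Group-like elements: invertible $g$ with $\Delta(g)=(g\otimes g)\Delta(1)=\Delta(1)(g\otimes g)$; they form the group $G(\cdot)$. For a dual pair $(\ell,\lambda)$ as in the claim, $\lambda\leftharpoonup\ell$ and $\ell\leftharpoonup\lambda$ are group-like. *)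

theory Defs
  imports Complex_Main "HOL-Library.Function_Algebras"
begin

text \<open>
  Structures over a field \<open>'k\<close> are records with an explicit carrier, so that a weak Hopf algebra
  and its dual (a set of functionals) are objects of the same kind. Addition and zero are those of
  the ambient type of class \<^class>\<open>ab_group_add\<close>; for function types these are the pointwise ones
  of \<^theory>\<open>HOL-Library.Function_Algebras\<close>. The values of structure maps outside the carrier
  are irrelevant.
\<close>

record ('k, 'a) vspace =
  carrier :: "'a set"
  smult :: "'k \<Rightarrow> 'a \<Rightarrow> 'a" (infixr "\<odot>\<index>" 75)

locale vec_space =
  fixes V :: "('k::field, 'a::ab_group_add, 'm) vspace_scheme" (structure)
  assumes ambient: "vector_space (smult V)"
    and subspace: "module.subspace (smult V) (carrier V)"

definition finite_dimensional :: "('k::field, 'a::ab_group_add, 'm) vspace_scheme \<Rightarrow> bool" where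
  "finite_dimensional V \<longleftrightarrow>
     (\<exists>B. finite B \<and> B \<subseteq> carrier V \<and> carrier V = module.span (smult V) B)"

definition scalars :: "('k::field, 'k) vspace" where
  "scalars = \<lparr>carrier = UNIV, smult = (*)\<rparr>"

definition lin_map ::
  "('k::field, 'a::ab_group_add, 'm) vspace_scheme \<Rightarrow> ('k, 'b::ab_group_add, 'n) vspace_scheme \<Rightarrow>
   ('a \<Rightarrow> 'b) \<Rightarrow> bool" where
  "lin_map V W f \<longleftrightarrow>
     (\<forall>x\<in>carrier V. f x \<in> carrier W) \<and>
     (\<forall>x\<in>carrier V. \<forall>y\<in>carrier V. f (x + y) = f x + f y) \<and>
     (\<forall>c. \<forall>x\<in>carrier V. f (c \<odot>\<^bsub>V\<^esub> x) = c \<odot>\<^bsub>W\<^esub> f x)"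

definition bilin_map ::
  "('k::field, 'a::ab_group_add, 'm) vspace_scheme \<Rightarrow> ('k, 'b::ab_group_add, 'n) vspace_scheme \<Rightarrow>
   ('k, 'c::ab_group_add, 'p) vspace_scheme \<Rightarrow> ('a \<Rightarrow> 'b \<Rightarrow> 'c) \<Rightarrow> bool" where
  "bilin_map V W U \<mu> \<longleftrightarrow>
     (\<forall>x\<in>carrier V. lin_map W U (\<lambda>y. \<mu> x y)) \<and>
     (\<forall>y\<in>carrier W. lin_map V U (\<lambda>x. \<mu> x y))"

text \<open>
  Tensor products. Since bilinear forms separate the elements of \<open>V \<otimes> W\<close>, this space embeds into the
  functionals on the bilinear forms on \<open>V \<times> W\<close>, with \<open>x \<otimes> y\<close> acting by evaluation at \<open>(x, y)\<close>;
  \<open>V \<otimes> W\<close> is realised as the span of these evaluations. The type is not symmetric or associative,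
  so the associator is made explicit below.
\<close>

type_synonym ('a, 'b, 'k) tensor = "('a \<Rightarrow> 'b \<Rightarrow> 'k) \<Rightarrow> 'k"

definition pure_tensor ::
  "('k::field, 'a::ab_group_add, 'm) vspace_scheme \<Rightarrow> ('k, 'b::ab_group_add, 'n) vspace_scheme \<Rightarrow>
   'a \<Rightarrow> 'b \<Rightarrow> ('a, 'b, 'k) tensor" where
  "pure_tensor V W x y = (\<lambda>\<beta>. if bilin_map V W scalars \<beta> then \<beta> x y else 0)"

definition tensor_space ::
  "('k::field, 'a::ab_group_add, 'm) vspace_scheme \<Rightarrow> ('k, 'b::ab_group_add, 'n) vspace_scheme \<Rightarrow>
   ('k, ('a, 'b, 'k) tensor) vspace" where
  "tensor_space V W =
     \<lparr>carrier = module.span (\<lambda>c t \<beta>. c * t \<beta>)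
        {pure_tensor V W x y | x y. x \<in> carrier V \<and> y \<in> carrier W},
      smult = (\<lambda>c t \<beta>. c * t \<beta>)\<rparr>"

text \<open>
  The linear map on \<open>V \<otimes> W\<close> induced by a bilinear map \<open>\<mu>\<close>: it sends \<open>\<Sum> x\<^sub>i \<otimes> y\<^sub>i\<close> to \<open>\<Sum> \<mu> x\<^sub>i y\<^sub>i\<close>.
  For bilinear \<open>\<mu>\<close> the value does not depend on the presentation of the tensor.
\<close>

definition tensor_lift ::
  "('k::field, 'a::ab_group_add, 'm) vspace_scheme \<Rightarrow> ('k, 'b::ab_group_add, 'n) vspace_scheme \<Rightarrow>
   ('a \<Rightarrow> 'b \<Rightarrow> 'c::ab_group_add) \<Rightarrow> ('a, 'b, 'k) tensor \<Rightarrow> 'c" where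
  "tensor_lift V W \<mu> t =
     (THE u. \<exists>xs. set xs \<subseteq> carrier V \<times> carrier W \<and>
        t = (\<Sum>(x, y)\<leftarrow>xs. pure_tensor V W x y) \<and> u = (\<Sum>(x, y)\<leftarrow>xs. \<mu> x y))"

text \<open>The map \<open>f \<otimes> g : V \<otimes> W \<rightarrow> V' \<otimes> W'\<close>.\<close>

definition tensor_map ::
  "('k::field, 'a::ab_group_add, 'm) vspace_scheme \<Rightarrow> ('k, 'b::ab_group_add, 'n) vspace_scheme \<Rightarrow>
   ('k, 'c::ab_group_add, 'p) vspace_scheme \<Rightarrow> ('k, 'd::ab_group_add, 'q) vspace_scheme \<Rightarrow>
   ('a \<Rightarrow> 'c) \<Rightarrow> ('b \<Rightarrow> 'd) \<Rightarrow> ('a, 'b, 'k) tensor \<Rightarrow> ('c, 'd, 'k) tensor" where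
  "tensor_map V W V' W' f g = tensor_lift V W (\<lambda>x y. pure_tensor V' W' (f x) (g y))"

text \<open>The associator \<open>V \<otimes> (W \<otimes> U) \<rightarrow> (V \<otimes> W) \<otimes> U\<close>.\<close>

definition tensor_assoc ::
  "('k::field, 'a::ab_group_add, 'm) vspace_scheme \<Rightarrow> ('k, 'b::ab_group_add, 'n) vspace_scheme \<Rightarrow>
   ('k, 'c::ab_group_add, 'p) vspace_scheme \<Rightarrow>
   ('a, ('b, 'c, 'k) tensor, 'k) tensor \<Rightarrow> (('a, 'b, 'k) tensor, 'c, 'k) tensor" where
  "tensor_assoc V W U =
     tensor_lift V (tensor_space W U) (\<lambda>x.
       tensor_lift W U (\<lambda>y z. pure_tensor (tensor_space V W) U (pure_tensor V W x y) z))"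

record ('k, 'a) alg = "('k, 'a) vspace" +
  mult :: "'a \<Rightarrow> 'a \<Rightarrow> 'a" (infixl "\<cdot>\<index>" 70)
  one :: "'a" ("\<one>\<index>")

locale unital_algebra = vec_space A
  for A :: "('k::field, 'a::ab_group_add, 'm) alg_scheme" (structure) +
  assumes mult_bilin: "bilin_map A A A (mult A)"
    and mult_assoc: "\<lbrakk>x \<in> carrier A; y \<in> carrier A; z \<in> carrier A\<rbrakk> \<Longrightarrow> (x \<cdot> y) \<cdot> z = x \<cdot> (y \<cdot> z)"
    and one_closed: "\<one> \<in> carrier A"
    and one_left: "x \<in> carrier A \<Longrightarrow> \<one> \<cdot> x = x"
    and one_right: "x \<in> carrier A \<Longrightarrow> x \<cdot> \<one> = x"

definition alg_units :: "('k::field, 'a::ab_group_add, 'm) alg_scheme \<Rightarrow> 'a set" where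
  "alg_units A =
     {x \<in> carrier A. \<exists>y\<in>carrier A. x \<cdot>\<^bsub>A\<^esub> y = \<one>\<^bsub>A\<^esub> \<and> y \<cdot>\<^bsub>A\<^esub> x = \<one>\<^bsub>A\<^esub>}"

definition alg_inv :: "('k::field, 'a::ab_group_add, 'm) alg_scheme \<Rightarrow> 'a \<Rightarrow> 'a" where
  "alg_inv A x = (THE y. y \<in> carrier A \<and> x \<cdot>\<^bsub>A\<^esub> y = \<one>\<^bsub>A\<^esub> \<and> y \<cdot>\<^bsub>A\<^esub> x = \<one>\<^bsub>A\<^esub>)"

text \<open>
  Frobenius algebras: finite dimensional, with a functional \<open>f\<close> for which the bilinear form
  \<open>(x, y) \<mapsto> f (x \<cdot> y)\<close> is non-degenerate.
\<close>

definition frobenius_algebra :: "('k::field, 'a::ab_group_add, 'm) alg_scheme \<Rightarrow> bool" where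
  "frobenius_algebra A \<longleftrightarrow> finite_dimensional A \<and>
     (\<exists>f. lin_map A scalars f \<and>
        (\<forall>x\<in>carrier A. (\<forall>y\<in>carrier A. f (x \<cdot>\<^bsub>A\<^esub> y) = 0) \<longrightarrow> x = 0) \<and>
        (\<forall>y\<in>carrier A. (\<forall>x\<in>carrier A. f (x \<cdot>\<^bsub>A\<^esub> y) = 0) \<longrightarrow> y = 0))"

definition tensor_alg ::
  "('k::field, 'a::ab_group_add, 'm) alg_scheme \<Rightarrow> ('k, 'b::ab_group_add, 'n) alg_scheme \<Rightarrow>
   ('k, ('a, 'b, 'k) tensor) alg" where
  "tensor_alg A B =
     \<lparr>carrier = carrier (tensor_space A B), smult = smult (tensor_space A B),
      mult = (\<lambda>s t. tensor_lift A B (\<lambda>x y.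
                tensor_lift A B (\<lambda>x' y'. pure_tensor A B (x \<cdot>\<^bsub>A\<^esub> x') (y \<cdot>\<^bsub>B\<^esub> y')) t) s),
      one = pure_tensor A B \<one>\<^bsub>A\<^esub> \<one>\<^bsub>B\<^esub>\<rparr>"

record ('k, 'a) weak_hopf = "('k, 'a) alg" +
  comult :: "'a \<Rightarrow> ('a, 'a, 'k) tensor" ("\<Delta>\<index>")
  counit :: "'a \<Rightarrow> 'k" ("\<epsilon>\<index>")
  antipode :: "'a \<Rightarrow> 'a"

text \<open>\<open>sweedler H \<mu> h\<close> is \<open>\<mu> h\<^sub>(\<^sub>1\<^sub>) h\<^sub>(\<^sub>2\<^sub>)\<close> in Sweedler notation.\<close>

definition sweedler ::
  "('k::field, 'a::ab_group_add) weak_hopf \<Rightarrow> ('a \<Rightarrow> 'a \<Rightarrow> 'b::ab_group_add) \<Rightarrow> 'a \<Rightarrow> 'b" where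
  "sweedler H \<mu> h = tensor_lift H H \<mu> (\<Delta>\<^bsub>H\<^esub> h)"

abbreviation tensor_square ::
  "('k::field, 'a::ab_group_add) weak_hopf \<Rightarrow> ('k, ('a, 'a, 'k) tensor) alg" where
  "tensor_square H \<equiv> tensor_alg H H"

text \<open>\<open>H \<otimes> H \<otimes> H\<close>, bracketed to the left.\<close>

abbreviation tensor_cube ::
  "('k::field, 'a::ab_group_add) weak_hopf \<Rightarrow> ('k, (('a, 'a, 'k) tensor, 'a, 'k) tensor) alg" where
  "tensor_cube H \<equiv> tensor_alg (tensor_alg H H) H"

text \<open>\<open>(\<Delta> \<otimes> id) \<circ> \<Delta>\<close> and \<open>(id \<otimes> \<Delta>) \<circ> \<Delta>\<close>, both with values in \<open>(H \<otimes> H) \<otimes> H\<close>.\<close>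

definition comult_left ::
  "('k::field, 'a::ab_group_add) weak_hopf \<Rightarrow> 'a \<Rightarrow> (('a, 'a, 'k) tensor, 'a, 'k) tensor" where
  "comult_left H h = tensor_map H H (tensor_square H) H \<Delta>\<^bsub>H\<^esub> id (\<Delta>\<^bsub>H\<^esub> h)"

definition comult_right ::
  "('k::field, 'a::ab_group_add) weak_hopf \<Rightarrow> 'a \<Rightarrow> (('a, 'a, 'k) tensor, 'a, 'k) tensor" where
  "comult_right H h =
     tensor_assoc H H H (tensor_map H H H (tensor_square H) id \<Delta>\<^bsub>H\<^esub> (\<Delta>\<^bsub>H\<^esub> h))"

locale weak_hopf_algebra = unital_algebra H
  for H :: "('k::field, 'a::ab_group_add) weak_hopf" (structure) +
  assumes comult_linear: "lin_map H (tensor_square H) \<Delta>"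
    and counit_linear: "lin_map H scalars \<epsilon>"
    and antipode_linear: "lin_map H H (antipode H)"
    and coassoc: "h \<in> carrier H \<Longrightarrow> comult_left H h = comult_right H h"
    and counit_left: "h \<in> carrier H \<Longrightarrow> sweedler H (\<lambda>x y. \<epsilon> x \<odot> y) h = h"
    and counit_right: "h \<in> carrier H \<Longrightarrow> sweedler H (\<lambda>x y. \<epsilon> y \<odot> x) h = h"
    and comult_mult:
      "\<lbrakk>h \<in> carrier H; g \<in> carrier H\<rbrakk> \<Longrightarrow> \<Delta> (h \<cdot> g) = \<Delta> h \<cdot>\<^bsub>tensor_square H\<^esub> \<Delta> g"
    and comult_one_1:
      "comult_left H \<one> =
         pure_tensor (tensor_square H) H (\<Delta> \<one>) \<one> \<cdot>\<^bsub>tensor_cube H\<^esub>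
         tensor_assoc H H H (pure_tensor H (tensor_square H) \<one> (\<Delta> \<one>))"
    and comult_one_2:
      "comult_left H \<one> =
         tensor_assoc H H H (pure_tensor H (tensor_square H) \<one> (\<Delta> \<one>)) \<cdot>\<^bsub>tensor_cube H\<^esub>
         pure_tensor (tensor_square H) H (\<Delta> \<one>) \<one>"
    and counit_mult_1:
      "\<lbrakk>f \<in> carrier H; g \<in> carrier H; h \<in> carrier H\<rbrakk> \<Longrightarrow>
         \<epsilon> (f \<cdot> g \<cdot> h) = sweedler H (\<lambda>x y. \<epsilon> (f \<cdot> x) * \<epsilon> (y \<cdot> h)) g"
    and counit_mult_2:
      "\<lbrakk>f \<in> carrier H; g \<in> carrier H; h \<in> carrier H\<rbrakk> \<Longrightarrow>
         \<epsilon> (f \<cdot> g \<cdot> h) = sweedler H (\<lambda>x y. \<epsilon> (f \<cdot> y) * \<epsilon> (x \<cdot> h)) g"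
    and antipode_1:
      "h \<in> carrier H \<Longrightarrow>
         sweedler H (\<lambda>x y. x \<cdot> antipode H y) h =
         tensor_lift H H (\<lambda>x y. \<epsilon> x \<odot> y) (\<Delta> \<one> \<cdot>\<^bsub>tensor_square H\<^esub> pure_tensor H H h \<one>)"
    and antipode_2:
      "h \<in> carrier H \<Longrightarrow>
         sweedler H (\<lambda>x y. antipode H x \<cdot> y) h =
         tensor_lift H H (\<lambda>x y. \<epsilon> y \<odot> x) (pure_tensor H H \<one> h \<cdot>\<^bsub>tensor_square H\<^esub> \<Delta> \<one>)"
    and antipode_3:
      "h \<in> carrier H \<Longrightarrow>
         antipode H h =
         tensor_lift (tensor_square H) H
           (\<lambda>t z. tensor_lift H H (\<lambda>x y. antipode H x \<cdot> y) t \<cdot> antipode H z) (comult_left H h)"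

definition counital_t :: "('k::field, 'a::ab_group_add) weak_hopf \<Rightarrow> 'a \<Rightarrow> 'a" where
  "counital_t H h = sweedler H (\<lambda>x y. \<epsilon>\<^bsub>H\<^esub> (x \<cdot>\<^bsub>H\<^esub> h) \<odot>\<^bsub>H\<^esub> y) \<one>\<^bsub>H\<^esub>"

definition counital_s :: "('k::field, 'a::ab_group_add) weak_hopf \<Rightarrow> 'a \<Rightarrow> 'a" where
  "counital_s H h = sweedler H (\<lambda>x y. \<epsilon>\<^bsub>H\<^esub> (h \<cdot>\<^bsub>H\<^esub> y) \<odot>\<^bsub>H\<^esub> x) \<one>\<^bsub>H\<^esub>"

definition base_t :: "('k::field, 'a::ab_group_add) weak_hopf \<Rightarrow> 'a set" where
  "base_t H = counital_t H ` carrier H"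

definition base_s :: "('k::field, 'a::ab_group_add) weak_hopf \<Rightarrow> 'a set" where
  "base_s H = counital_s H ` carrier H"

definition H_min :: "('k::field, 'a::ab_group_add) weak_hopf \<Rightarrow> 'a set" where
  "H_min H = module.span (smult H) {z \<cdot>\<^bsub>H\<^esub> w | z w. z \<in> base_t H \<and> w \<in> base_s H}"

definition left_integrals :: "('k::field, 'a::ab_group_add) weak_hopf \<Rightarrow> 'a set" where
  "left_integrals H =
     {l \<in> carrier H. \<forall>h\<in>carrier H. h \<cdot>\<^bsub>H\<^esub> l = counital_t H h \<cdot>\<^bsub>H\<^esub> l}"

definition group_likes :: "('k::field, 'a::ab_group_add) weak_hopf \<Rightarrow> 'a set" where
  "group_likes H =
     {g \<in> alg_units H.
        \<Delta>\<^bsub>H\<^esub> g = pure_tensor H H g g \<cdot>\<^bsub>tensor_square H\<^esub> \<Delta>\<^bsub>H\<^esub> \<one>\<^bsub>H\<^esub> \<and>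
        \<Delta>\<^bsub>H\<^esub> g = \<Delta>\<^bsub>H\<^esub> \<one>\<^bsub>H\<^esub> \<cdot>\<^bsub>tensor_square H\<^esub> pure_tensor H H g g}"

text \<open>
  The dual. Functionals on \<open>carrier H\<close> are represented by functions vanishing outside
  \<open>carrier H\<close>, so that equality of functionals is equality of functions.
\<close>

definition dual_alg :: "('k::field, 'a::ab_group_add) weak_hopf \<Rightarrow> ('k, 'a \<Rightarrow> 'k) alg" where
  "dual_alg H =
     \<lparr>carrier = {\<phi>. lin_map H scalars \<phi> \<and> (\<forall>x. x \<notin> carrier H \<longrightarrow> \<phi> x = 0)},
      smult = (\<lambda>c \<phi> x. c * \<phi> x),
      mult = (\<lambda>\<phi> \<psi> h. if h \<in> carrier H then sweedler H (\<lambda>x y. \<phi> x * \<psi> y) h else 0),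
      one = (\<lambda>h. if h \<in> carrier H then \<epsilon>\<^bsub>H\<^esub> h else 0)\<rparr>"

text \<open>
  The comultiplication takes \<open>\<phi>\<close> to the element of \<open>H\<^sup>* \<otimes> H\<^sup>*\<close> pairing with \<open>h \<otimes> g\<close> to \<open>\<phi> (h \<cdot> g)\<close>,
  which exists and is unique if \<open>H\<close> is finite dimensional.
\<close>

definition dual :: "('k::field, 'a::ab_group_add) weak_hopf \<Rightarrow> ('k, 'a \<Rightarrow> 'k) weak_hopf" where
  "dual H =
     \<lparr>carrier = carrier (dual_alg H), smult = smult (dual_alg H),
      mult = mult (dual_alg H), one = one (dual_alg H),
      comult = (\<lambda>\<phi>. THE t. t \<in> carrier (tensor_space (dual_alg H) (dual_alg H)) \<and>
         (\<forall>h\<in>carrier H. \<forall>g\<in>carrier H.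
            tensor_lift (dual_alg H) (dual_alg H) (\<lambda>\<psi> \<chi>. \<psi> h * \<chi> g) t = \<phi> (h \<cdot>\<^bsub>H\<^esub> g))),
      counit = (\<lambda>\<phi>. \<phi> \<one>\<^bsub>H\<^esub>),
      antipode = (\<lambda>\<phi> h. if h \<in> carrier H then \<phi> (antipode H h) else 0)\<rparr>"

text \<open>
  Sweedler arrows: \<open>\<phi> \<rightharpoonup> h\<close> and \<open>h \<leftharpoonup> \<phi>\<close> in \<open>H\<close> are \<open>hit_left H \<phi> h\<close> and \<open>hit_right H h \<phi>\<close>;
  \<open>h \<rightharpoonup> \<phi>\<close> and \<open>\<phi> \<leftharpoonup> h\<close> in the dual are \<open>dual_hit_left H h \<phi>\<close> and \<open>dual_hit_right H \<phi> h\<close>.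
\<close>

definition hit_left ::
  "('k::field, 'a::ab_group_add) weak_hopf \<Rightarrow> ('a \<Rightarrow> 'k) \<Rightarrow> 'a \<Rightarrow> 'a" where
  "hit_left H \<phi> h = sweedler H (\<lambda>x y. \<phi> y \<odot>\<^bsub>H\<^esub> x) h"

definition hit_right ::
  "('k::field, 'a::ab_group_add) weak_hopf \<Rightarrow> 'a \<Rightarrow> ('a \<Rightarrow> 'k) \<Rightarrow> 'a" where
  "hit_right H h \<phi> = sweedler H (\<lambda>x y. \<phi> x \<odot>\<^bsub>H\<^esub> y) h"

definition dual_hit_left ::
  "('k::field, 'a::ab_group_add) weak_hopf \<Rightarrow> 'a \<Rightarrow> ('a \<Rightarrow> 'k) \<Rightarrow> ('a \<Rightarrow> 'k)" where
  "dual_hit_left H h \<phi> = sweedler (dual H) (\<lambda>\<psi> \<chi>. \<chi> h \<odot>\<^bsub>dual H\<^esub> \<psi>) \<phi>"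

definition dual_hit_right ::
  "('k::field, 'a::ab_group_add) weak_hopf \<Rightarrow> ('a \<Rightarrow> 'k) \<Rightarrow> 'a \<Rightarrow> ('a \<Rightarrow> 'k)" where
  "dual_hit_right H \<phi> h = sweedler (dual H) (\<lambda>\<psi> \<chi>. \<psi> h \<odot>\<^bsub>dual H\<^esub> \<chi>) \<phi>"

end

theory Submission
  imports Defs
begin

text \<open>
  Write \<open>\<lambda>\<close> for the dual integral of \<open>l\<close> and \<open>\<Delta> h = h\<^sub>1 \<otimes> h\<^sub>2\<close>. As for Hopf algebras (Radford),
  the formula for \<open>S\<^sup>4\<close> comes from the Frobenius structure given by \<open>\<lambda>\<close>. A left integral moves
  factors across its comultiplication, \<open>l\<^sub>1 \<otimes> h l\<^sub>2 = S h l\<^sub>1 \<otimes> l\<^sub>2\<close>, and \<open>\<lambda>\<close> satisfies the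
  corresponding rule \<open>x\<^sub>1 \<lambda>(h x\<^sub>2) = S h\<^sub>1 \<lambda>(h\<^sub>2 x)\<close>; together with \<open>\<lambda> \<rightharpoonup> l = 1\<close> and \<open>l \<rightharpoonup> \<lambda> = \<epsilon>\<close>
  they give \<open>l\<^sub>1 \<lambda>(h l\<^sub>2) = S h\<close>, \<open>\<lambda>(S h l\<^sub>1) l\<^sub>2 = h a\<close> and \<open>S l\<^sub>1 \<lambda>(l\<^sub>2 h) = \<alpha> \<rightharpoonup> h\<close>. The first
  of these is a reproducing formula, so that the form \<open>\<lambda>(x y)\<close> is non-degenerate, and integral
  functionals are unique up to the counital subalgebras. It follows that \<open>\<lambda>(a x)\<close> is a right
  integral functional, which yields the fourth formula \<open>\<lambda>(l\<^sub>1 h) l\<^sub>2 = \<alpha>(h\<^sub>1) a S h\<^sub>2\<close>.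

  Given \<open>k\<close>, put \<open>h = S (S k)\<close> and let \<open>N\<close> be the image of \<open>h\<close> under the Nakayama automorphism:
  \<open>\<lambda>(x N) = \<lambda>(h x)\<close> for all \<open>x\<close>. The third and first formulas at \<open>N\<close> give \<open>\<alpha> \<rightharpoonup> N = S (S h)\<close>, and
  the fourth and second give \<open>N \<leftharpoonup> \<alpha> = a\<^sup>-\<^sup>1 k a\<close>. Hence \<open>S\<^sup>4 k = T (a\<^sup>-\<^sup>1 k a)\<close> with
  \<open>T x = \<alpha> \<rightharpoonup> x \<leftharpoonup> \<alpha>\<^sup>-\<^sup>1\<close> (\<open>S4_of_conjugate\<close>). As \<open>\<alpha>\<close> is group-like, \<open>T\<close> is multiplicative; the
  case \<open>k = a\<close> shows \<open>T a = a\<close>, and the theorem follows (\<open>S4\<close>).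

  Two ingredients are specific to weak Hopf algebras. The antipode is bijective: a linear
  relation among its powers gives \<open>S\<^sup>n = S^(n+1) R\<close>, and \<open>n\<close> can be lowered to \<open>0\<close> because two
  multiplicative maps that agree on the image of \<open>S\<close> are equal (\<open>S_epi\<close>, \<open>S_bij\<close>). And \<open>a\<close> is
  group-like on both sides: uniqueness of integral functionals gives only \<open>\<Delta> a = \<Delta> 1 (a \<otimes> a)\<close>;
  the identity \<open>a S a = 1\<close>, which supplies the other half, uses \<open>S\<^sup>2 = id\<close> on the counital
  subalgebras through the symmetry of their separability idempotent (\<open>a_S_a\<close>).

  All this is carried out in coordinates. With respect to a basis, a weak Hopf algebra is a
  family of structure constants subject to polynomial identities, and these identities are
  invariant under transposition (passage to the dual) and under reversing both products and
  coproducts. The two symmetries are interpretations of one locale into itself; they turn each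
  lemma on \<open>\<epsilon>\<close>, \<open>l\<close> or \<open>a\<close> into one on the unit, \<open>\<lambda>\<close> or \<open>\<alpha>\<close>. The last sections translate: an
  element of a tensor product is determined by its values on bilinear forms, and both \<open>H\<close> and
  \<open>H\<^sup>*\<close> are described by the same structure constants.
\<close>

section \<open>Linear algebra in coordinates\<close>

text \<open>
  Vectors and functionals are both functions on the index set \<open>I\<close>, paired by \<open>pr\<close>, so that the
  dual of a space of vectors is again a space of vectors. Laws of an algebra are imposed later;
  only multilinear algebra is developed here.
\<close>

locale structure_constants =
  fixes I :: "'i set"
    and m :: "'i \<Rightarrow> 'i \<Rightarrow> 'i \<Rightarrow> 'k::field" and u :: "'i \<Rightarrow> 'k"
    and d :: "'i \<Rightarrow> 'i \<Rightarrow> 'i \<Rightarrow> 'k" and e :: "'i \<Rightarrow> 'k" and s :: "'i \<Rightarrow> 'i \<Rightarrow> 'k"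
  assumes finite_I: "finite I"
begin

definition vecs :: "('i \<Rightarrow> 'k) set" where
  "vecs = {x. \<forall>i. i \<notin> I \<longrightarrow> x i = 0}"

definition pr :: "('i \<Rightarrow> 'k) \<Rightarrow> ('i \<Rightarrow> 'k) \<Rightarrow> 'k" where
  "pr \<phi> x = (\<Sum>i\<in>I. \<phi> i * x i)"

definition bas :: "'i \<Rightarrow> 'i \<Rightarrow> 'k" where
  "bas i = (\<lambda>j. if j = i then 1 else 0)"

definition mul :: "('i \<Rightarrow> 'k) \<Rightarrow> ('i \<Rightarrow> 'k) \<Rightarrow> 'i \<Rightarrow> 'k" (infixl "\<bullet>" 70) where
  "x \<bullet> y = (\<lambda>k. if k \<in> I then \<Sum>i\<in>I. \<Sum>j\<in>I. x i * y j * m i j k else 0)"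

definition unit :: "'i \<Rightarrow> 'k" where
  "unit = (\<lambda>i. if i \<in> I then u i else 0)"

text \<open>
  The Sweedler sum \<open>F(x\<^sub>1, x\<^sub>2)\<close>. Every formula about the comultiplication is stated through it,
  for scalar valued forms \<open>F\<close>.
\<close>

definition D :: "('i \<Rightarrow> 'k) \<Rightarrow> (('i \<Rightarrow> 'k) \<Rightarrow> ('i \<Rightarrow> 'k) \<Rightarrow> 'k) \<Rightarrow> 'k" where
  "D x F = (\<Sum>i\<in>I. \<Sum>j\<in>I. (\<Sum>k\<in>I. x k * d k i j) * F (bas i) (bas j))"

definition eps :: "('i \<Rightarrow> 'k) \<Rightarrow> 'k" where
  "eps x = pr e x"

definition S :: "('i \<Rightarrow> 'k) \<Rightarrow> 'i \<Rightarrow> 'k" where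
  "S x = (\<lambda>j. if j \<in> I then \<Sum>i\<in>I. x i * s i j else 0)"

text \<open>
  Linearity is being a pairing with a fixed vector. This also makes a linear functional
  independent of coordinates outside \<open>I\<close>, and reduces identities between linear functionals to
  functionals of the form \<open>pr \<phi>\<close>.
\<close>

definition lin :: "(('i \<Rightarrow> 'k) \<Rightarrow> 'k) \<Rightarrow> bool" where
  "lin f \<longleftrightarrow> (\<exists>\<phi>. f = pr \<phi>)"

definition linv :: "(('i \<Rightarrow> 'k) \<Rightarrow> 'i \<Rightarrow> 'k) \<Rightarrow> bool" where
  "linv g \<longleftrightarrow> (\<forall>f. lin f \<longrightarrow> lin (\<lambda>x. f (g x)))"

definition blin :: "(('i \<Rightarrow> 'k) \<Rightarrow> ('i \<Rightarrow> 'k) \<Rightarrow> 'k) \<Rightarrow> bool" where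
  "blin F \<longleftrightarrow> (\<forall>y. lin (\<lambda>x. F x y)) \<and> (\<forall>x. lin (F x))"

text \<open>
  Values outside \<open>I\<close> are set to 0 here and in the algebra operations, so that vectors are equal
  as soon as all functionals agree on them.
\<close>

definition DV :: "('i \<Rightarrow> 'k) \<Rightarrow> (('i \<Rightarrow> 'k) \<Rightarrow> ('i \<Rightarrow> 'k) \<Rightarrow> 'i \<Rightarrow> 'k) \<Rightarrow> 'i \<Rightarrow> 'k" where
  "DV x G = (\<lambda>k. if k \<in> I then D x (\<lambda>p q. G p q k) else 0)"

definition sc :: "'k \<Rightarrow> ('i \<Rightarrow> 'k) \<Rightarrow> 'i \<Rightarrow> 'k" where
  "sc c x = (\<lambda>i. c * x i)"

lemma sum_bas: "i \<in> I \<Longrightarrow> (\<Sum>j\<in>I. f j * bas i j) = f i" "i \<in> I \<Longrightarrow> (\<Sum>j\<in>I. bas i j * f j) = f i"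
  by (simp_all add: bas_def if_distrib[of "\<lambda>z. _ * z"] if_distrib[of "\<lambda>z. z * _"] finite_I cong: if_cong)

lemma sum_delta_mult: fixes f :: "'i \<Rightarrow> 'k" assumes "i \<in> I" shows "(\<Sum>j\<in>I. (if i = j then 1 else 0) * f j) = f i"
proof -
  have "(\<Sum>j\<in>I. (if i = j then 1 else 0) * f j) = (\<Sum>j\<in>I. if i = j then f j else 0)"
    by (intro sum.cong) auto
  then show ?thesis using assms by (simp add: finite_I)
qed

lemma pr_bas [simp]: "i \<in> I \<Longrightarrow> pr \<phi> (bas i) = \<phi> i" "i \<in> I \<Longrightarrow> pr (bas i) x = x i"
  by (simp_all add: pr_def sum_bas)

lemma pr_commute: "pr \<phi> x = pr x \<phi>"
  by (simp add: pr_def mult.commute)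

lemma lin_pr [simp, intro!]: "lin (pr \<phi>)"
  by (auto simp: lin_def)

lemma lin_obtain: assumes "lin f" obtains \<phi> where "f = pr \<phi>"
  using assms by (auto simp: lin_def)

lemma lin_iff: "lin f \<longleftrightarrow> (\<forall>x. f x = (\<Sum>i\<in>I. f (bas i) * x i))"
proof
  assume "lin f"
  then obtain \<phi> where f: "f = pr \<phi>" by (rule lin_obtain)
  show "\<forall>x. f x = (\<Sum>i\<in>I. f (bas i) * x i)"
    unfolding f by (intro allI, subst pr_def, rule sum.cong[OF refl], simp)
next
  assume "\<forall>x. f x = (\<Sum>i\<in>I. f (bas i) * x i)"
  then show "lin f" unfolding lin_def pr_def by (intro exI[of _ "\<lambda>i. f (bas i)"] ext) (erule spec)
qed

lemma lin_expand: "lin f \<Longrightarrow> f x = (\<Sum>i\<in>I. f (bas i) * x i)"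
  using lin_iff by blast

lemma lin_scale: "lin f \<Longrightarrow> lin (\<lambda>x. c * f x)"
  by (elim lin_obtain, unfold lin_def, rule_tac x="\<lambda>i. c * \<phi> i" in exI)
     (simp add: fun_eq_iff pr_def sum_distrib_left mult.assoc)

lemma lin_sum:
  assumes "\<And>j. j \<in> J \<Longrightarrow> lin (\<lambda>x. F x j)" shows "lin (\<lambda>x. \<Sum>j\<in>J. F x j)"
proof -
  have "(\<Sum>j\<in>J. F x j) = (\<Sum>i\<in>I. (\<Sum>j\<in>J. F (bas i) j) * x i)" for x
  proof -
    have "(\<Sum>j\<in>J. F x j) = (\<Sum>j\<in>J. \<Sum>i\<in>I. F (bas i) j * x i)"
      by (intro sum.cong refl lin_expand assms)
    also have "\<dots> = (\<Sum>i\<in>I. (\<Sum>j\<in>J. F (bas i) j) * x i)"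
      by (subst sum.swap) (simp add: sum_distrib_right)
    finally show ?thesis .
  qed
  then show ?thesis by (subst lin_iff) (rule allI)
qed

lemma lin_add: "lin f \<Longrightarrow> lin g \<Longrightarrow> lin (\<lambda>x. f x + g x)"
  by (elim lin_obtain, unfold lin_def, rule_tac x="\<lambda>i. \<phi> i + \<phi>' i" in exI)
     (simp add: fun_eq_iff pr_def distrib_right sum.distrib)

lemma lin_scale_right: "lin f \<Longrightarrow> lin (\<lambda>x. f x * c)"
  using lin_scale[of f c] by (simp add: mult.commute)

lemma lin_coord: "i \<in> I \<Longrightarrow> lin (\<lambda>x. x i)"
  unfolding lin_def by (rule exI[of _ "bas i"]) (simp add: fun_eq_iff)

lemma linvI:
  assumes "\<And>k. k \<in> I \<Longrightarrow> lin (\<lambda>x. g x k)" shows "linv g"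
  unfolding linv_def
proof (intro allI impI)
  fix f assume "lin f"
  then obtain \<phi> where f: "f = pr \<phi>" by (rule lin_obtain)
  show "lin (\<lambda>x. f (g x))" unfolding f pr_def by (intro lin_sum lin_scale assms)
qed

lemma lin_linv:
  assumes "lin f" "linv g" shows "lin (\<lambda>x. f (g x))"
proof -
  from assms(2) have "lin f \<longrightarrow> lin (\<lambda>x. f (g x))" unfolding linv_def by (rule spec)
  then show ?thesis using assms(1) by (rule mp)
qed

lemma linv_id: "linv (\<lambda>x. x)" by (simp add: linv_def)

lemma linv_comp: "linv g \<Longrightarrow> linv h \<Longrightarrow> linv (\<lambda>x. g (h x))"
  by (unfold linv_def[of "\<lambda>x. g (h x)"], intro allI impI, rule lin_linv[OF lin_linv])

lemma linv_mul_left0: "linv (\<lambda>x. x \<bullet> y)"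
proof (rule linvI)
  fix k assume k: "k \<in> I"
  have "lin (\<lambda>x. \<Sum>i\<in>I. \<Sum>j\<in>I. x i * (y j * m i j k))"
    by (intro lin_sum lin_scale_right lin_coord)
  then show "lin (\<lambda>x. (x \<bullet> y) k)" using k by (simp only: mul_def mult.assoc if_True)
qed

lemma linv_mul_right0: "linv (\<lambda>y. x \<bullet> y)"
proof (rule linvI)
  fix k assume k: "k \<in> I"
  have "lin (\<lambda>y. \<Sum>i\<in>I. \<Sum>j\<in>I. x i * y j * m i j k)"
    by (intro lin_sum lin_scale_right lin_scale lin_coord)
  then show "lin (\<lambda>y. (x \<bullet> y) k)" using k by (simp only: mul_def if_True)
qed

lemma linv_S0: "linv S"
proof (rule linvI)
  fix k assume k: "k \<in> I"
  have "lin (\<lambda>x. \<Sum>i\<in>I. x i * s i k)"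
    by (intro lin_sum lin_scale_right lin_coord)
  then show "lin (\<lambda>y. S y k)" using k by (simp only: S_def if_True)
qed

lemmas linv_mul_left = linv_comp[OF linv_mul_left0]
lemmas linv_mul_right = linv_comp[OF linv_mul_right0]
lemmas linv_S = linv_comp[OF linv_S0]

lemma lin_D_arg0: "lin (\<lambda>x. D x F)"
  unfolding D_def by (intro lin_sum lin_scale_right lin_coord)

lemmas lin_D_arg = lin_linv[OF lin_D_arg0]
lemmas lin_pr_comp = lin_linv[OF lin_pr]

lemma lin_eps0: "lin eps" unfolding eps_def[abs_def] by simp

lemmas lin_eps = lin_linv[OF lin_eps0]

lemma lin_D_fun: "(\<And>p q. lin (\<lambda>x. F x p q)) \<Longrightarrow> lin (\<lambda>x. D y (\<lambda>p q. F x p q))"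
  unfolding D_def by (intro lin_sum lin_scale) blast

lemma linv_DV_arg0: "linv (\<lambda>x. DV x G)"
  by (rule linvI) (simp add: DV_def lin_D_arg0)

lemmas linv_DV_arg = linv_comp[OF linv_DV_arg0]

lemma blinI: "(\<And>y. lin (\<lambda>x. F x y)) \<Longrightarrow> (\<And>x. lin (\<lambda>y. F x y)) \<Longrightarrow> blin F"
  by (simp add: blin_def)

lemma blinD1: "blin F \<Longrightarrow> lin (\<lambda>x. F x y)" and blinD2: "blin F \<Longrightarrow> lin (\<lambda>x. F y x)"
  by (simp_all add: blin_def)

lemma blin_lin1: assumes "blin F" "linv g" shows "lin (\<lambda>x. F (g x) y)"
  by (rule lin_linv[OF blinD1[OF assms(1)] assms(2)])

lemma blin_lin2: assumes "blin F" "linv g" shows "lin (\<lambda>x. F y (g x))"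
  by (rule lin_linv[OF blinD2[OF assms(1)] assms(2)])

lemmas blin_lin = blin_lin1 blin_lin2

lemmas lin_intros = lin_pr_comp lin_scale lin_scale_right lin_D_fun lin_D_arg lin_eps lin_add
  linv_id linv_mul_left linv_mul_right linv_S linv_DV_arg

lemma vecs_closed [simp, intro]:
  "x \<bullet> y \<in> vecs" "unit \<in> vecs" "S x \<in> vecs" "DV x G \<in> vecs" "i \<in> I \<Longrightarrow> bas i \<in> vecs"
  by (auto simp: vecs_def mul_def unit_def S_def DV_def bas_def)

lemma vec_eqI:
  assumes "x \<in> vecs" "y \<in> vecs" "\<And>\<phi>. pr \<phi> x = pr \<phi> y" shows "x = y"
proof
  fix i show "x i = y i" using assms(1,2) assms(3)[of "bas i"] by (cases "i \<in> I") (auto simp: vecs_def)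
qed

lemma lin_eqI:
  assumes "lin f" "\<And>\<phi>. pr \<phi> x = pr \<phi> y" shows "f x = f y"
  using assms(1) by (elim lin_obtain) (simp add: assms(2))

lemma D_cong:
  assumes "\<And>p q. p \<in> vecs \<Longrightarrow> q \<in> vecs \<Longrightarrow> F p q = G p q" shows "D x F = D x G"
  unfolding D_def using assms by (auto intro!: sum.cong)

lemma D_arg_cong: assumes "\<And>\<phi>. pr \<phi> x = pr \<phi> y" shows "D x F = D y F"
  using lin_eqI[OF lin_D_arg0 assms] .

lemma D_add: "D x (\<lambda>p q. F p q + G p q) = D x F + D x G"
  by (simp add: D_def distrib_left sum.distrib)
lemma D_scale: "D x (\<lambda>p q. c * F p q) = c * D x F"
  by (simp add: D_def sum_distrib_left mult.left_commute)
lemma D_scale_right: "D x (\<lambda>p q. F p q * c) = D x F * c"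
  by (simp add: D_def sum_distrib_right mult.assoc)
lemma D_sum: "D x (\<lambda>p q. \<Sum>i\<in>J. F p q i) = (\<Sum>i\<in>J. D x (\<lambda>p q. F p q i))"
  by (simp only: D_def sum_distrib_left sum.swap[of _ J I])
lemma lin_DV:
  assumes "lin f" shows "f (DV x G) = D x (\<lambda>p q. f (G p q))"
proof -
  obtain \<phi> where f: "f = pr \<phi>" using assms by (rule lin_obtain)
  have "pr \<phi> (DV x G) = (\<Sum>k\<in>I. D x (\<lambda>p q. \<phi> k * G p q k))"
    by (simp add: pr_def DV_def D_scale)
  also have "\<dots> = D x (\<lambda>p q. pr \<phi> (G p q))" unfolding pr_def by (rule D_sum[symmetric])
  finally show ?thesis by (simp only: f)
qed

text \<open>
  Two Sweedler sums over different elements can be interchanged; this replaces all permutations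
  of tensor factors.
\<close>

lemma D_commute: "D x (\<lambda>p q. D y (\<lambda>r t. F p q r t)) = D y (\<lambda>r t. D x (\<lambda>p q. F p q r t))"
proof -
  have "D x (\<lambda>p q. D y (\<lambda>r t. F p q r t)) =
     (\<Sum>i\<in>I. \<Sum>j\<in>I. D x (\<lambda>p q. (\<Sum>k\<in>I. y k * d k i j) * F p q (bas i) (bas j)))"
    unfolding D_def[of y] by (simp only: D_sum)
  also have "\<dots> = D y (\<lambda>r t. D x (\<lambda>p q. F p q r t))"
    by (simp only: D_scale D_def[of y])
  finally show ?thesis .
qed

lemma blin_expand:
  assumes "blin F" 
  shows "F x y = (\<Sum>i\<in>I. \<Sum>j\<in>I. F (bas i) (bas j) * (pr (bas i) x * pr (bas j) y))"
proof -
  have "F x y = (\<Sum>i\<in>I. F (bas i) y * x i)"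
    using assms by (intro lin_expand[of "\<lambda>x. F x y"]) (simp add: blin_def)
  also have "\<dots> = (\<Sum>i\<in>I. (\<Sum>j\<in>I. F (bas i) (bas j) * y j) * x i)"
    using assms by (intro sum.cong refl arg_cong2[where f="(*)"] lin_expand) (simp add: blin_def)
  finally show ?thesis by (simp add: sum_distrib_left sum_distrib_right mult_ac)
qed

lemma blin_obtain:
  assumes "blin F" 
  obtains c where "F = (\<lambda>x y. \<Sum>i\<in>I. \<Sum>j\<in>I. c i j * (pr (bas i) x * pr (bas j) y))"
  by (rule that[of "\<lambda>i j. F (bas i) (bas j)"]) (intro ext blin_expand assms)

text \<open>
  A bilinear form is a sum of products of functionals, so that an identity of tensors need only
  be tested on such products.
\<close>

lemma rank_one2:
  assumes "\<And>\<phi> \<psi>. D x (\<lambda>p q. pr \<phi> (f p q) * pr \<psi> (g p q)) = D y (\<lambda>p q. pr \<phi> (f' p q) * pr \<psi> (g' p q))"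
    and F: "blin F"
  shows "D x (\<lambda>p q. F (f p q) (g p q)) = D y (\<lambda>p q. F (f' p q) (g' p q))"
  using F by (elim blin_obtain) (simp only: D_sum D_scale assms(1))

text \<open>
  Trilinear forms are needed for the axiom on \<open>\<Delta> 1\<close>, which lives in the third tensor power.
\<close>

definition tlin where
  "tlin F \<longleftrightarrow> (\<forall>z. blin (\<lambda>x y. F x y z)) \<and> (\<forall>x y. lin (\<lambda>z. F x y z))"

lemma tlinI:
  assumes "\<And>y z. lin (\<lambda>x. F x y z)" "\<And>x z. lin (\<lambda>y. F x y z)" "\<And>x y. lin (\<lambda>z. F x y z)"
  shows "tlin F"
  using assms by (simp add: tlin_def blin_def)

lemma tlin_expand:
  assumes "tlin F"
  shows "F x y z = (\<Sum>i\<in>I. \<Sum>j\<in>I. \<Sum>k\<in>I. F (bas i) (bas j) (bas k) * (pr (bas i) x * pr (bas j) y * pr (bas k) z))"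
proof -
  have "F x y z = (\<Sum>k\<in>I. F x y (bas k) * z k)"
    using assms by (intro lin_expand[of "\<lambda>z. F x y z"]) (simp add: tlin_def)
  also have "\<dots> = (\<Sum>k\<in>I. (\<Sum>i\<in>I. \<Sum>j\<in>I. F (bas i) (bas j) (bas k) * (pr (bas i) x * pr (bas j) y)) * z k)"
    using assms by (intro sum.cong refl arg_cong2[where f="(*)"] blin_expand[of "\<lambda>x y. F x y _"]) (simp add: tlin_def)
  also have "\<dots> = (\<Sum>k\<in>I. \<Sum>i\<in>I. \<Sum>j\<in>I. F (bas i) (bas j) (bas k) * (pr (bas i) x * pr (bas j) y * pr (bas k) z))"
    by (simp add: sum_distrib_left sum_distrib_right mult_ac)
  also have "\<dots> = (\<Sum>i\<in>I. \<Sum>k\<in>I. \<Sum>j\<in>I. F (bas i) (bas j) (bas k) * (pr (bas i) x * pr (bas j) y * pr (bas k) z))"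
    by (rule sum.swap)
  also have "\<dots> = (\<Sum>i\<in>I. \<Sum>j\<in>I. \<Sum>k\<in>I. F (bas i) (bas j) (bas k) * (pr (bas i) x * pr (bas j) y * pr (bas k) z))"
    by (intro sum.cong refl sum.swap)
  finally show ?thesis .
qed

lemma tlin_obtain:
  assumes "tlin F" 
  obtains c where "F = (\<lambda>x y z. \<Sum>i\<in>I. \<Sum>j\<in>I. \<Sum>k\<in>I. c i j k * (pr (bas i) x * pr (bas j) y * pr (bas k) z))"
  by (rule that[of "\<lambda>i j k. F (bas i) (bas j) (bas k)"]) (intro ext tlin_expand assms)

lemma lin_f_sc: "lin f \<Longrightarrow> f (sc c x) = c * f x"
  by (elim lin_obtain) (simp add: pr_def sc_def sum_distrib_left mult.left_commute)

lemma linv_sc: "linv g \<Longrightarrow> linv (\<lambda>x. sc c (g x))"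
  by (rule linv_comp[of "sc c"]) (auto intro!: linvI lin_scale lin_coord simp: sc_def)

text \<open>
  The target and source counital maps \<open>h \<mapsto> \<epsilon>(u\<^sub>1 h) u\<^sub>2\<close> and \<open>h \<mapsto> u\<^sub>1 \<epsilon>(h u\<^sub>2)\<close>, where \<open>u\<close> is
  the unit.
\<close>

definition et :: "('i \<Rightarrow> 'k) \<Rightarrow> 'i \<Rightarrow> 'k" where
  "et x = DV unit (\<lambda>p q. sc (eps (p \<bullet> x)) q)"

definition es :: "('i \<Rightarrow> 'k) \<Rightarrow> 'i \<Rightarrow> 'k" where
  "es x = DV unit (\<lambda>p q. sc (eps (x \<bullet> q)) p)"

lemma lin_et: "lin f \<Longrightarrow> f (et x) = D unit (\<lambda>p q. eps (p \<bullet> x) * f q)"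
  by (simp add: et_def lin_DV lin_f_sc)

lemma lin_es: "lin f \<Longrightarrow> f (es x) = D unit (\<lambda>p q. eps (x \<bullet> q) * f p)"
  by (simp add: es_def lin_DV lin_f_sc)

lemma linv_et0: "linv et"
proof (unfold linv_def, intro allI impI)
  fix f assume f: "lin f"
  show "lin (\<lambda>x. f (et x))" unfolding lin_et[OF f] by (intro lin_intros)
qed

lemma linv_es0: "linv es"
proof (unfold linv_def, intro allI impI)
  fix f assume f: "lin f"
  show "lin (\<lambda>x. f (es x))" unfolding lin_es[OF f] by (intro lin_intros)
qed

lemmas linv_et = linv_comp[OF linv_et0]
lemmas linv_es = linv_comp[OF linv_es0]
lemmas lin_rules = lin_intros linv_et linv_es linv_sc

lemma et_vecs [simp]: "et x \<in> vecs" "es x \<in> vecs" by (simp_all add: et_def es_def)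

end

section \<open>Weak Hopf algebras in coordinates\<close>

text \<open>
  The axioms are assumed only for functionals of the form \<open>pr \<phi>\<close>: this is the weakest form to
  verify, and the general forms follow by multilinearity.
\<close>

locale weak_hopf_coords = structure_constants I m u d e s
  for I :: "'i set" and m :: "'i \<Rightarrow> 'i \<Rightarrow> 'i \<Rightarrow> 'k::field" and u d e s +
  assumes ax_assoc: "pr \<phi> ((x \<bullet> y) \<bullet> z) = pr \<phi> (x \<bullet> (y \<bullet> z))"
    and ax_coassoc: "D x (\<lambda>p q. D p (\<lambda>r t. pr \<phi> r * pr \<psi> t * pr \<chi> q)) =
      D x (\<lambda>p q. D q (\<lambda>r t. pr \<phi> p * pr \<psi> r * pr \<chi> t))"
    and ax_unit: "pr \<phi> (unit \<bullet> x) = pr \<phi> x" "pr \<phi> (x \<bullet> unit) = pr \<phi> x"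
    and ax_counit: "D x (\<lambda>p q. eps p * pr \<phi> q) = pr \<phi> x" "D x (\<lambda>p q. eps q * pr \<phi> p) = pr \<phi> x"
    and ax_mul: "D (x \<bullet> y) (\<lambda>p q. pr \<phi> p * pr \<psi> q) =
      D x (\<lambda>p q. D y (\<lambda>r t. pr \<phi> (p \<bullet> r) * pr \<psi> (q \<bullet> t)))"
    and ax_comul_unit:
      "D unit (\<lambda>p q. D q (\<lambda>r t. pr \<phi> p * pr \<psi> r * pr \<chi> t)) =
       D unit (\<lambda>p q. D unit (\<lambda>r t. pr \<phi> p * pr \<psi> (q \<bullet> r) * pr \<chi> t))"
      "D unit (\<lambda>p q. D q (\<lambda>r t. pr \<phi> p * pr \<psi> r * pr \<chi> t)) =
       D unit (\<lambda>p q. D unit (\<lambda>r t. pr \<phi> p * pr \<psi> (r \<bullet> q) * pr \<chi> t))"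
    and ax_eps_mul:
      "eps (x \<bullet> y \<bullet> z) = D y (\<lambda>p q. eps (x \<bullet> p) * eps (q \<bullet> z))"
      "eps (x \<bullet> y \<bullet> z) = D y (\<lambda>p q. eps (x \<bullet> q) * eps (p \<bullet> z))"
    and ax_S1: "D x (\<lambda>p q. pr \<phi> (p \<bullet> S q)) = D unit (\<lambda>p q. eps (p \<bullet> x) * pr \<phi> q)"
    and ax_S2: "D x (\<lambda>p q. pr \<phi> (S p \<bullet> q)) = D unit (\<lambda>p q. eps (x \<bullet> q) * pr \<phi> p)"
    and ax_S3_left: "pr \<phi> (S x) = D x (\<lambda>p q. D p (\<lambda>r t. pr \<phi> (S r \<bullet> t \<bullet> S q)))"
begin

abbreviation D1 where "D1 \<equiv> D unit"

lemma mul_assoc: "(x \<bullet> y) \<bullet> z = x \<bullet> (y \<bullet> z)"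
  by (rule vec_eqI) (simp_all only: vecs_closed ax_assoc)

lemma unit_mul: "x \<in> vecs \<Longrightarrow> unit \<bullet> x = x" and mul_unit: "x \<in> vecs \<Longrightarrow> x \<bullet> unit = x"
  by (rule vec_eqI; simp only: vecs_closed ax_unit)+

lemma unit_mul_mul [simp]: "unit \<bullet> (x \<bullet> y) = x \<bullet> y" "unit \<bullet> S x = S x" "S x \<bullet> unit = S x"
  "unit \<bullet> unit = unit" "x \<bullet> (y \<bullet> unit) = x \<bullet> y"
  by (simp_all only: unit_mul mul_unit vecs_closed mul_assoc[symmetric]) 
     (simp_all only: mul_assoc unit_mul vecs_closed)

lemma lin_unit: "lin f \<Longrightarrow> f (unit \<bullet> x) = f x" "lin f \<Longrightarrow> f (x \<bullet> unit) = f x"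
  by (rule lin_eqI, assumption, rule ax_unit)+

lemma mul_unit_mul [simp]: "x \<bullet> (unit \<bullet> y) = x \<bullet> y"
  by (rule vec_eqI, simp, simp, rule lin_unit(1), intro lin_rules)

lemma D_basis_cong: "(\<And>i j. i \<in> I \<Longrightarrow> j \<in> I \<Longrightarrow> F (bas i) (bas j) = G (bas i) (bas j)) \<Longrightarrow> D x F = D x G"
  unfolding D_def by (auto intro!: sum.cong)

text \<open>
  Holds for arbitrary \<open>F\<close>, not only for trilinear ones, as \<open>D\<close> evaluates its argument on basis
  vectors only; \<open>F\<close> may be replaced by its trilinear extension \<open>G\<close>.
\<close>

lemma coassoc: "D x (\<lambda>p q. D p (\<lambda>r t. F r t q)) = D x (\<lambda>p q. D q (\<lambda>r t. F p r t))"
proof -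
  define G where "G r t q = (\<Sum>i\<in>I. \<Sum>j\<in>I. \<Sum>k\<in>I. F (bas i) (bas j) (bas k) *
     (pr (bas i) r * pr (bas j) t * pr (bas k) q))" for r t q
  have G: "F (bas i) (bas j) (bas k) = G (bas i) (bas j) (bas k)" if "i \<in> I" "j \<in> I" "k \<in> I" for i j k
  proof -
    have "G (bas i) (bas j) (bas k) = (\<Sum>i'\<in>I. \<Sum>j'\<in>I. \<Sum>k'\<in>I. F (bas i') (bas j') (bas k') *
     (bas i' i * bas j' j * bas k' k))"
      unfolding G_def using that by (intro sum.cong refl) simp
    also have "\<dots> = (\<Sum>i'\<in>I. bas i' i * (\<Sum>j'\<in>I. bas j' j * (\<Sum>k'\<in>I. bas k' k * F (bas i') (bas j') (bas k'))))"
      by (simp add: sum_distrib_left mult_ac)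
    also have "\<dots> = F (bas i) (bas j) (bas k)" using that by (simp add: bas_def sum_delta_mult)
    finally show ?thesis by (rule sym)
  qed
  have "D x (\<lambda>p q. D p (\<lambda>r t. F r t q)) = D x (\<lambda>p q. D p (\<lambda>r t. G r t q))"
    by (intro D_basis_cong G)
  also have "\<dots> = D x (\<lambda>p q. D q (\<lambda>r t. G p r t))"
    unfolding G_def by (simp only: D_sum D_scale ax_coassoc)
  also have "\<dots> = D x (\<lambda>p q. D q (\<lambda>r t. F p r t))"
    by (intro D_basis_cong G[symmetric])
  finally show ?thesis .
qed

lemma ax_S3: "pr \<phi> (S x) = D x (\<lambda>p q. D q (\<lambda>r t. pr \<phi> (S p \<bullet> r \<bullet> S t)))"
  unfolding ax_S3_left by (rule coassoc)

lemma counit: "lin f \<Longrightarrow> D x (\<lambda>p q. eps p * f q) = f x" "lin f \<Longrightarrow> D x (\<lambda>p q. eps q * f p) = f x"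
  by (elim lin_obtain, simp only: ax_counit)+

lemma D_mul: 
  assumes F: "blin F" shows "D (x \<bullet> y) F = D x (\<lambda>p q. D y (\<lambda>r t. F (p \<bullet> r) (q \<bullet> t)))"
  using F by (elim blin_obtain) (simp only: D_sum D_scale ax_mul)

lemma D_unit_left:
  assumes F: "blin F" shows "D x F = D1 (\<lambda>a b. D x (\<lambda>p q. F (a \<bullet> p) (b \<bullet> q)))"
  unfolding D_mul[OF F, symmetric] by (rule D_arg_cong) (simp only: ax_unit)

lemma D_unit_right:
  assumes F: "blin F" shows "D x F = D x (\<lambda>p q. D1 (\<lambda>a b. F (p \<bullet> a) (q \<bullet> b)))"
  unfolding D_mul[OF F, symmetric] by (rule D_arg_cong) (simp only: ax_unit)

lemma comul_unit:
  assumes F: "tlin F"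
  shows "D1 (\<lambda>p q. D q (\<lambda>r t. F p r t)) = D1 (\<lambda>p q. D1 (\<lambda>r t. F p (q \<bullet> r) t))"
    and "D1 (\<lambda>p q. D q (\<lambda>r t. F p r t)) = D1 (\<lambda>p q. D1 (\<lambda>r t. F p (r \<bullet> q) t))"
  using F by (elim tlin_obtain, simp only: D_sum D_scale ax_comul_unit(1))
     (use F in \<open>elim tlin_obtain, simp only: D_sum D_scale ax_comul_unit(2)\<close>)

end

section \<open>Counital maps and antipode\<close>

context weak_hopf_coords begin

text \<open>
  The weak multiplicativity of the counit with the unit in the middle; the two orders of \<open>\<Delta> 1\<close>
  give two factorisations of \<open>\<epsilon>(x y)\<close>.
\<close>

lemma eps_mul: "eps (x \<bullet> y) = D1 (\<lambda>p q. eps (p \<bullet> y) * eps (x \<bullet> q))"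
proof -
  have "eps (x \<bullet> y) = eps (x \<bullet> unit \<bullet> y)" by (simp add: mul_assoc)
  also have "\<dots> = D1 (\<lambda>p q. eps (x \<bullet> q) * eps (p \<bullet> y))" by (rule ax_eps_mul)
  finally show ?thesis by (simp add: mult.commute)
qed

lemma eps_mul': "eps (x \<bullet> y) = D1 (\<lambda>p q. eps (x \<bullet> p) * eps (q \<bullet> y))"
proof -
  have "eps (x \<bullet> y) = eps (x \<bullet> unit \<bullet> y)" by (simp add: mul_assoc)
  also have "\<dots> = D1 (\<lambda>p q. eps (x \<bullet> p) * eps (q \<bullet> y))" by (rule ax_eps_mul)
  finally show ?thesis .
qed

lemma eps_et: "eps (x \<bullet> et y) = eps (x \<bullet> y)"
  by (subst lin_et[of "\<lambda>z. eps (x \<bullet> z)"]) (intro lin_rules, rule eps_mul[symmetric])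

lemma eps_es: "eps (es x \<bullet> y) = eps (x \<bullet> y)"
  by (subst lin_es[of "\<lambda>z. eps (z \<bullet> y)"]) (intro lin_rules, simp only: eps_mul[of x y] mult.commute)

text \<open>
  Insert \<open>\<Delta> 1\<close> in front of \<open>\<Delta> x\<close>, absorb the counit into \<open>\<Delta> 1\<close> by the comultiplication of the
  unit, and the counit of \<open>\<Delta>(u\<^sub>1 x)\<close> removes one leg.
\<close>

lemma D_et_right:
  assumes F: "blin F" shows "D x (\<lambda>p q. F p (et q)) = D1 (\<lambda>p q. F (p \<bullet> x) q)"
proof -
  have "D x (\<lambda>p q. F p (et q)) = D1 (\<lambda>a b. D x (\<lambda>p q. F (a \<bullet> p) (et (b \<bullet> q))))"
    by (rule D_unit_left) (intro blinI lin_rules blin_lin[OF F])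
  also have "\<dots> = D1 (\<lambda>a b. D x (\<lambda>p q. D1 (\<lambda>r t. eps (r \<bullet> (b \<bullet> q)) * F (a \<bullet> p) t)))"
    by (simp only: lin_et[OF blinD2[OF F]])
  also have "\<dots> = D1 (\<lambda>a b. D1 (\<lambda>r t. D x (\<lambda>p q. eps (r \<bullet> b \<bullet> q) * F (a \<bullet> p) t)))"
    by (simp only: D_commute[of x unit] mul_assoc)
  also have "\<dots> = D1 (\<lambda>a b. D b (\<lambda>r t. D x (\<lambda>p q. eps (r \<bullet> q) * F (a \<bullet> p) t)))"
    by (rule comul_unit(2)[symmetric]) (intro tlinI lin_rules blin_lin[OF F])
  also have "\<dots> = D1 (\<lambda>a b. D a (\<lambda>r t. D x (\<lambda>p q. eps (t \<bullet> q) * F (r \<bullet> p) b)))"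
    by (rule coassoc[symmetric])
  also have "\<dots> = D1 (\<lambda>a b. D (a \<bullet> x) (\<lambda>p q. eps q * F p b))"
    by (subst D_mul) (intro blinI lin_rules blin_lin[OF F], rule refl)
  also have "\<dots> = D1 (\<lambda>a b. F (a \<bullet> x) b)"
    by (simp only: counit(2)[OF blinD1[OF F]])
  finally show ?thesis .
qed

lemma D_eps_left:
  assumes f: "lin f" shows "D x (\<lambda>p q. eps (y \<bullet> p) * f q) = D1 (\<lambda>p q. eps (y \<bullet> p) * f (q \<bullet> x))"
proof -
  note f' = lin_linv[OF f]
  have "D1 (\<lambda>p q. eps (y \<bullet> p) * f (q \<bullet> x)) = D1 (\<lambda>p q. eps (y \<bullet> p) * D (q \<bullet> x) (\<lambda>r t. eps r * f t))"
    by (simp only: counit(1)[OF f])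
  also have "\<dots> = D1 (\<lambda>p q. D q (\<lambda>a b. D x (\<lambda>r t. eps (y \<bullet> p) * (eps (a \<bullet> r) * f (b \<bullet> t)))))"
    by (subst D_mul) (intro blinI lin_rules f', simp only: D_scale)
  also have "\<dots> = D1 (\<lambda>p q. D1 (\<lambda>a b. D x (\<lambda>r t. eps (y \<bullet> p) * (eps (q \<bullet> a \<bullet> r) * f (b \<bullet> t)))))"
    by (rule comul_unit(1)) (intro tlinI lin_rules f')
  also have "\<dots> = D1 (\<lambda>a b. D x (\<lambda>r t. D1 (\<lambda>p q. eps (y \<bullet> p) * eps (q \<bullet> (a \<bullet> r))) * f (b \<bullet> t)))"
    by (subst D_commute) (simp only: D_commute[of unit x] D_scale_right[symmetric] mul_assoc mult.assoc)
  also have "\<dots> = D1 (\<lambda>a b. D x (\<lambda>r t. eps (y \<bullet> (a \<bullet> r)) * f (b \<bullet> t)))"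
    by (simp only: eps_mul'[symmetric])
  also have "\<dots> = D x (\<lambda>r t. eps (y \<bullet> r) * f t)"
    by (rule D_unit_left[symmetric]) (intro blinI lin_rules f')
  finally show ?thesis by (rule sym)
qed

text \<open>
  The coproduct of an element of the target subalgebra is the coproduct of the unit with that
  element multiplied into the first leg, from either side. In the next two lemmas such an
  element passes through the first leg of any coproduct.
\<close>

lemma D_et: "D (et y) G = D1 (\<lambda>p q. G (p \<bullet> et y) q)" and D_et': "D (et y) G = D1 (\<lambda>p q. G (et y \<bullet> p) q)"
  if G: "blin G"
proof -
  have "D (et y) G = D1 (\<lambda>p q. D q (\<lambda>r t. eps (p \<bullet> y) * G r t))"
    by (subst lin_et[of "\<lambda>z. D z G"]) (intro lin_rules, simp only: D_scale)
  also have 1: "\<dots> = D1 (\<lambda>p q. D1 (\<lambda>r t. eps (p \<bullet> y) * G (q \<bullet> r) t))"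
    by (rule comul_unit(1)) (intro tlinI lin_rules blin_lin[OF G])
  also have "\<dots> = D1 (\<lambda>r t. G (et y \<bullet> r) t)"
    by (subst lin_et[of "\<lambda>z. G (z \<bullet> _) _"]) (intro lin_rules blin_lin[OF G], rule D_commute)
  finally show "D (et y) G = D1 (\<lambda>p q. G (et y \<bullet> p) q)" .
  have "D (et y) G = D1 (\<lambda>p q. D q (\<lambda>r t. eps (p \<bullet> y) * G r t))"
    by (subst lin_et[of "\<lambda>z. D z G"]) (intro lin_rules, simp only: D_scale)
  also have 1: "\<dots> = D1 (\<lambda>p q. D1 (\<lambda>r t. eps (p \<bullet> y) * G (r \<bullet> q) t))"
    by (rule comul_unit(2)) (intro tlinI lin_rules blin_lin[OF G])
  also have "\<dots> = D1 (\<lambda>r t. G (r \<bullet> et y) t)"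
    by (subst lin_et[of "\<lambda>z. G (_ \<bullet> z) _"]) (intro lin_rules blin_lin[OF G], rule D_commute)
  finally show "D (et y) G = D1 (\<lambda>p q. G (p \<bullet> et y) q)" .
qed

lemma D_et_mul:
  assumes F: "blin F" shows "D (et y \<bullet> x) F = D x (\<lambda>p q. F (et y \<bullet> p) q)"
proof -
  have "D (et y \<bullet> x) F = D (et y) (\<lambda>a b. D x (\<lambda>p q. F (a \<bullet> p) (b \<bullet> q)))"
    by (rule D_mul[OF F])
  also have "\<dots> = D1 (\<lambda>a b. D x (\<lambda>p q. F (et y \<bullet> a \<bullet> p) (b \<bullet> q)))"
    by (rule D_et') (intro blinI lin_rules blin_lin[OF F])
  also have "\<dots> = D x (\<lambda>p q. F (et y \<bullet> p) q)"
    unfolding mul_assoc by (rule D_unit_left[symmetric]) (intro blinI lin_rules blin_lin[OF F])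
  finally show ?thesis .
qed

lemma D_mul_et:
  assumes F: "blin F" shows "D (x \<bullet> et y) F = D x (\<lambda>p q. F (p \<bullet> et y) q)"
proof -
  have "D (x \<bullet> et y) F = D (et y) (\<lambda>a b. D x (\<lambda>p q. F (p \<bullet> a) (q \<bullet> b)))"
    unfolding D_mul[OF F] by (rule D_commute)
  also have "\<dots> = D1 (\<lambda>a b. D x (\<lambda>p q. F (p \<bullet> (a \<bullet> et y)) (q \<bullet> b)))"
    by (rule D_et) (intro blinI lin_rules blin_lin[OF F])
  also have "\<dots> = D x (\<lambda>p q. D1 (\<lambda>a b. F (p \<bullet> a \<bullet> et y) (q \<bullet> b)))"
    unfolding mul_assoc by (rule D_commute)
  also have "\<dots> = D x (\<lambda>p q. F (p \<bullet> et y) q)"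
    by (rule D_unit_right[symmetric]) (intro blinI lin_rules blin_lin[OF F])
  finally show ?thesis .
qed

text \<open>
  The two expressions for \<open>\<Delta>\<^sup>2 1\<close> differ by the order of the middle factors; evaluated with \<open>\<epsilon>\<close>
  on the outer legs they are the two products.
\<close>

lemma et_es_commute: "et x \<bullet> es y = es y \<bullet> et x"
proof (rule vec_eqI)
  fix \<phi>
  have "pr \<phi> (et x \<bullet> es y) = D1 (\<lambda>p q. eps (p \<bullet> x) * pr \<phi> (q \<bullet> es y))"
    by (rule lin_et) (intro lin_rules)
  also have "\<dots> = D1 (\<lambda>p q. D1 (\<lambda>r t. eps (p \<bullet> x) * (eps (y \<bullet> t) * pr \<phi> (q \<bullet> r))))"
    by (subst lin_es[of "\<lambda>z. pr \<phi> (_ \<bullet> z)"]) (intro lin_rules, simp only: D_scale)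
  also have "\<dots> = D1 (\<lambda>p q. D1 (\<lambda>r t. eps (p \<bullet> x) * (eps (y \<bullet> t) * pr \<phi> (r \<bullet> q))))"
    by (subst comul_unit(1)[symmetric], intro tlinI lin_rules, subst comul_unit(2), intro tlinI lin_rules, rule refl)
  also have "\<dots> = D1 (\<lambda>p q. eps (p \<bullet> x) * pr \<phi> (es y \<bullet> q))"
    by (subst lin_es[of "\<lambda>z. pr \<phi> (z \<bullet> _)"]) (intro lin_rules, simp only: D_scale)
  also have "\<dots> = pr \<phi> (es y \<bullet> et x)"
    by (rule lin_et[symmetric]) (intro lin_rules)
  finally show "pr \<phi> (et x \<bullet> es y) = pr \<phi> (es y \<bullet> et x)" .
qed auto

lemma D_S1: "lin f \<Longrightarrow> D x (\<lambda>p q. f (p \<bullet> S q)) = f (et x)"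
  by (simp only: lin_et, elim lin_obtain) (simp only: ax_S1)

lemma D_S2: "lin f \<Longrightarrow> D x (\<lambda>p q. f (S p \<bullet> q)) = f (es x)"
  by (simp only: lin_es, elim lin_obtain) (simp only: ax_S2)

text \<open>
  Two ways to bracket \<open>S x\<^sub>1 x\<^sub>2 S x\<^sub>3 = S x\<close>; they show that \<open>S x\<close> is determined by its
  products with counital values.
\<close>

lemma D_S_et: assumes f: "lin f" shows "D x (\<lambda>p q. f (S p \<bullet> et q)) = f (S x)"
proof -
  note f' = lin_linv[OF f]
  have "f (S x) = D x (\<lambda>p q. D q (\<lambda>r t. f (S p \<bullet> (r \<bullet> S t))))"
    using f by (elim lin_obtain) (simp only: ax_S3 mul_assoc)
  also have "\<dots> = D x (\<lambda>p q. f (S p \<bullet> et q))"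
    by (subst D_S1[of "\<lambda>z. f (S _ \<bullet> z)"]) (intro lin_rules f', rule refl)
  finally show ?thesis by (rule sym)
qed

lemma D_es_S: assumes f: "lin f" shows "D x (\<lambda>p q. f (es p \<bullet> S q)) = f (S x)"
proof -
  note f' = lin_linv[OF f]
  have "f (S x) = D x (\<lambda>p q. D q (\<lambda>r t. f (S p \<bullet> r \<bullet> S t)))"
    using f by (elim lin_obtain) (simp only: ax_S3)
  also have "\<dots> = D x (\<lambda>p q. D p (\<lambda>r t. f (S r \<bullet> t \<bullet> S q)))"
    by (rule coassoc[symmetric])
  also have "\<dots> = D x (\<lambda>p q. f (es p \<bullet> S q))"
    by (subst D_S2[of "\<lambda>z. f (z \<bullet> S _)"]) (intro lin_rules f', rule refl)
  finally show ?thesis by (rule sym)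
qed

lemma D_et_mul_id: assumes f: "lin f" shows "D x (\<lambda>p q. f (et p \<bullet> q)) = f x"
proof -
  note f' = lin_linv[OF f]
  have "D x (\<lambda>p q. f (et p \<bullet> q)) = D1 (\<lambda>a b. D x (\<lambda>p q. eps (a \<bullet> p) * f (b \<bullet> q)))"
    by (subst lin_et[of "\<lambda>z. f (z \<bullet> _)"]) (intro lin_rules f', rule D_commute)
  also have "\<dots> = D x (\<lambda>p q. eps p * f q)"
    by (rule D_unit_left[symmetric]) (intro blinI lin_rules f f')
  also have "\<dots> = f x" by (rule counit[OF f])
  finally show ?thesis .
qed

lemma es_unit [simp]: "es unit = unit"
proof (rule vec_eqI)
  fix \<phi>
  have "pr \<phi> (es unit) = D1 (\<lambda>p q. eps (unit \<bullet> q) * pr \<phi> p)" by (rule lin_es) simp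
  also have "\<dots> = D1 (\<lambda>p q. eps q * pr \<phi> p)" by (rule D_cong) (simp only: unit_mul)
  also have "\<dots> = pr \<phi> unit" by (rule counit) simp
  finally show "pr \<phi> (es unit) = pr \<phi> unit" .
qed auto

text \<open>
  The product \<open>S u\<^sub>1 et(u\<^sub>2)\<close> equals \<open>S 1\<close>, and \<open>D_et_right\<close> turns it into
  \<open>S u\<^sub>1 u\<^sub>2 = es 1 = 1\<close>.
\<close>

lemma S_unit [simp]: "S unit = unit"
proof (rule vec_eqI)
  fix \<phi>
  have "pr \<phi> (S unit) = D1 (\<lambda>p q. pr \<phi> (S p \<bullet> et q))" by (rule D_S_et[symmetric]) simp
  also have "\<dots> = D1 (\<lambda>p q. pr \<phi> (S (p \<bullet> unit) \<bullet> q))" by (rule D_et_right) (intro blinI lin_rules)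
  also have "\<dots> = D1 (\<lambda>p q. pr \<phi> (S p \<bullet> q))" by (rule D_cong) (simp only: mul_unit)
  also have "\<dots> = pr \<phi> unit" by (subst D_S2) auto
  finally show "pr \<phi> (S unit) = pr \<phi> unit" .
qed auto

lemma et_mul_et: "et (x \<bullet> et y) = et (x \<bullet> y)"
  by (rule vec_eqI) (simp_all add: lin_et mul_assoc[symmetric] eps_et)

lemma es_es_mul: "es (es x \<bullet> y) = es (x \<bullet> y)"
  by (rule vec_eqI) (simp_all add: lin_es mul_assoc eps_es)

text \<open>
  The antipode axiom for the product \<open>x et(y)\<close>, in which \<open>et(y)\<close> stays inside the first leg.
\<close>

lemma et_mul: assumes f: "lin f" shows "f (et (x \<bullet> et y)) = D x (\<lambda>p q. f (p \<bullet> (et y \<bullet> S q)))"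
proof -
  have "f (et (x \<bullet> et y)) = D (x \<bullet> et y) (\<lambda>p q. f (p \<bullet> S q))" by (rule D_S1[symmetric, OF f])
  also have "\<dots> = D x (\<lambda>p q. f (p \<bullet> et y \<bullet> S q))"
    by (rule D_mul_et) (intro blinI lin_rules lin_linv[OF f])
  finally show ?thesis by (simp only: mul_assoc)
qed

end

section \<open>The opposite-coopposite and the dual algebra\<close>

context weak_hopf_coords begin

interpretation mir: structure_constants I "\<lambda>i j k. m j i k" u "\<lambda>k i j. d k j i" e s
  by unfold_locales (rule finite_I)

lemma mir_mul: "mir.mul x y = y \<bullet> x"
  unfolding mul_def mir.mul_def by (rule ext, subst sum.swap) (simp add: mult.commute)

lemma mir_D: "mir.D x F = D x (\<lambda>p q. F q p)"
  unfolding D_def mir.D_def by (rule sum.swap)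

lemma mir_DV: "mir.DV x F = DV x (\<lambda>p q. F q p)"
  unfolding DV_def mir.DV_def mir_D ..

lemma mir_et: "mir.et x = es x" and mir_es: "mir.es x = et x"
  unfolding et_def es_def mir.et_def mir.es_def mir_DV mir_mul by simp_all

lemmas mir_simps = mir_mul mir_D mir_et mir_es mir_DV

text \<open>
  Reversing the order of both the product and the coproduct leaves the antipode unchanged and
  exchanges the two counital maps, so that every lemma has a mirror image.
\<close>

lemma mirror: "weak_hopf_coords I (\<lambda>i j k. m j i k) u (\<lambda>k i j. d k j i) e s"
proof (rule weak_hopf_coords.intro[OF mir.structure_constants_axioms weak_hopf_coords_axioms.intro])
  fix x y z \<phi> \<psi> \<chi>
  have comul_unit_left:
      "D1 (\<lambda>p q. D p (\<lambda>r t. F r t q)) = D1 (\<lambda>p q. D1 (\<lambda>r t. F r (t \<bullet> p) q))"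
      "D1 (\<lambda>p q. D p (\<lambda>r t. F r t q)) = D1 (\<lambda>p q. D1 (\<lambda>r t. F r (p \<bullet> t) q))" if "tlin F" for F
    by (subst coassoc, subst D_commute, rule comul_unit[OF that])+
  have tl: "tlin (\<lambda>r t q. pr \<phi> q * pr \<psi> t * pr \<chi> r)" by (intro tlinI lin_rules)
  show "pr \<phi> (mir.mul (mir.mul x y) z) = pr \<phi> (mir.mul x (mir.mul y z))"
    by (simp only: mir_simps mul_assoc)
  show "mir.D x (\<lambda>p q. mir.D p (\<lambda>r t. pr \<phi> r * pr \<psi> t * pr \<chi> q)) =
      mir.D x (\<lambda>p q. mir.D q (\<lambda>r t. pr \<phi> p * pr \<psi> r * pr \<chi> t))"
    unfolding mir_D by (rule coassoc[symmetric])
  show "pr \<phi> (mir.mul unit x) = pr \<phi> x" "pr \<phi> (mir.mul x unit) = pr \<phi> x"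
    by (simp_all only: mir_simps ax_unit)
  show "mir.D x (\<lambda>p q. eps p * pr \<phi> q) = pr \<phi> x" "mir.D x (\<lambda>p q. eps q * pr \<phi> p) = pr \<phi> x"
    by (simp_all only: mir_simps ax_counit)
  show "mir.D (mir.mul x y) (\<lambda>p q. pr \<phi> p * pr \<psi> q) =
      mir.D x (\<lambda>p q. mir.D y (\<lambda>r t. pr \<phi> (mir.mul p r) * pr \<psi> (mir.mul q t)))"
    unfolding mir_simps by (subst D_mul, intro blinI lin_rules, rule D_commute)
  show "mir.D unit (\<lambda>p q. mir.D q (\<lambda>r t. pr \<phi> p * pr \<psi> r * pr \<chi> t)) =
       mir.D unit (\<lambda>p q. mir.D unit (\<lambda>r t. pr \<phi> p * pr \<psi> (mir.mul q r) * pr \<chi> t))"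
    "mir.D unit (\<lambda>p q. mir.D q (\<lambda>r t. pr \<phi> p * pr \<psi> r * pr \<chi> t)) =
       mir.D unit (\<lambda>p q. mir.D unit (\<lambda>r t. pr \<phi> p * pr \<psi> (mir.mul r q) * pr \<chi> t))"
    unfolding mir_simps by (rule comul_unit_left[OF tl])+
  show "eps (mir.mul (mir.mul x y) z) = mir.D y (\<lambda>p q. eps (mir.mul x p) * eps (mir.mul q z))"
    unfolding mir_simps mul_assoc[symmetric] ax_eps_mul(1) by (simp only: mult.commute)
  show "eps (mir.mul (mir.mul x y) z) = mir.D y (\<lambda>p q. eps (mir.mul x q) * eps (mir.mul p z))"
    unfolding mir_simps mul_assoc[symmetric] ax_eps_mul(2) by (simp only: mult.commute)
  show "mir.D x (\<lambda>p q. pr \<phi> (mir.mul p (S q))) = mir.D unit (\<lambda>p q. eps (mir.mul p x) * pr \<phi> q)"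
    unfolding mir_simps by (rule ax_S2)
  show "mir.D x (\<lambda>p q. pr \<phi> (mir.mul (S p) q)) = mir.D unit (\<lambda>p q. eps (mir.mul x q) * pr \<phi> p)"
    unfolding mir_simps by (rule ax_S1)
  show "pr \<phi> (S x) = mir.D x (\<lambda>p q. mir.D p (\<lambda>r t. pr \<phi> (mir.mul (mir.mul (S r) t) (S q))))"
    unfolding mir_simps mul_assoc[symmetric] by (rule ax_S3)
qed

interpretation dl: structure_constants I "\<lambda>i j k. d k i j" e "\<lambda>k i j. m i j k" u "\<lambda>i j. s j i"
  by unfold_locales (rule finite_I)

text \<open>
  The dual has the transposed structure constants: its product is the coproduct, its unit the
  counit, and \<open>pr\<close> becomes the pairing between the algebra and its dual.
\<close>

lemma dual_mul: "pr (dl.mul \<phi> \<psi>) x = D x (\<lambda>p q. pr \<phi> p * pr \<psi> q)" 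
proof -
  have "pr (dl.mul \<phi> \<psi>) x = (\<Sum>k\<in>I. \<Sum>i\<in>I. \<Sum>j\<in>I. x k * d k i j * (\<phi> i * \<psi> j))"
    unfolding pr_def dl.mul_def by (intro sum.cong refl) (simp add: sum_distrib_left mult_ac)
  also have "\<dots> = (\<Sum>i\<in>I. \<Sum>k\<in>I. \<Sum>j\<in>I. x k * d k i j * (\<phi> i * \<psi> j))" by (rule sum.swap)
  also have "\<dots> = (\<Sum>i\<in>I. \<Sum>j\<in>I. \<Sum>k\<in>I. x k * d k i j * (\<phi> i * \<psi> j))"
    by (intro sum.cong refl sum.swap)
  also have "\<dots> = D x (\<lambda>p q. pr \<phi> p * pr \<psi> q)"
    unfolding D_def by (intro sum.cong refl) (simp add: sum_distrib_right)
  finally show ?thesis .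
qed

lemma dual_D: "dl.D \<phi> (\<lambda>p q. pr p x * pr q y) = pr \<phi> (x \<bullet> y)"
proof -
  have "dl.D \<phi> (\<lambda>p q. pr p x * pr q y) = (\<Sum>i\<in>I. \<Sum>j\<in>I. \<Sum>k\<in>I. \<phi> k * (x i * y j * m i j k))"
    unfolding dl.D_def by (intro sum.cong refl) (simp add: sum_distrib_left sum_distrib_right mult_ac)
  also have "\<dots> = (\<Sum>i\<in>I. \<Sum>k\<in>I. \<Sum>j\<in>I. \<phi> k * (x i * y j * m i j k))"
    by (intro sum.cong refl sum.swap)
  also have "\<dots> = (\<Sum>k\<in>I. \<Sum>i\<in>I. \<Sum>j\<in>I. \<phi> k * (x i * y j * m i j k))" by (rule sum.swap)
  also have "\<dots> = pr \<phi> (x \<bullet> y)"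
    unfolding pr_def mul_def by (intro sum.cong refl) (simp add: sum_distrib_left)
  finally show ?thesis .
qed

lemma dual_S: "pr (dl.S \<phi>) x = pr \<phi> (S x)"
proof -
  have "pr (dl.S \<phi>) x = (\<Sum>i\<in>I. \<Sum>j\<in>I. \<phi> j * (x i * s i j))"
    unfolding pr_def dl.S_def by (intro sum.cong refl) (simp add: sum_distrib_left mult_ac)
  also have "\<dots> = (\<Sum>j\<in>I. \<Sum>i\<in>I. \<phi> j * (x i * s i j))" by (rule sum.swap)
  also have "\<dots> = pr \<phi> (S x)"
    unfolding pr_def S_def by (intro sum.cong refl) (simp add: sum_distrib_left)
  finally show ?thesis .
qed

lemma dual_unit: "pr dl.unit x = eps x"
  unfolding eps_def pr_def dl.unit_def by (intro sum.cong) auto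

lemma dual_eps: "dl.eps \<phi> = pr \<phi> unit"
  unfolding dl.eps_def pr_def unit_def by (intro sum.cong) (auto simp: mult.commute)

lemma dual_D_commute: "dl.D \<phi> (\<lambda>p q. D x (\<lambda>r t. F p q r t)) = D x (\<lambda>r t. dl.D \<phi> (\<lambda>p q. F p q r t))"
  unfolding dl.D_def by (simp only: D_sum D_scale)

lemma dual_mul': "pr x (dl.mul \<phi> \<psi>) = D x (\<lambda>p q. pr \<phi> p * pr \<psi> q)" 
  by (subst pr_commute) (rule dual_mul)
lemma dual_S': "pr x (dl.S \<phi>) = pr \<phi> (S x)"
  by (subst pr_commute) (rule dual_S)
lemma dual_unit': "pr x dl.unit = eps x"
  by (subst pr_commute) (rule dual_unit)
lemma dual_D2: "dl.D \<phi> (\<lambda>p q. pr x p * pr y q) = pr \<phi> (x \<bullet> y)"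
  using dual_D[of \<phi> x y] by (simp only: pr_commute[of x] pr_commute[of y])
lemma dual_D3: "dl.D \<phi> (\<lambda>p q. pr q y * pr p x) = pr \<phi> (x \<bullet> y)"
  using dual_D[of \<phi> x y] by (simp only: mult.commute)
text \<open>
  A scalar between the two factors occurs when sums over the dual are interchanged with sums
  over the algebra.
\<close>

lemma dual_D_c: "dl.D \<phi> (\<lambda>p q. pr p x * c * pr q y) = pr \<phi> (x \<bullet> y) * c"
   "dl.D \<phi> (\<lambda>p q. pr q y * c * pr p x) = pr \<phi> (x \<bullet> y) * c"
  using dl.D_scale_right[of \<phi> "\<lambda>p q. pr p x * pr q y" c] by (simp_all only: dual_D mult_ac)

text \<open>
  Each axiom of the dual, evaluated on elements, becomes the transposed axiom: associativity and
  coassociativity, the laws for \<open>\<Delta> 1\<close> and for \<open>\<epsilon>(x y z)\<close>, are exchanged in pairs, and the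
  antipode axioms are self-dual.
\<close>

lemma dual_weak_hopf: "weak_hopf_coords I (\<lambda>i j k. d k i j) e (\<lambda>k i j. m i j k) u (\<lambda>i j. s j i)"
proof (rule weak_hopf_coords.intro[OF dl.structure_constants_axioms weak_hopf_coords_axioms.intro])
  fix \<phi> \<psi> \<chi> x y z
  show "pr x (dl.mul (dl.mul \<phi> \<psi>) \<chi>) = pr x (dl.mul \<phi> (dl.mul \<psi> \<chi>))"
    by (simp only: dual_mul' dual_mul D_scale_right[symmetric] D_scale[symmetric] coassoc mult.assoc)
  show "dl.D \<phi> (\<lambda>p q. dl.D p (\<lambda>r t. pr x r * pr y t * pr z q)) =
      dl.D \<phi> (\<lambda>p q. dl.D q (\<lambda>r t. pr x p * pr y r * pr z t))"
  proof -
    have "dl.D \<phi> (\<lambda>p q. dl.D p (\<lambda>r t. pr x r * pr y t * pr z q)) = pr \<phi> (x \<bullet> y \<bullet> z)"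
      by (simp only: dl.D_scale_right dual_D2 pr_commute[of z] dual_D)
    moreover have "dl.D \<phi> (\<lambda>p q. dl.D q (\<lambda>r t. pr x p * pr y r * pr z t)) = pr \<phi> (x \<bullet> (y \<bullet> z))"
      by (simp only: dl.D_scale mult.assoc dual_D2 pr_commute[of x] dual_D)
    ultimately show ?thesis by (simp only: mul_assoc)
  qed
  show "pr x (dl.mul dl.unit \<phi>) = pr x \<phi>" "pr x (dl.mul \<phi> dl.unit) = pr x \<phi>"
    by (simp_all only: dual_mul' dual_unit pr_commute[of x] ax_counit mult.commute[of _ "eps _"])
  show "dl.D \<phi> (\<lambda>p q. dl.eps p * pr x q) = pr x \<phi>" "dl.D \<phi> (\<lambda>p q. dl.eps q * pr x p) = pr x \<phi>"
    by (simp_all only: dual_eps pr_commute[of x] dual_D dual_D3 ax_unit)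
  show "dl.D (dl.mul \<phi> \<psi>) (\<lambda>p q. pr x p * pr y q) =
      dl.D \<phi> (\<lambda>p q. dl.D \<psi> (\<lambda>r t. pr x (dl.mul p r) * pr y (dl.mul q t)))"
  proof -
    have "dl.D \<phi> (\<lambda>p q. dl.D \<psi> (\<lambda>r t. pr x (dl.mul p r) * pr y (dl.mul q t))) =
       dl.D \<phi> (\<lambda>p q. dl.D \<psi> (\<lambda>r t. D y (\<lambda>a' b'. D x (\<lambda>a b. pr p a * pr q a' * (pr r b * pr t b')))))"
      by (simp only: dual_mul' D_scale_right[symmetric] D_scale[symmetric] mult_ac)
    also have "\<dots> = D y (\<lambda>a' b'. D x (\<lambda>a b. pr \<phi> (a \<bullet> a') * pr \<psi> (b \<bullet> b')))"
      by (simp only: dual_D_commute dl.D_scale dl.D_scale_right dual_D)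
    also have "\<dots> = D x (\<lambda>a b. D y (\<lambda>a' b'. pr \<phi> (a \<bullet> a') * pr \<psi> (b \<bullet> b')))" by (rule D_commute)
    finally show ?thesis by (simp only: dual_D2 dual_mul ax_mul)
  qed
  show "dl.D dl.unit (\<lambda>p q. dl.D q (\<lambda>r t. pr x p * pr y r * pr z t)) =
       dl.D dl.unit (\<lambda>p q. dl.D dl.unit (\<lambda>r t. pr x p * pr y (dl.mul q r) * pr z t))"
  proof -
    have "dl.D dl.unit (\<lambda>p q. dl.D dl.unit (\<lambda>r t. pr x p * pr y (dl.mul q r) * pr z t)) =
      dl.D dl.unit (\<lambda>p q. dl.D dl.unit (\<lambda>r t. D y (\<lambda>a b. pr p x * pr q a * (pr r b * pr t z))))"
      by (simp only: dual_mul' D_scale_right[symmetric] D_scale[symmetric] mult_ac pr_commute[of x] pr_commute[of z])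
    also have "\<dots> = eps (x \<bullet> y \<bullet> z)"
      by (simp only: dual_D_commute dl.D_scale dl.D_scale_right dual_D dual_unit ax_eps_mul(1))
    finally show ?thesis
      by (simp only: dl.D_scale_right dl.D_scale mult.assoc dual_D2 pr_commute[of x] dual_D dual_unit mul_assoc)
  qed
  show "dl.D dl.unit (\<lambda>p q. dl.D q (\<lambda>r t. pr x p * pr y r * pr z t)) =
       dl.D dl.unit (\<lambda>p q. dl.D dl.unit (\<lambda>r t. pr x p * pr y (dl.mul r q) * pr z t))"
  proof -
    have "dl.D dl.unit (\<lambda>p q. dl.D dl.unit (\<lambda>r t. pr x p * pr y (dl.mul r q) * pr z t)) =
      dl.D dl.unit (\<lambda>p q. dl.D dl.unit (\<lambda>r t. D y (\<lambda>a b. pr p x * pr q b * (pr r a * pr t z))))"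
      by (simp only: dual_mul' D_scale_right[symmetric] D_scale[symmetric] mult_ac pr_commute[of x] pr_commute[of z])
    also have "\<dots> = eps (x \<bullet> y \<bullet> z)"
      by (simp only: dual_D_commute dl.D_scale dl.D_scale_right dual_D dual_unit ax_eps_mul(2))
    finally show ?thesis
      by (simp only: dl.D_scale_right dl.D_scale mult.assoc dual_D2 pr_commute[of x] dual_D dual_unit mul_assoc)
  qed
  have tl: "tlin (\<lambda>p q r. pr \<phi> p * pr \<psi> q * pr \<chi> r)" by (intro tlinI lin_rules)
  have L: "dl.eps (dl.mul (dl.mul \<phi> \<psi>) \<chi>) = D1 (\<lambda>p q. D q (\<lambda>r t. pr \<phi> p * pr \<psi> r * pr \<chi> t))"
    by (simp only: dual_eps dual_mul D_scale_right[symmetric] coassoc)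
  show "dl.eps (dl.mul (dl.mul \<phi> \<psi>) \<chi>) = dl.D \<psi> (\<lambda>p q. dl.eps (dl.mul \<phi> p) * dl.eps (dl.mul q \<chi>))"
  proof -
    have "dl.D \<psi> (\<lambda>p q. dl.eps (dl.mul \<phi> p) * dl.eps (dl.mul q \<chi>)) =
      dl.D \<psi> (\<lambda>p q. D1 (\<lambda>r t. D1 (\<lambda>a b. pr \<phi> a * (pr p b * pr q r) * pr \<chi> t)))"
      by (simp only: dual_eps dual_mul D_scale_right[symmetric] D_scale[symmetric] mult.assoc)
    also have "\<dots> = D1 (\<lambda>r t. D1 (\<lambda>a b. pr \<phi> a * pr \<psi> (b \<bullet> r) * pr \<chi> t))"
      by (simp only: dual_D_commute dl.D_scale dl.D_scale_right dual_D)
    also have "\<dots> = D1 (\<lambda>a b. D1 (\<lambda>r t. pr \<phi> a * pr \<psi> (b \<bullet> r) * pr \<chi> t))" by (rule D_commute)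
    finally show ?thesis unfolding L by (simp only: comul_unit(1)[OF tl])
  qed
  show "dl.eps (dl.mul (dl.mul \<phi> \<psi>) \<chi>) = dl.D \<psi> (\<lambda>p q. dl.eps (dl.mul \<phi> q) * dl.eps (dl.mul p \<chi>))"
  proof -
    have "dl.D \<psi> (\<lambda>p q. dl.eps (dl.mul \<phi> q) * dl.eps (dl.mul p \<chi>)) =
      dl.D \<psi> (\<lambda>p q. D1 (\<lambda>r t. D1 (\<lambda>a b. pr \<phi> a * (pr q b * pr p r) * pr \<chi> t)))"
      by (simp only: dual_eps dual_mul D_scale_right[symmetric] D_scale[symmetric] mult.assoc)
    also have "\<dots> = D1 (\<lambda>r t. D1 (\<lambda>a b. pr \<phi> a * pr \<psi> (r \<bullet> b) * pr \<chi> t))"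
      by (simp only: dual_D_commute dl.D_scale dl.D_scale_right dual_D3)
    also have "\<dots> = D1 (\<lambda>a b. D1 (\<lambda>r t. pr \<phi> a * pr \<psi> (r \<bullet> b) * pr \<chi> t))" by (rule D_commute)
    finally show ?thesis unfolding L by (simp only: comul_unit(2)[OF tl])
  qed
  show "dl.D \<phi> (\<lambda>p q. pr x (dl.mul p (dl.S q))) = dl.D dl.unit (\<lambda>p q. dl.eps (dl.mul p \<phi>) * pr x q)"
  proof -
    have "dl.D dl.unit (\<lambda>p q. dl.eps (dl.mul p \<phi>) * pr x q) = D1 (\<lambda>p q. eps (p \<bullet> x) * pr \<phi> q)"
      by (simp only: dual_eps dual_mul pr_commute[of x] D_scale_right[symmetric] dual_D_commute dual_D_c dual_unit)
    then show ?thesis by (simp only: dual_mul' dual_S dual_D_commute dual_D ax_S1)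
  qed
  show "dl.D \<phi> (\<lambda>p q. pr x (dl.mul (dl.S p) q)) = dl.D dl.unit (\<lambda>p q. dl.eps (dl.mul \<phi> q) * pr x p)"
  proof -
    have "dl.D dl.unit (\<lambda>p q. dl.eps (dl.mul \<phi> q) * pr x p) = dl.D dl.unit (\<lambda>p q. D1 (\<lambda>a b. pr q b * pr \<phi> a * pr p x))"
      by (simp only: dual_eps dual_mul pr_commute[of x] D_scale_right[symmetric] mult.commute[of "pr \<phi> _"])
    also have "\<dots> = D1 (\<lambda>p q. eps (x \<bullet> q) * pr \<phi> p)"
      by (simp only: dual_D_commute dual_D_c dual_unit)
    finally show ?thesis by (simp only: dual_mul' dual_S dual_D_commute dual_D ax_S2)
  qed
  show "pr x (dl.S \<phi>) = dl.D \<phi> (\<lambda>p q. dl.D p (\<lambda>r t. pr x (dl.mul (dl.mul (dl.S r) t) (dl.S q))))"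
  proof -
    have "dl.D \<phi> (\<lambda>p q. dl.D p (\<lambda>r t. pr x (dl.mul (dl.mul (dl.S r) t) (dl.S q)))) =
      dl.D \<phi> (\<lambda>p q. dl.D p (\<lambda>r t. D x (\<lambda>a b. D a (\<lambda>a' b'. pr r (S a') * pr t b' * pr q (S b)))))"
      by (simp only: dual_mul' dual_mul dual_S D_scale_right[symmetric])
    also have "\<dots> = D x (\<lambda>a b. D a (\<lambda>a' b'. pr \<phi> (S a' \<bullet> b' \<bullet> S b)))"
      by (simp only: dual_D_commute dl.D_scale_right dual_D)
    also have "\<dots> = pr \<phi> (S x)" by (rule ax_S3_left[symmetric])
    finally show ?thesis by (simp only: dual_S')
  qed
qed

end

section \<open>The antipode is antimultiplicative\<close>

context weak_hopf_coords begin

interpretation mir: structure_constants I "\<lambda>i j k. m j i k" u "\<lambda>k i j. d k j i" e s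
  by unfold_locales (rule finite_I)

lemma blin_flip: "blin F \<Longrightarrow> blin (\<lambda>p q. F q p)" by (auto simp: blin_def)

lemma D_es_left: "blin F \<Longrightarrow> D x (\<lambda>p q. F (es p) q) = D1 (\<lambda>p q. F p (x \<bullet> q))"
  using weak_hopf_coords.D_et_right[OF mirror, of "\<lambda>p q. F q p" x, unfolded mir_simps] blin_flip[of F] by simp

lemma D_es: "blin G \<Longrightarrow> D (es y) G = D1 (\<lambda>p q. G p (es y \<bullet> q))"
  using weak_hopf_coords.D_et[OF mirror, of "\<lambda>p q. G q p" y, unfolded mir_simps] blin_flip[of G] by simp

lemma D_mul_es: "blin F \<Longrightarrow> D (x \<bullet> es y) F = D x (\<lambda>p q. F p (q \<bullet> es y))"
  using weak_hopf_coords.D_et_mul[OF mirror, of "\<lambda>p q. F q p" y x, unfolded mir_simps] blin_flip[of F] by simp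

lemma D_mul_es_id: "lin f \<Longrightarrow> D x (\<lambda>p q. f (p \<bullet> es q)) = f x"
  by (rule weak_hopf_coords.D_et_mul_id[OF mirror, unfolded mir_simps])

lemma et_unit [simp]: "et unit = unit"
  by (rule weak_hopf_coords.es_unit[OF mirror, unfolded mir_simps])

lemma es_mul: "lin f \<Longrightarrow> f (es (es y \<bullet> x)) = D x (\<lambda>p q. f (S p \<bullet> (es y \<bullet> q)))"
  using weak_hopf_coords.et_mul[OF mirror, unfolded mir_simps] by (simp only: mul_assoc)

lemma es_mul': "lin f \<Longrightarrow> f (es (y \<bullet> x)) = D x (\<lambda>p q. f (S p \<bullet> (es y \<bullet> q)))"
  by (simp only: es_mul[symmetric] es_es_mul)

text \<open>
  The form of \<open>S x\<^sub>1 x\<^sub>2 = es x\<close> in which the factors belong to two different legs of an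
  iterated coproduct.
\<close>

lemma D_S2': assumes H: "blin H" shows "D x (\<lambda>p q. H (es p) q) = D x (\<lambda>p q. D q (\<lambda>r t. H (S p \<bullet> r) t))"
proof -
  have "D x (\<lambda>p q. H (es p) q) = D x (\<lambda>p q. D p (\<lambda>r t. H (S r \<bullet> t) q))"
    by (simp only: D_S2[OF blinD1[OF H]])
  then show ?thesis by (simp only: coassoc)
qed

text \<open>
  Expand \<open>S(x y) = es(x\<^sub>1 y\<^sub>1) S(x\<^sub>2 y\<^sub>2)\<close> and \<open>es(x\<^sub>1 y\<^sub>1) = S y\<^sub>1 es(x\<^sub>1) y\<^sub>2\<close>. The resulting
  factors on the right assemble to \<open>et(x y)\<close> by the antipode axiom, and
  \<open>et(x y) = x\<^sub>1 et(y) S x\<^sub>2\<close>; after exchanging \<open>es\<close> and \<open>et\<close> what remains is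
  \<open>S y\<^sub>1 et(y\<^sub>2) es(x\<^sub>1) S x\<^sub>2 = S y S x\<close>.
\<close>

lemma S_mul: "S (x \<bullet> y) = S y \<bullet> S x"
proof (rule vec_eqI)
  fix \<phi> define f where "f = pr \<phi>"
  have f: "lin f" by (simp add: f_def)
  note lr = lin_rules lin_linv[OF f]
  have "f (S (x \<bullet> y)) = D x (\<lambda>p q. D y (\<lambda>r t. f (es (p \<bullet> r) \<bullet> S (q \<bullet> t))))"
    unfolding D_es_S[OF f, symmetric] by (rule D_mul) (intro blinI lr)
  also have "\<dots> = D x (\<lambda>p q. D y (\<lambda>r t. D r (\<lambda>a b. f (S a \<bullet> (es p \<bullet> (b \<bullet> S (q \<bullet> t)))))))"
    by (subst es_mul'[of "\<lambda>z. f (z \<bullet> _)"], intro lr) (simp only: mul_assoc)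
  also have "\<dots> = D x (\<lambda>p q. D y (\<lambda>r t. D t (\<lambda>a b. f (S r \<bullet> (es p \<bullet> (a \<bullet> S (q \<bullet> b)))))))"
    by (intro D_cong coassoc)
  also have "\<dots> = D x (\<lambda>p q. D q (\<lambda>c g. D y (\<lambda>r t. D t (\<lambda>a b. f (S r \<bullet> (S p \<bullet> c \<bullet> (a \<bullet> S (g \<bullet> b))))))))"
    by (rule D_S2') (intro blinI lr)
  also have "\<dots> = D x (\<lambda>p q. D y (\<lambda>r t. D q (\<lambda>c g. D t (\<lambda>a b. f (S r \<bullet> (S p \<bullet> (c \<bullet> a \<bullet> S (g \<bullet> b))))))))"
    unfolding mul_assoc by (intro D_cong D_commute)
  also have "\<dots> = D x (\<lambda>p q. D y (\<lambda>r t. f (S r \<bullet> (S p \<bullet> et (q \<bullet> t)))))"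
    by (subst D_S1[of "\<lambda>z. f (_ \<bullet> (_ \<bullet> z))", symmetric], intro lr, subst D_mul, intro blinI lr, rule refl)
  also have "\<dots> = D x (\<lambda>p q. D y (\<lambda>r t. D q (\<lambda>c g. f (S r \<bullet> (S p \<bullet> (c \<bullet> (et t \<bullet> S g)))))))"
    by (subst et_mul_et[symmetric], subst et_mul[of "\<lambda>z. f (_ \<bullet> (_ \<bullet> z))"], intro lr, rule refl)
  also have "\<dots> = D x (\<lambda>p q. D q (\<lambda>c g. D y (\<lambda>r t. f (S r \<bullet> (S p \<bullet> c \<bullet> (et t \<bullet> S g))))))"
    unfolding mul_assoc by (intro D_cong D_commute)
  also have "\<dots> = D x (\<lambda>p q. D y (\<lambda>r t. f (S r \<bullet> (es p \<bullet> (et t \<bullet> S q)))))"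
    by (rule D_S2'[symmetric]) (intro blinI lr)
  also have "\<dots> = D x (\<lambda>p q. D y (\<lambda>r t. f (S r \<bullet> et t \<bullet> (es p \<bullet> S q))))"
    by (simp only: mul_assoc[symmetric, of "es _" "et _"] et_es_commute[symmetric]) (simp only: mul_assoc)
  also have "\<dots> = D x (\<lambda>p q. f (S y \<bullet> (es p \<bullet> S q)))"
    by (subst D_S_et[of "\<lambda>z. f (z \<bullet> _)"]) (intro lr, rule refl)
  also have "\<dots> = f (S y \<bullet> S x)"
    by (rule D_es_S) (intro lr)
  finally show "pr \<phi> (S (x \<bullet> y)) = pr \<phi> (S y \<bullet> S x)" by (simp only: f_def)
qed auto

interpretation dl: structure_constants I "\<lambda>i j k. d k i j" e "\<lambda>k i j. m i j k" u "\<lambda>i j. s j i"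
  by unfold_locales (rule finite_I)

lemma eps_S [simp]: "eps (S x) = eps x"
proof -
  have "dl.S dl.unit = dl.unit" by (rule weak_hopf_coords.S_unit[OF dual_weak_hopf])
  then have "pr (dl.S dl.unit) x = pr dl.unit x" by simp
  then show ?thesis by (simp only: dual_S dual_unit)
qed

text \<open>
  Antimultiplicativity of the antipode of the dual, read as a statement about coproducts.
\<close>

lemma D_S:
  assumes F: "blin F" shows "D (S x) F = D x (\<lambda>p q. F (S q) (S p))"
proof (rule rank_one2[OF _ F])
  fix \<phi> \<psi>
  have "pr (dl.S (dl.mul \<phi> \<psi>)) x = pr (dl.mul (dl.S \<psi>) (dl.S \<phi>)) x"
    by (simp only: weak_hopf_coords.S_mul[OF dual_weak_hopf])
  then show "D (S x) (\<lambda>p q. pr \<phi> p * pr \<psi> q) = D x (\<lambda>p q. pr \<phi> (S q) * pr \<psi> (S p))"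
    by (simp only: dual_S dual_mul mult.commute)
qed

lemma D_unit_S: "blin F \<Longrightarrow> D1 (\<lambda>p q. F (S q) (S p)) = D1 F"
  using D_S[of F unit] by simp

text \<open>
  Since \<open>\<Delta>(es y) = u\<^sub>1 \<otimes> es(y) u\<^sub>2\<close>, the antipode axiom at \<open>es y\<close> leaves \<open>et 1 S(es y)\<close>.
\<close>

lemma et_es: "et (es y) = S (es y)"
proof (rule vec_eqI)
  fix \<phi>
  have "pr \<phi> (et (es y)) = D (es y) (\<lambda>p q. pr \<phi> (p \<bullet> S q))" by (rule D_S1[symmetric]) simp
  also have "\<dots> = D1 (\<lambda>p q. pr \<phi> (p \<bullet> S q \<bullet> S (es y)))"
    unfolding mul_assoc S_mul[symmetric] by (rule D_es) (intro blinI lin_rules)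
  also have "\<dots> = pr \<phi> (et unit \<bullet> S (es y))" by (rule D_S1) (intro lin_rules)
  finally show "pr \<phi> (et (es y)) = pr \<phi> (S (es y))" by simp
qed auto

lemma es_et: "es (et y) = S (et y)"
  by (rule weak_hopf_coords.et_es[OF mirror, unfolded mir_simps])

lemma D_unit_es: "blin F \<Longrightarrow> D1 (\<lambda>p q. F (es p) q) = D1 F"
  by (subst D_es_left, assumption, rule D_cong) (simp only: unit_mul)

lemma D_unit_et: "blin F \<Longrightarrow> D1 (\<lambda>p q. F p (et q)) = D1 F"
  by (subst D_et_right, assumption, rule D_cong) (simp only: mul_unit)

text \<open>
  The counterpart of \<open>D_et_right\<close> on the other leg; the antipode enters because \<open>et\<close> of a value
  of \<open>es\<close> is its antipode.
\<close>

lemma D_et_left: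
  assumes F: "blin F" shows "D x (\<lambda>p q. F (et p) q) = D1 (\<lambda>p q. F (S p) (q \<bullet> x))"
proof -
  note lr = lin_rules blin_lin[OF F]
  have "D x (\<lambda>p q. F (et p) q) = D1 (\<lambda>a b. D x (\<lambda>p q. eps (a \<bullet> p) * F b q))"
    by (subst lin_et[OF blinD1[OF F]]) (rule D_commute)
  also have "\<dots> = D1 (\<lambda>a b. D1 (\<lambda>p q. eps (a \<bullet> p) * F b (q \<bullet> x)))"
    by (subst D_eps_left) (intro lr, rule refl)
  also have "\<dots> = D1 (\<lambda>p q. F (et p) (q \<bullet> x))"
    by (subst D_commute, subst lin_et[OF blinD1[OF F]]) (rule refl)
  also have "\<dots> = D1 (\<lambda>p q. F (et (es p)) (q \<bullet> x))"
    by (rule D_unit_es[symmetric]) (intro blinI lr)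
  also have "\<dots> = D1 (\<lambda>p q. F (S p) (q \<bullet> x))"
    unfolding et_es by (rule D_unit_es) (intro blinI lr)
  finally show ?thesis .
qed

end

section \<open>The antipode is bijective\<close>

text \<open>
  Gaussian elimination: one equation is used to eliminate one unknown. It is stated for
  arbitrary index sets, as it is applied with the matrix entries as equations and the powers of
  an endomorphism as unknowns.
\<close>

lemma homogeneous_system_nontrivial:
  fixes f :: "'a \<Rightarrow> 'j \<Rightarrow> 'k::field"
  assumes "finite J" "finite A" "card J < card A"
  shows "\<exists>c. (\<exists>a\<in>A. c a \<noteq> 0) \<and> (\<forall>j\<in>J. (\<Sum>a\<in>A. c a * f a j) = 0)"
  using assms
proof (induction J arbitrary: A f rule: finite_induct)
  case empty
  then obtain a where "a \<in> A" by fastforce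
  then show ?case by (intro exI[of _ "\<lambda>_. 1"]) auto
next
  case (insert j J)
  show ?case
  proof (cases "\<forall>a\<in>A. f a j = 0")
    case True
    have "card J < card A" using insert by simp
    from insert.IH[OF insert.prems(1) this, of f] True show ?thesis by auto
  next
    case False
    then obtain b where b: "b \<in> A" "f b j \<noteq> 0" by blast
    define f' where "f' a i = f a i - f a j / f b j * f b i" for a i
    have "card J < card (A - {b})" using insert b by simp
    from insert.IH[OF _ this, of f'] insert.prems(1) obtain c where
      c: "\<exists>a\<in>A-{b}. c a \<noteq> 0" "\<And>i. i \<in> J \<Longrightarrow> (\<Sum>a\<in>A-{b}. c a * f' a i) = 0" by auto
    define c' where "c' a = (if a = b then - (\<Sum>a\<in>A-{b}. c a * f a j) / f b j else c a)" for a
    have *: "(\<Sum>a\<in>A. c' a * f a i) = (\<Sum>a\<in>A-{b}. c a * f' a i)" for i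
    proof -
      have "(\<Sum>a\<in>A. c' a * f a i) = c' b * f b i + (\<Sum>a\<in>A-{b}. c' a * f a i)"
        using b insert.prems(1) by (simp add: sum.remove)
      also have "(\<Sum>a\<in>A-{b}. c' a * f a i) = (\<Sum>a\<in>A-{b}. c a * f a i)"
        by (intro sum.cong) (auto simp: c'_def)
      also have "c' b * f b i = - (\<Sum>a\<in>A-{b}. c a * (f a j / f b j * f b i))"
        by (simp add: c'_def sum_distrib_left sum_distrib_right sum_divide_distrib mult.assoc)
      finally show ?thesis by (simp add: f'_def right_diff_distrib sum_subtractf)
    qed
    have "f' a j = 0" for a using b by (simp add: f'_def)
    then have "\<forall>i\<in>insert j J. (\<Sum>a\<in>A. c' a * f a i) = 0" unfolding * using c(2) by auto
    moreover have "\<exists>a\<in>A. c' a \<noteq> 0" using c(1) by (auto simp: c'_def)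
    ultimately show ?thesis by blast
  qed
qed

context structure_constants begin

lemma lin_lincomb: "lin f \<Longrightarrow> f (\<lambda>k. \<Sum>i\<in>J. c i * g i k) = (\<Sum>i\<in>J. c i * f (g i))"
  by (elim lin_obtain) (simp add: pr_def sum_distrib_left sum.swap[of _ J] mult.left_commute)

lemma linv_funpow: "linv T \<Longrightarrow> linv (T ^^ n)"
proof (induction n)
  case (Suc n)
  from linv_comp[OF Suc.prems Suc.IH[OF Suc.prems]] show ?case by (simp add: comp_def)
qed (simp add: id_def linv_id)

text \<open>
  More powers of \<open>T\<close> than matrix entries satisfy a linear relation. Dividing it by its lowest
  non-zero coefficient, at \<open>T\<^sup>n\<close>, writes \<open>T\<^sup>n\<close> as \<open>T^(n+1)\<close> times a polynomial \<open>R\<close> in \<open>T\<close>.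
\<close>

lemma fitting:
  assumes T: "linv T" "\<And>x. x \<in> vecs \<Longrightarrow> T x \<in> vecs"
  obtains R n where "linv R" "\<And>x. x \<in> vecs \<Longrightarrow> R x \<in> vecs" "\<And>x. x \<in> vecs \<Longrightarrow> R (T x) = T (R x)"
    "\<And>x. x \<in> vecs \<Longrightarrow> (T ^^ n) x = (T ^^ Suc n) (R x)"
proof -
  let ?N = "card (I \<times> I)"
  note lT = lin_linv[OF _ linv_funpow[OF T(1)]]
  obtain c where c: "\<exists>i\<in>{..?N}. c i \<noteq> 0" and c0: "\<And>a b. a \<in> I \<Longrightarrow> b \<in> I \<Longrightarrow> (\<Sum>i\<le>?N. c i * (T ^^ i) (bas a) b) = 0"
    using homogeneous_system_nontrivial[of "I \<times> I" "{..?N}" "\<lambda>i (a, b). (T ^^ i) (bas a) b"] finite_I by auto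
  have zero: "(\<Sum>i\<le>?N. c i * pr \<phi> ((T ^^ i) x)) = 0" for \<phi> x
  proof -
    have "lin (\<lambda>x. \<Sum>i\<le>?N. c i * pr \<phi> ((T ^^ i) x))" by (intro lin_sum lin_scale lT lin_pr)
    from lin_expand[OF this, of x]
    have "(\<Sum>i\<le>?N. c i * pr \<phi> ((T ^^ i) x)) = (\<Sum>a\<in>I. (\<Sum>i\<le>?N. c i * pr \<phi> ((T ^^ i) (bas a))) * x a)" .
    also have "\<dots> = (\<Sum>a\<in>I. (\<Sum>b\<in>I. \<phi> b * (\<Sum>i\<le>?N. c i * (T ^^ i) (bas a) b)) * x a)"
      by (simp add: pr_def sum_distrib_left sum.swap[of _ "{..?N}"] mult_ac)
    also have "\<dots> = 0" by (simp add: c0)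
    finally show ?thesis .
  qed
  define n where "n = (LEAST i. i \<le> ?N \<and> c i \<noteq> 0)"
  have n: "n \<le> ?N" "c n \<noteq> 0" using LeastI_ex[of "\<lambda>i. i \<le> ?N \<and> c i \<noteq> 0"] c by (auto simp: n_def)
  have small: "c i = 0" if "i < n" for i
    using not_less_Least[of i "\<lambda>i. i \<le> ?N \<and> c i \<noteq> 0"] that n by (auto simp: n_def[symmetric])
  define R where "R x = (\<lambda>k. \<Sum>i\<in>{Suc n..?N}. (- c i / c n) * (T ^^ (i - Suc n)) x k)" for x
  have pow: "(T ^^ i) x \<in> vecs" if "x \<in> vecs" for i x using that by (induction i) (auto intro: T(2))
  have fR: "f (R x) = (\<Sum>i\<in>{Suc n..?N}. (- c i / c n) * f ((T ^^ (i - Suc n)) x))" if "lin f" for f x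
    unfolding R_def by (rule lin_lincomb[OF that])
  have R: "R x \<in> vecs" if "x \<in> vecs" for x using pow[OF that] by (auto simp: R_def vecs_def)
  show thesis
  proof (rule that[of R n])
    show "linv R"
    proof (rule linvI)
      fix k assume "k \<in> I"
      show "lin (\<lambda>x. R x k)" unfolding R_def by (intro lin_sum lin_scale lT lin_coord \<open>k \<in> I\<close>)
    qed
    show "R (T x) = T (R x)" if x: "x \<in> vecs" for x
    proof (rule vec_eqI)
      fix \<phi> show "pr \<phi> (R (T x)) = pr \<phi> (T (R x))"
        unfolding fR[OF lin_pr] fR[OF lin_linv[OF lin_pr T(1)]] by (simp add: funpow_swap1)
    qed (auto intro!: R T(2) x)
    show "(T ^^ n) x = (T ^^ Suc n) (R x)" if x: "x \<in> vecs" for x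
    proof (rule vec_eqI)
      fix \<phi>
      have "pr \<phi> ((T ^^ Suc n) (R x)) = (\<Sum>i\<in>{Suc n..?N}. (- c i / c n) * pr \<phi> ((T ^^ i) x))"
        unfolding fR[OF lT[OF lin_pr]] by (intro sum.cong refl) (metis atLeastAtMost_iff comp_apply funpow_add le_add_diff_inverse)
      also have "\<dots> = - (\<Sum>i\<in>{Suc n..?N}. c i * pr \<phi> ((T ^^ i) x)) / c n"
        by (simp add: sum_divide_distrib sum_negf)
      also have "(\<Sum>i\<in>{Suc n..?N}. c i * pr \<phi> ((T ^^ i) x)) = - (c n * pr \<phi> ((T ^^ n) x))"
      proof -
        have "{..?N} = {..<n} \<union> {n} \<union> {Suc n..?N}" using n(1) by auto
        then have "0 = (\<Sum>i\<in>{..<n} \<union> {n} \<union> {Suc n..?N}. c i * pr \<phi> ((T ^^ i) x))" using zero[of \<phi> x] by simp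
        also have "\<dots> = c n * pr \<phi> ((T ^^ n) x) + (\<Sum>i\<in>{Suc n..?N}. c i * pr \<phi> ((T ^^ i) x))"
          by (subst sum.union_disjoint, auto simp: small)
        finally show ?thesis by (simp add: eq_neg_iff_add_eq_0 add.commute)
      qed
      finally show "pr \<phi> ((T ^^ n) x) = pr \<phi> ((T ^^ Suc n) (R x))" using n(2) by simp
    qed (auto intro!: pow R x simp del: funpow.simps)
  qed (rule R)
qed

text \<open>
  An injective endomorphism satisfies \<open>T\<^sup>n = T\<^sup>n T R\<close>, and \<open>T\<^sup>n\<close> can be cancelled.
\<close>

lemma left_inverse_right_inverse:
  assumes T: "linv T" "\<And>x. x \<in> vecs \<Longrightarrow> T x \<in> vecs" and Q: "\<And>x. x \<in> vecs \<Longrightarrow> Q x \<in> vecs"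
    and QT: "\<And>x. x \<in> vecs \<Longrightarrow> Q (T x) = x" and x: "x \<in> vecs"
  shows "T (Q x) = x"
proof -
  obtain R n where R: "linv R" "\<And>x. x \<in> vecs \<Longrightarrow> R x \<in> vecs" "\<And>x. x \<in> vecs \<Longrightarrow> R (T x) = T (R x)"
    "\<And>x. x \<in> vecs \<Longrightarrow> (T ^^ n) x = (T ^^ Suc n) (R x)" by (rule fitting[OF T], assumption, rule that)
  have pow: "(T ^^ i) y \<in> vecs" if "y \<in> vecs" for i y using that by (induction i) (auto intro: T(2))
  have inj: "y = z" if "(T ^^ i) y = (T ^^ i) z" "y \<in> vecs" "z \<in> vecs" for i y z
    using that
  proof (induction i)
    case (Suc i)
    then have "Q (T ((T ^^ i) y)) = Q (T ((T ^^ i) z))" by simp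
    then have "(T ^^ i) y = (T ^^ i) z" using QT pow Suc.prems by simp
    then show ?case using Suc by blast
  qed simp
  have "(T ^^ n) x = (T ^^ n) (T (R x))" using R(4)[OF x] by (simp add: funpow_swap1)
  then have "x = T (R x)" using inj T(2) R(2) x by blast
  then show ?thesis using QT[OF R(2)[OF x]] by simp
qed

end

context weak_hopf_coords begin

text \<open>
  The image of \<open>S\<close> generates in a sense that suffices for multiplicative maps \<open>f\<close> and \<open>P\<close>: first
  \<open>f = P\<close> on counital values, because \<open>\<Delta> 1\<close> is fixed by \<open>S \<otimes> S\<close> up to a flip; then
  \<open>f x = f x\<^sub>1 P(es x\<^sub>2) = f x\<^sub>1 P(S x\<^sub>2) P(x\<^sub>3) = f(x\<^sub>1 S x\<^sub>2) P(x\<^sub>3) = P(et(x\<^sub>1) x\<^sub>2) = P x\<close>.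
  The product \<open>st\<close> may be the opposite one, to cover antimultiplicative maps.
\<close>

lemma S_epi:
  assumes f: "linv f" and P: "linv P"
    and st: "\<And>g x. linv g \<Longrightarrow> linv (\<lambda>y. st (g y) x)" "\<And>g x. linv g \<Longrightarrow> linv (\<lambda>y. st x (g y))"
    and assoc: "\<And>x y z. st (st x y) z = st x (st y z)"
    and fmul: "\<And>x y. x \<in> vecs \<Longrightarrow> y \<in> vecs \<Longrightarrow> f (x \<bullet> y) = st (f x) (f y)"
    and Pmul: "\<And>x y. x \<in> vecs \<Longrightarrow> y \<in> vecs \<Longrightarrow> P (x \<bullet> y) = st (P x) (P y)"
    and fS: "\<And>x. x \<in> vecs \<Longrightarrow> f (S x) = P (S x)"
  shows "pr \<phi> (f x) = pr \<phi> (P x)"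
proof -
  note lr = lin_rules linv_comp[OF f] linv_comp[OF P] st
  have es: "h (f (es q)) = h (P (es q))" if h: "lin h" for h q
  proof -
    note lh = lr lin_linv[OF h]
    have "h (f (es q)) = D1 (\<lambda>a b. eps (q \<bullet> b) * h (f a))" by (rule lin_es) (intro lh)
    also have "\<dots> = D1 (\<lambda>a b. eps (q \<bullet> S a) * h (f (S b)))" by (rule D_unit_S[symmetric]) (intro blinI lh)
    also have "\<dots> = D1 (\<lambda>a b. eps (q \<bullet> S a) * h (P (S b)))" by (rule D_cong) (simp only: fS)
    also have "\<dots> = D1 (\<lambda>a b. eps (q \<bullet> b) * h (P a))" by (rule D_unit_S) (intro blinI lh)
    also have "\<dots> = h (P (es q))" by (rule lin_es[symmetric]) (intro lh)
    finally show ?thesis .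
  qed
  have et: "h (f (et q)) = h (P (et q))" if h: "lin h" for h q
  proof -
    note lh = lr lin_linv[OF h]
    have "h (f (et q)) = D1 (\<lambda>a b. eps (a \<bullet> q) * h (f b))" by (rule lin_et) (intro lh)
    also have "\<dots> = D1 (\<lambda>a b. eps (S b \<bullet> q) * h (f (S a)))" by (rule D_unit_S[symmetric]) (intro blinI lh)
    also have "\<dots> = D1 (\<lambda>a b. eps (S b \<bullet> q) * h (P (S a)))" by (rule D_cong) (simp only: fS)
    also have "\<dots> = D1 (\<lambda>a b. eps (a \<bullet> q) * h (P b))" by (rule D_unit_S) (intro blinI lh)
    also have "\<dots> = h (P (et q))" by (rule lin_et[symmetric]) (intro lh)
    finally show ?thesis .
  qed
  have "pr \<phi> (f x) = D x (\<lambda>p q. pr \<phi> (f (p \<bullet> es q)))" by (rule D_mul_es_id[symmetric]) (intro lr)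
  also have "\<dots> = D x (\<lambda>p q. pr \<phi> (st (f p) (P (es q))))"
    by (rule D_cong) (simp only: fmul et_vecs, rule es, intro lr)
  also have "\<dots> = D x (\<lambda>p q. D q (\<lambda>r t. pr \<phi> (st (f p) (P (S r \<bullet> t)))))"
    by (subst D_S2[of "\<lambda>z. pr \<phi> (st _ (P z))"]) (intro lr, rule refl)
  also have "\<dots> = D x (\<lambda>p q. D q (\<lambda>r t. pr \<phi> (st (f (p \<bullet> S r)) (P t))))"
    by (rule D_cong, rule D_cong) (simp only: Pmul fmul assoc fS vecs_closed)
  also have "\<dots> = D x (\<lambda>p q. D p (\<lambda>r t. pr \<phi> (st (f (r \<bullet> S t)) (P q))))" by (rule coassoc[symmetric])
  also have "\<dots> = D x (\<lambda>p q. pr \<phi> (st (f (et p)) (P q)))"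
    by (subst D_S1[of "\<lambda>z. pr \<phi> (st (f z) _)"]) (intro lr, rule refl)
  also have "\<dots> = D x (\<lambda>p q. pr \<phi> (P (et p \<bullet> q)))"
    by (rule D_cong) (simp only: Pmul et_vecs, rule et, intro lr)
  also have "\<dots> = pr \<phi> (P x)" by (rule D_et_mul_id) (intro lr)
  finally show ?thesis .
qed

lemma S_pow_vecs: "x \<in> vecs \<Longrightarrow> (S ^^ n) x \<in> vecs"
  by (induction n) auto

text \<open>
  Starting from \<open>S\<^sup>n = S^(n+1) R\<close>, the maps \<open>f = S^(n-1)\<close> and \<open>P = S\<^sup>n R\<close> agree on the image of
  \<open>S\<close>, and both are multiplicative or antimultiplicative according to the parity; for \<open>P\<close> this
  holds because \<open>S\<close> is injective on the image of \<open>S\<^sup>n\<close>. Then \<open>f = P\<close> by \<open>S_epi\<close>, and descending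
  to \<open>n = 0\<close> gives \<open>S R = id\<close>.
\<close>

lemma S_bij: obtains R where "linv R" "\<And>x. x \<in> vecs \<Longrightarrow> R x \<in> vecs" "\<And>x. x \<in> vecs \<Longrightarrow> R (S x) = x"
    "\<And>x. x \<in> vecs \<Longrightarrow> S (R x) = x"
proof -
  obtain R n where R: "linv R" "\<And>x. x \<in> vecs \<Longrightarrow> R x \<in> vecs" "\<And>x. x \<in> vecs \<Longrightarrow> R (S x) = S (R x)"
    and n: "\<And>x. x \<in> vecs \<Longrightarrow> (S ^^ n) x = (S ^^ Suc n) (R x)" by (rule fitting[OF linv_S0 vecs_closed(3)]) (rule that)
  define st where "st n x y = (if even n then x \<bullet> y else y \<bullet> x)" for n :: nat and x y
  have st_assoc: "st n (st n x y) z = st n x (st n y z)" for n x y z by (simp add: st_def mul_assoc)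
  have S_st: "S (st n x y) = st (Suc n) (S x) (S y)" for n x y by (simp add: st_def S_mul)
  have pow_mul: "(S ^^ n) (x \<bullet> y) = st n ((S ^^ n) x) ((S ^^ n) y)" for n x y
    by (induction n) (simp_all add: S_st, simp add: st_def)
  have Rpow: "R ((S ^^ n) x) = (S ^^ n) (R x)" if "x \<in> vecs" for n x
    using that by (induction n) (simp_all add: R(3) S_pow_vecs)
  have st_vecs: "st n x y \<in> vecs" for n x y by (simp add: st_def)
  have descend: "(S ^^ n) x = (S ^^ Suc n) (R x)"
    if n: "\<And>x. x \<in> vecs \<Longrightarrow> (S ^^ Suc n) x = (S ^^ Suc (Suc n)) (R x)" and x: "x \<in> vecs" for n x
  proof -
    define P where "P x = (S ^^ Suc n) (R x)" for x
    have PS: "S (P x) = (S ^^ Suc n) x" if "x \<in> vecs" for x using n[OF that] by (simp add: P_def)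
    have inj: "y = z" if "S y = S z" "y = (S ^^ Suc n) y'" "z = (S ^^ Suc n) z'" "y' \<in> vecs" "z' \<in> vecs" for y z y' z'
    proof -
      have "y = R (S y)" using n[OF that(4)] Rpow[OF that(4), of "Suc (Suc n)"] that(2) by simp
      moreover have "z = R (S z)" using n[OF that(5)] Rpow[OF that(5), of "Suc (Suc n)"] that(3) by simp
      ultimately show ?thesis using that(1) by simp
    qed
    have "pr \<phi> ((S ^^ n) x) = pr \<phi> (P x)" for \<phi>
    proof (rule S_epi[of "S ^^ n" P "st n"])
      show "linv (S ^^ n)" by (rule linv_funpow[OF linv_S0])
      show "linv P" unfolding P_def by (rule linv_comp[OF linv_funpow[OF linv_S0] R(1)])
      show "linv (\<lambda>y. st n (g y) x)" "linv (\<lambda>y. st n x (g y))" if "linv g" for g x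
        unfolding st_def by (cases "even n"; simp only: if_True if_False; intro lin_rules that)+
      show "st n (st n x y) z = st n x (st n y z)" for x y z by (rule st_assoc)
      show "(S ^^ n) (x \<bullet> y) = st n ((S ^^ n) x) ((S ^^ n) y)" for x y by (rule pow_mul)
      show "P (x \<bullet> y) = st n (P x) (P y)" if xy: "x \<in> vecs" "y \<in> vecs" for x y
      proof (rule inj)
        show "S (P (x \<bullet> y)) = S (st n (P x) (P y))"
          unfolding S_st PS[OF xy(1)] PS[OF xy(2)] pow_mul[symmetric] by (rule PS) simp
        show "P (x \<bullet> y) = (S ^^ Suc n) (R (x \<bullet> y))" by (simp only: P_def)
        show "st n (P x) (P y) = (S ^^ Suc n) (R y \<bullet> R x)"
          unfolding P_def pow_mul by (simp add: st_def)
      qed (simp_all add: st_vecs R)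
      show "(S ^^ n) (S x) = P (S x)" if x: "x \<in> vecs" for x
        using n[OF x] R(3)[OF x] by (simp add: P_def funpow_swap1)
    qed
    then show ?thesis using x by (intro vec_eqI) (auto simp: P_def S_pow_vecs R simp del: funpow.simps)
  qed
  have "\<forall>x\<in>vecs. (S ^^ n) x = (S ^^ Suc n) (R x)" using n by blast
  then have "\<forall>x\<in>vecs. (S ^^ 0) x = (S ^^ Suc 0) (R x)"
  proof (induction n)
    case (Suc n)
    have "\<forall>x\<in>vecs. (S ^^ n) x = (S ^^ Suc n) (R x)"
    proof
      fix x assume x: "x \<in> vecs"
      show "(S ^^ n) x = (S ^^ Suc n) (R x)" by (rule descend[OF bspec[OF Suc.prems] x])
    qed
    then show ?case by (rule Suc.IH)
  qed
  then have "\<And>x. x \<in> vecs \<Longrightarrow> S (R x) = x" by simp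
  then show thesis using that[of R] R by simp
qed

end

section \<open>Dual integrals and the Frobenius structure\<close>

context weak_hopf_coords begin

lemma lin_pr_arg: "lin (\<lambda>\<phi>. pr \<phi> z)"
  by (simp only: pr_commute[of _ z] lin_pr)

text \<open>
  The choice is unique on \<open>vecs\<close>; the linearity required is that on all functions.
\<close>

definition Sinv :: "('i \<Rightarrow> 'k) \<Rightarrow> 'i \<Rightarrow> 'k" where
  "Sinv = (SOME R. linv R \<and> (\<forall>x\<in>vecs. R x \<in> vecs \<and> R (S x) = x \<and> S (R x) = x))"

lemma Sinv_props: "linv Sinv \<and> (\<forall>x\<in>vecs. Sinv x \<in> vecs \<and> Sinv (S x) = x \<and> S (Sinv x) = x)"
proof -
  have "\<exists>R. linv R \<and> (\<forall>x\<in>vecs. R x \<in> vecs \<and> R (S x) = x \<and> S (R x) = x)"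
    by (rule S_bij) (intro exI conjI ballI; assumption?; simp)
  then show ?thesis unfolding Sinv_def by (rule someI_ex)
qed

lemma linv_Sinv0: "linv Sinv" and Sinv_vecs [simp]: "x \<in> vecs \<Longrightarrow> Sinv x \<in> vecs"
  and Sinv_S: "x \<in> vecs \<Longrightarrow> Sinv (S x) = x" and S_Sinv: "x \<in> vecs \<Longrightarrow> S (Sinv x) = x"
  using Sinv_props by auto

lemmas linv_Sinv = linv_comp[OF linv_Sinv0]

lemma S_unit_mul: "S (unit \<bullet> x) = S x" by (simp add: S_mul)

lemma Sinv_S_lin: "lin f \<Longrightarrow> f (Sinv (S x)) = f x"
  using Sinv_S[of "unit \<bullet> x"] by (simp add: S_unit_mul lin_unit)

lemma S_inj: "S x = S y \<Longrightarrow> x \<in> vecs \<Longrightarrow> y \<in> vecs \<Longrightarrow> x = y"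
  using Sinv_S by metis

lemma D_unit_Sinv: assumes F: "blin F" shows "D1 (\<lambda>p q. F (Sinv q) (Sinv p)) = D1 F"
proof -
  have "D1 (\<lambda>p q. F (Sinv q) (Sinv p)) = D1 (\<lambda>p q. F (Sinv (S p)) (Sinv (S q)))"
    by (rule D_unit_S[symmetric]) (intro blinI lin_rules blin_lin[OF F] linv_Sinv)
  also have "\<dots> = D1 F" by (rule D_cong) (simp only: Sinv_S)
  finally show ?thesis .
qed

lemma es_es: "es (es x) = es x"
  by (rule vec_eqI) (simp_all add: lin_es eps_es)

text \<open>
  The Galois map \<open>h \<otimes> x \<mapsto> S h\<^sub>1 h\<^sub>2 x\<^sub>1 \<otimes> h\<^sub>3 x\<^sub>2\<close>: the factor \<open>S h\<^sub>1 h\<^sub>2 = es(h\<^sub>1)\<close> is absorbed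
  by \<open>\<Delta> 1\<close>.
\<close>

lemma galois:
  assumes F: "blin F"
  shows "D h (\<lambda>a b. D (b \<bullet> x) (\<lambda>p q. F (S a \<bullet> p) q)) = D x (\<lambda>p q. F p (h \<bullet> q))"
proof -
  note lr = lin_rules blin_lin[OF F]
  have "D h (\<lambda>a b. D (b \<bullet> x) (\<lambda>p q. F (S a \<bullet> p) q)) =
     D h (\<lambda>a b. D b (\<lambda>c g. D x (\<lambda>p q. F (S a \<bullet> c \<bullet> p) (g \<bullet> q))))"
    by (subst D_mul, intro blinI lr) (simp only: mul_assoc)
  also have "\<dots> = D h (\<lambda>a b. D x (\<lambda>p q. F (es a \<bullet> p) (b \<bullet> q)))"
    by (rule D_S2'[symmetric]) (intro blinI lr)
  also have "\<dots> = D1 (\<lambda>a b. D x (\<lambda>p q. F (a \<bullet> p) (h \<bullet> b \<bullet> q)))"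
    by (rule D_es_left) (intro blinI lr)
  also have "\<dots> = D x (\<lambda>p q. F p (h \<bullet> q))"
    unfolding mul_assoc by (rule D_unit_left[symmetric]) (intro blinI lr)
  finally show ?thesis .
qed

text \<open>
  The invariance of an integral functional \<open>\<psi>\<close> puts \<open>et\<close> on the first leg of \<open>\<Delta>(h\<^sub>2 x)\<close> in
  \<open>galois\<close>, where \<open>et(y\<^sub>1) \<otimes> y\<^sub>2 = S u\<^sub>1 \<otimes> u\<^sub>2 y\<close>, with \<open>u\<close> the unit; this removes the coproduct
  of \<open>x\<close>.
\<close>

lemma integral_functional_move:
  assumes \<psi>: "lin \<psi>" and int: "\<And>f x. lin f \<Longrightarrow> D x (\<lambda>p q. f p * \<psi> q) = D x (\<lambda>p q. f (et p) * \<psi> q)"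
    and f: "lin f"
  shows "D x (\<lambda>p q. f p * \<psi> (h \<bullet> q)) = D h (\<lambda>p q. f (S p) * \<psi> (q \<bullet> x))"
proof -
  note lr = lin_rules lin_linv[OF f] lin_linv[OF \<psi>]
  have "D x (\<lambda>p q. f p * \<psi> (h \<bullet> q)) = D h (\<lambda>a b. D (b \<bullet> x) (\<lambda>p q. f (S a \<bullet> p) * \<psi> q))"
    by (rule galois[symmetric]) (intro blinI lr)
  also have "\<dots> = D h (\<lambda>a b. D (b \<bullet> x) (\<lambda>p q. f (S a \<bullet> et p) * \<psi> q))"
    by (intro D_cong int lr)
  also have "\<dots> = D h (\<lambda>a b. D1 (\<lambda>p q. f (S a \<bullet> S p) * \<psi> (q \<bullet> (b \<bullet> x))))"
    by (subst D_et_left[of "\<lambda>z q. f (_ \<bullet> z) * \<psi> q"]) (intro blinI lr, rule refl)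
  also have "\<dots> = D1 (\<lambda>p q. D h (\<lambda>a b. f (S (p \<bullet> a)) * \<psi> (q \<bullet> b \<bullet> x)))"
    by (subst D_commute) (simp only: S_mul mul_assoc)
  also have "\<dots> = D h (\<lambda>p q. f (S p) * \<psi> (q \<bullet> x))"
    by (rule D_unit_left[symmetric]) (intro blinI lr)
  finally show ?thesis .
qed

end

text \<open>
  The hypotheses of the theorem in coordinates. They are symmetric in \<open>l\<close> and \<open>\<lambda>\<close>, in the sense
  that exchanging the two gives the same hypotheses for the dual algebra.
\<close>

locale dual_integrals = weak_hopf_coords I m u d e s
  for I :: "'i set" and m :: "'i \<Rightarrow> 'i \<Rightarrow> 'i \<Rightarrow> 'k::field" and u d e s +
  fixes l lam :: "'i \<Rightarrow> 'k"
  assumes l_vecs: "l \<in> vecs" and lam_vecs: "lam \<in> vecs"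
    and l_int: "pr \<phi> (x \<bullet> l) = pr \<phi> (et x \<bullet> l)"
    and lam_int: "D x (\<lambda>p q. pr \<phi> p * pr lam q) = D x (\<lambda>p q. pr \<phi> (et p) * pr lam q)"
    and lam_l: "D l (\<lambda>p q. pr \<phi> p * pr lam q) = pr \<phi> unit"
    and l_lam: "pr lam (x \<bullet> l) = eps x"
    and S2_et: "S (S (et x)) = et x"
    and S2_es: "S (S (es x)) = es x"
begin

abbreviation L where "L \<equiv> pr lam"

lemma L_int: "lin f \<Longrightarrow> D x (\<lambda>p q. f p * L q) = D x (\<lambda>p q. f (et p) * L q)"
  by (elim lin_obtain) (simp only: lam_int)

text \<open>
  The integral property turns the coproduct of \<open>h\<^sub>2 l\<close> in \<open>galois\<close> into that of \<open>et(h\<^sub>2) l\<close>, and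
  \<open>S h\<^sub>1 et(h\<^sub>2) = S h\<close>.
\<close>

lemma l_move:
  assumes F: "blin F" shows "D l (\<lambda>p q. F p (h \<bullet> q)) = D l (\<lambda>p q. F (S h \<bullet> p) q)"
proof -
  note lr = lin_rules blin_lin[OF F]
  have 1: "D (b \<bullet> l) G = D l (\<lambda>p q. G (et b \<bullet> p) q)" if G: "blin G" for b G
  proof -
    have "D (b \<bullet> l) G = D (et b \<bullet> l) G" by (rule D_arg_cong) (rule l_int)
    then show ?thesis by (simp only: D_et_mul[OF G])
  qed
  have "D l (\<lambda>p q. F p (h \<bullet> q)) = D h (\<lambda>a b. D (b \<bullet> l) (\<lambda>p q. F (S a \<bullet> p) q))"
    by (rule galois[OF F, symmetric])
  also have "\<dots> = D h (\<lambda>a b. D l (\<lambda>p q. F (S a \<bullet> et b \<bullet> p) q))"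
    by (subst 1) (intro blinI lr, simp only: mul_assoc)
  also have "\<dots> = D l (\<lambda>p q. F (S h \<bullet> p) q)"
    by (rule D_S_et) (intro lr)
  finally show ?thesis .
qed

text \<open>
  The element \<open>l \<leftharpoonup> \<lambda>\<close>.
\<close>

definition a :: "'i \<Rightarrow> 'k" where "a = DV l (\<lambda>p q. sc (L p) q)"

lemma a_vecs [simp]: "a \<in> vecs" by (simp add: a_def)

lemma lin_a: "lin f \<Longrightarrow> f a = D l (\<lambda>p q. L p * f q)"
  by (simp add: a_def lin_DV lin_f_sc)

text \<open>
  By \<open>l_move\<close> and \<open>\<lambda> \<rightharpoonup> l = 1\<close>. The antipode is thus determined by the pair of integrals.
\<close>

lemma S_from_integrals: assumes f: "lin f" shows "D l (\<lambda>p q. f p * L (h \<bullet> q)) = f (S h)"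
proof -
  note lr = lin_rules lin_linv[OF f]
  have "D l (\<lambda>p q. f p * L (h \<bullet> q)) = D l (\<lambda>p q. f (S h \<bullet> p) * L q)"
    by (rule l_move) (intro blinI lr)
  also have "\<dots> = f (S h \<bullet> unit)"
  proof -
    have "lin (\<lambda>z. f (S h \<bullet> z))" by (intro lr)
    then show ?thesis by (elim lin_obtain) (simp only: lam_l fun_eq_iff)
  qed
  finally show ?thesis by simp
qed

text \<open>
  The other evaluation of \<open>l_move\<close>, which produces \<open>a\<close> in place of the unit.
\<close>

lemma L_S_l: assumes f: "lin f" shows "D l (\<lambda>p q. L (S h \<bullet> p) * f q) = f (h \<bullet> a)"
proof -
  note lr = lin_rules lin_linv[OF f]
  have "D l (\<lambda>p q. L (S h \<bullet> p) * f q) = D l (\<lambda>p q. L p * f (h \<bullet> q))"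
    by (rule l_move[symmetric]) (intro blinI lr)
  also have "\<dots> = f (h \<bullet> a)" by (rule lin_a[symmetric]) (intro lr)
  finally show ?thesis .
qed

text \<open>
  The rule \<open>integral_functional_move\<close> for \<open>\<lambda>\<close> at \<open>x = l\<close>. The left-hand side is \<open>\<alpha> \<rightharpoonup> h\<close>.
\<close>

lemma L_l_S: assumes f: "lin f" shows "D h (\<lambda>p q. f p * L (l \<bullet> q)) = D l (\<lambda>p q. f (S p) * L (q \<bullet> h))"
  by (rule integral_functional_move[OF lin_pr L_int f])

text \<open>
  The first formula with the antipode inverted is a reproducing formula: \<open>S\<^sup>-\<^sup>1 l\<^sub>1 \<otimes> l\<^sub>2\<close> is
  the pair of dual bases of the form \<open>\<lambda>(x y)\<close>. In finite dimension a one-sided reproducing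
  formula is two-sided, which is the second expansion.
\<close>

lemma frobenius_expand1: assumes f: "lin f" shows "D l (\<lambda>p q. f (Sinv p) * L (h \<bullet> q)) = f h"
  using S_from_integrals[OF lin_linv[OF f linv_Sinv0], of h] by (simp only: Sinv_S_lin[OF f])

lemma frobenius_expand2: assumes f: "lin f" shows "D l (\<lambda>p q. L (Sinv p \<bullet> x) * f q) = f x"
proof -
  define T where "T x = (\<lambda>i. if i \<in> I then L (bas i \<bullet> x) else 0)" for x
  define Q where "Q \<phi> = DV l (\<lambda>p q. sc (pr \<phi> (Sinv p)) q)" for \<phi>
  have T: "pr (T x) y = L (y \<bullet> x)" for x y
  proof -
    have "lin (\<lambda>y. L (y \<bullet> x))" by (intro lin_rules)
    from lin_expand[OF this, of y] show ?thesis by (simp add: pr_def T_def)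
  qed
  have Q: "g (Q \<phi>) = D l (\<lambda>p q. pr \<phi> (Sinv p) * g q)" if "lin g" for g \<phi>
    using that by (simp add: Q_def lin_DV lin_f_sc)
  have TQ: "T (Q \<phi>) = \<phi>" if "\<phi> \<in> vecs" for \<phi>
  proof (rule vec_eqI)
    fix x
    have "pr (T (Q \<phi>)) x = D l (\<lambda>p q. pr \<phi> (Sinv p) * L (x \<bullet> q))"
      unfolding T by (rule Q) (intro lin_rules)
    also have "\<dots> = pr \<phi> x" by (rule frobenius_expand1) simp
    finally show "pr x (T (Q \<phi>)) = pr x \<phi>" by (simp only: pr_commute[of x])
  qed (use that in \<open>auto simp: T_def vecs_def\<close>)
  have QV: "Q \<phi> \<in> vecs" and TV: "T x \<in> vecs" for \<phi> x
    by (simp add: Q_def) (simp add: T_def vecs_def)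
  have "Q (T (unit \<bullet> x)) = unit \<bullet> x"
  proof (rule left_inverse_right_inverse[of Q T])
    show "linv Q"
    proof (rule linvI)
      fix k assume k: "k \<in> I"
      show "lin (\<lambda>\<phi>. Q \<phi> k)" unfolding Q[OF lin_coord[OF k]] by (intro lin_rules lin_pr_arg)
    qed
  qed (simp_all add: TQ QV TV)
  then have "f (Q (T (unit \<bullet> x))) = f x" by (simp only: lin_unit[OF f])
  then show ?thesis
    unfolding Q[OF f] T by (simp only: lin_unit(1)[of "\<lambda>z. L (_ \<bullet> z)"] lin_rules)
qed

text \<open>
  Moving \<open>\<psi>\<close> with \<open>h = 1\<close> leaves only \<open>\<psi>(u\<^sub>2 l)\<close> to be known, where \<open>u\<close> is the unit; \<open>\<lambda>\<close>
  therefore generates the integral functionals over the counital subalgebras.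
\<close>

lemma integral_functional_unique:
  assumes \<psi>: "lin \<psi>" and int: "\<And>f x. lin f \<Longrightarrow> D x (\<lambda>p q. f p * \<psi> q) = D x (\<lambda>p q. f (et p) * \<psi> q)"
  shows "\<psi> x = D1 (\<lambda>p q. L (p \<bullet> x) * \<psi> (q \<bullet> l))"
proof -
  note lr = lin_rules lin_linv[OF \<psi>] linv_Sinv
  define f where "f r = L (Sinv r \<bullet> x)" for r
  have f: "lin f" unfolding f_def by (intro lr)
  define \<omega> where "\<omega> t = D1 (\<lambda>p q. L (p \<bullet> t) * \<psi> (q \<bullet> l))" for t
  have \<omega>: "lin \<omega>" unfolding \<omega>_def by (intro lr)
  have "\<psi> x = D l (\<lambda>p q. f p * \<psi> q)" unfolding f_def by (rule frobenius_expand2[OF \<psi>, symmetric])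
  also have "\<dots> = D l (\<lambda>p q. f p * \<psi> (unit \<bullet> q))" by (simp only: lin_unit[OF \<psi>])
  also have "\<dots> = D1 (\<lambda>p q. f (S p) * \<psi> (q \<bullet> l))" by (rule integral_functional_move[OF \<psi> int f])
  also have "\<dots> = D1 (\<lambda>p q. D l (\<lambda>r t. f r * L (p \<bullet> t)) * \<psi> (q \<bullet> l))" by (simp only: S_from_integrals[OF f])
  also have "\<dots> = D l (\<lambda>r t. D1 (\<lambda>p q. f r * L (p \<bullet> t) * \<psi> (q \<bullet> l)))"
    by (subst D_commute) (simp only: D_scale_right)
  also have "\<dots> = D l (\<lambda>r t. f r * \<omega> t)"
    by (simp only: \<omega>_def D_scale mult.assoc)
  also have "\<dots> = \<omega> x" unfolding f_def by (rule frobenius_expand2[OF \<omega>])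
  finally show ?thesis by (simp only: \<omega>_def)
qed

text \<open>
  The functional \<open>x \<mapsto> \<lambda>(x\<^sub>1) f(x\<^sub>2)\<close> is again left invariant, by coassociativity, so uniqueness
  expresses it through \<open>\<lambda>\<close> and its values on \<open>et(q) l\<close>; these involve \<open>a\<close> by \<open>L_S_l\<close>.
\<close>

lemma L_comul: assumes f: "lin f" shows "D x (\<lambda>p q. L p * f q) = D1 (\<lambda>p q. L (p \<bullet> x) * f (Sinv q \<bullet> a))"
proof -
  note lr = lin_rules lin_linv[OF f] linv_Sinv
  define \<psi> where "\<psi> x = D x (\<lambda>p q. L p * f q)" for x
  have \<psi>: "lin \<psi>" unfolding \<psi>_def by (rule lin_D_arg0)
  have int: "D x (\<lambda>p q. g p * \<psi> q) = D x (\<lambda>p q. g (et p) * \<psi> q)" if g: "lin g" for g x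
  proof -
    have "D x (\<lambda>p q. g p * \<psi> q) = D x (\<lambda>p q. D p (\<lambda>r t. g r * L t) * f q)"
      unfolding \<psi>_def by (simp only: D_scale[symmetric] D_scale_right[symmetric] coassoc mult.assoc)
    also have "\<dots> = D x (\<lambda>p q. D p (\<lambda>r t. g (et r) * L t) * f q)" by (simp only: L_int[OF g])
    also have "\<dots> = D x (\<lambda>p q. g (et p) * \<psi> q)"
      unfolding \<psi>_def by (simp only: D_scale[symmetric] D_scale_right[symmetric] coassoc mult.assoc)
    finally show ?thesis .
  qed
  have 1: "\<psi> (et q \<bullet> l) = f (Sinv (et q) \<bullet> a)" for q
  proof -
    have "\<psi> (et q \<bullet> l) = D l (\<lambda>p r. L (S (Sinv (et q)) \<bullet> p) * f r)"
      unfolding \<psi>_def S_Sinv[OF et_vecs(1)] by (rule D_et_mul) (intro blinI lr f lin_pr)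
    then show ?thesis by (simp only: L_S_l[OF f])
  qed
  have "\<psi> x = D1 (\<lambda>p q. L (p \<bullet> x) * \<psi> (q \<bullet> l))" by (rule integral_functional_unique[OF \<psi> int])
  also have "\<dots> = D1 (\<lambda>p q. L (p \<bullet> x) * \<psi> (et q \<bullet> l))"
    by (rule D_unit_et[symmetric]) (intro blinI lr lin_linv[OF \<psi>])
  also have "\<dots> = D1 (\<lambda>p q. L (p \<bullet> x) * f (Sinv q \<bullet> a))"
    unfolding 1 by (rule D_unit_et) (intro blinI lr)
  finally show ?thesis by (simp only: \<psi>_def)
qed

text \<open>
  Apply \<open>L_comul\<close> inside the coproduct of \<open>a = \<lambda>(l\<^sub>1) l\<^sub>2\<close>: \<open>a\<^sub>1 \<otimes> a\<^sub>2 = \<lambda>(l\<^sub>1) l\<^sub>2 \<otimes> l\<^sub>3\<close>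
  becomes \<open>u\<^sub>1 a \<otimes> u\<^sub>2 a\<close>, with \<open>u\<close> the unit.
\<close>

lemma D_a: assumes F: "blin F" shows "D a F = D1 (\<lambda>p q. F (p \<bullet> a) (q \<bullet> a))"
proof -
  note lr = lin_rules blin_lin[OF F] linv_Sinv
  have "D a F = D l (\<lambda>p q. L p * D q F)" by (rule lin_a) (rule lin_D_arg0)
  also have "\<dots> = D l (\<lambda>p q. D p (\<lambda>r t. L r * F t q))" by (simp only: coassoc D_scale)
  also have "\<dots> = D l (\<lambda>p q. D1 (\<lambda>c g. L (c \<bullet> p) * F (Sinv g \<bullet> a) q))"
    by (subst L_comul[of "\<lambda>t. F t _"]) (intro lr, rule refl)
  also have "\<dots> = D1 (\<lambda>c g. D l (\<lambda>p q. L (S (Sinv c) \<bullet> p) * F (Sinv g \<bullet> a) q))"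
    by (subst D_commute) (rule D_cong, simp only: S_Sinv)
  also have "\<dots> = D1 (\<lambda>c g. F (Sinv g \<bullet> a) (Sinv c \<bullet> a))"
    by (subst L_S_l) (intro lr, rule refl)
  also have "\<dots> = D1 (\<lambda>p q. F (p \<bullet> a) (q \<bullet> a))"
    by (rule D_unit_Sinv) (intro blinI lr)
  finally show ?thesis .
qed

lemma eps_mul_a: "eps (h \<bullet> a) = eps h"
proof -
  have "eps (h \<bullet> a) = D l (\<lambda>p q. L (S h \<bullet> p) * eps q)" by (rule L_S_l[symmetric, OF lin_eps0])
  also have "\<dots> = L (S h \<bullet> l)"
    by (subst mult.commute) (rule counit(2), intro lin_rules)
  finally show ?thesis by (simp add: l_lam)
qed

text \<open>
  By \<open>L_S_l\<close> and \<open>frobenius_expand2\<close>, \<open>b a = 1\<close> if \<open>\<lambda>(S b x) = \<lambda>(S\<^sup>-\<^sup>1 x)\<close> for all \<open>x\<close>; this is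
  solved by expanding the functional \<open>\<lambda> S\<^sup>-\<^sup>1\<close> in the dual bases.
\<close>

definition b :: "'i \<Rightarrow> 'k" where "b = Sinv (DV l (\<lambda>p q. sc (L (Sinv q)) (Sinv p)))"

lemma b_vecs [simp]: "b \<in> vecs" by (simp add: b_def)

lemma b_a: "b \<bullet> a = unit"
proof (rule vec_eqI)
  fix \<phi>
  have 1: "L (S b \<bullet> x) = L (Sinv x)" for x
  proof -
    have "L (S b \<bullet> x) = D l (\<lambda>p q. L (Sinv q) * L (Sinv p \<bullet> x))"
      by (simp add: b_def S_Sinv, subst lin_DV[of "\<lambda>z. L (z \<bullet> x)"], intro lin_rules, subst lin_f_sc[of "\<lambda>z. L (z \<bullet> x)"], intro lin_rules, rule refl)
    also have "\<dots> = L (Sinv x)"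
      by (subst mult.commute) (rule frobenius_expand2, intro lin_rules linv_Sinv0)
    finally show ?thesis .
  qed
  have "pr \<phi> (b \<bullet> a) = D l (\<lambda>p q. L (S b \<bullet> p) * pr \<phi> q)" by (rule L_S_l[symmetric]) simp
  also have "\<dots> = D l (\<lambda>p q. L (Sinv p \<bullet> unit) * pr \<phi> q)"
    unfolding 1 by (rule D_cong) (simp only: mul_unit Sinv_vecs)
  also have "\<dots> = pr \<phi> unit" by (rule frobenius_expand2) simp
  finally show "pr \<phi> (b \<bullet> a) = pr \<phi> unit" .
qed auto

text \<open>
  The element \<open>x a\<close> determines the functional \<open>\<lambda>(S x q)\<close>, hence \<open>x\<close>. This makes the left inverse
  \<open>b\<close> also a right inverse.
\<close>

lemma mul_a_inj: assumes "x \<bullet> a = y \<bullet> a" "x \<in> vecs" "y \<in> vecs" shows "x = y"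
proof -
  have 1: "L (S x \<bullet> S h) = L (h \<bullet> (x \<bullet> a))" for x h
  proof -
    have "L (S x \<bullet> S h) = D l (\<lambda>p q. L (S x \<bullet> p) * L (h \<bullet> q))"
      by (rule S_from_integrals[symmetric]) (intro lin_rules)
    also have "\<dots> = L (h \<bullet> (x \<bullet> a))" by (rule L_S_l) (intro lin_rules)
    finally show ?thesis .
  qed
  have 2: "L (S x \<bullet> q) = L (S y \<bullet> q)" if "q \<in> vecs" for q
    using 1[of x "Sinv q"] 1[of y "Sinv q"] assms(1) that by (simp add: S_Sinv)
  have "S x = S y"
  proof (rule vec_eqI)
    fix \<phi>
    have "pr \<phi> (S x) = D l (\<lambda>p q. pr \<phi> (Sinv p) * L (S x \<bullet> q))" by (rule frobenius_expand1[symmetric]) simp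
    also have "\<dots> = D l (\<lambda>p q. pr \<phi> (Sinv p) * L (S y \<bullet> q))" by (rule D_cong) (simp only: 2)
    also have "\<dots> = pr \<phi> (S y)" by (rule frobenius_expand1) simp
    finally show "pr \<phi> (S x) = pr \<phi> (S y)" .
  qed auto
  then show ?thesis by (rule S_inj[OF _ assms(2,3)])
qed

lemma a_b: "a \<bullet> b = unit"
  by (rule mul_a_inj) (simp_all add: mul_assoc b_a mul_unit unit_mul)

lemma eps_mul_b: "eps (h \<bullet> b) = eps h"
  using eps_mul_a[of "h \<bullet> b"] by (simp add: mul_assoc b_a lin_unit[OF lin_eps0])

end

section \<open>The distinguished group-like element\<close>

context dual_integrals begin

lemma Sinv_et: "Sinv (et x) = es (et x)"
  using Sinv_S[OF et_vecs(2), of "et x"] by (simp add: es_et S2_et)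

text \<open>
  Comparing the coproduct of \<open>l es(y)\<close> with \<open>L_comul\<close> shows that \<open>a es(y) a\<^sup>-\<^sup>1\<close> is a
  combination of values \<open>S\<^sup>-\<^sup>1(et q)\<close>. These lie in the source subalgebra, since \<open>S\<^sup>-\<^sup>1 = S\<close> on
  the target subalgebra by the assumption on \<open>S\<^sup>2\<close>.
\<close>

lemma conj_a_es: "es (a \<bullet> es y \<bullet> b) = a \<bullet> es y \<bullet> b"
proof (rule vec_eqI)
  fix \<phi>
  have 1: "f (a \<bullet> es y \<bullet> b) = D1 (\<lambda>p q. L (p \<bullet> (l \<bullet> es y)) * f (es (et q)))" if f: "lin f" for f
  proof -
    note lr = lin_rules lin_linv[OF f] linv_Sinv
    have "f (a \<bullet> es y \<bullet> b) = D l (\<lambda>p q. L p * f (q \<bullet> es y \<bullet> b))" by (rule lin_a) (intro lr)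
    also have "\<dots> = D (l \<bullet> es y) (\<lambda>p q. L p * f (q \<bullet> b))"
      by (rule D_mul_es[symmetric]) (intro blinI lr)
    also have "\<dots> = D1 (\<lambda>p q. L (p \<bullet> (l \<bullet> es y)) * f (Sinv q \<bullet> a \<bullet> b))"
      by (rule L_comul) (intro lr)
    also have "\<dots> = D1 (\<lambda>p q. L (p \<bullet> (l \<bullet> es y)) * f (Sinv q))"
      unfolding mul_assoc a_b by (rule D_cong) (simp only: mul_unit Sinv_vecs)
    also have "\<dots> = D1 (\<lambda>p q. L (p \<bullet> (l \<bullet> es y)) * f (Sinv (et q)))"
      by (rule D_unit_et[symmetric]) (intro blinI lr)
    finally show ?thesis by (simp only: Sinv_et)
  qed
  have "pr \<phi> (es (a \<bullet> es y \<bullet> b)) = D1 (\<lambda>p q. L (p \<bullet> (l \<bullet> es y)) * pr \<phi> (es (es (et q))))"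
    by (rule 1) (intro lin_rules)
  then show "pr \<phi> (es (a \<bullet> es y \<bullet> b)) = pr \<phi> (a \<bullet> es y \<bullet> b)"
    by (simp add: es_es 1)
qed auto

text \<open>
  On the source subalgebra \<open>es S\<close> is \<open>S\<^sup>2\<close>, hence the identity.
\<close>

lemma es_S_es: "es (S (es y)) = es y"
  by (simp only: et_es[symmetric] es_et) (simp only: et_es S2_es)

text \<open>
  The counit is a trace on the source subalgebra because \<open>es(x)\<close> commutes with
  \<open>et(es y) = S(es y)\<close>, and the antipode can be undone under \<open>es\<close>.
\<close>

lemma eps_es_commute: "eps (es x \<bullet> es y) = eps (es y \<bullet> es x)"
proof -
  have "eps (es x \<bullet> es y) = eps (es x \<bullet> et (es y))" by (simp add: eps_et)
  also have "\<dots> = eps (et (es y) \<bullet> es x)" by (simp add: et_es_commute)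
  also have "\<dots> = eps (es (et (es y)) \<bullet> es x)" by (simp add: eps_es)
  finally show ?thesis by (simp only: et_es es_S_es)
qed

lemma eps_S_et_es: "eps (S (et q) \<bullet> es y) = eps (es y \<bullet> q)"
proof -
  have "eps (S (et q) \<bullet> es y) = eps (S (S (es y) \<bullet> et q))" by (simp only: S_mul S2_es)
  also have "\<dots> = eps (S (es y) \<bullet> et q)" by simp
  also have "\<dots> = eps (es (S (es y)) \<bullet> et q)" by (simp add: eps_es)
  also have "es (S (es y)) = es y" by (rule es_S_es)
  finally show ?thesis by (simp add: eps_et)
qed

text \<open>
  Together with \<open>Hs_basis2\<close> and \<open>Hs_basis_mul\<close>: the elements \<open>u\<^sub>1\<close> and \<open>S u\<^sub>2\<close> of the source
  subalgebra (\<open>u\<close> the unit) are dual bases for the form \<open>\<epsilon>(y z)\<close>, and the dual bases can be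
  exchanged because this form is symmetric. Their product is 1, so that they form a symmetric
  separability idempotent.
\<close>

lemma Hs_basis1: assumes f: "lin f" shows "D1 (\<lambda>p q. eps (S q \<bullet> es y) * f p) = f (es y)"
proof -
  note lr = lin_rules lin_linv[OF f]
  have "D1 (\<lambda>p q. eps (S q \<bullet> es y) * f p) = D1 (\<lambda>p q. eps (S (et q) \<bullet> es y) * f p)"
    by (rule D_unit_et[symmetric]) (intro blinI lr)
  also have "\<dots> = f (es (es y))" unfolding eps_S_et_es by (rule lin_es[OF f, symmetric])
  finally show ?thesis by (simp only: es_es)
qed

lemma Hs_basis2: assumes f: "lin f" shows "D1 (\<lambda>p q. eps (es y \<bullet> p) * f (S q)) = f (es y)"
proof -
  note lr = lin_rules lin_linv[OF f]
  have "D1 (\<lambda>p q. eps (es y \<bullet> p) * f (S q)) = D1 (\<lambda>p q. eps (es y \<bullet> S q) * f (S (S p)))"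
    by (rule D_unit_S[symmetric]) (intro blinI lr)
  also have "\<dots> = D1 (\<lambda>p q. eps (es y \<bullet> S q) * f (S (S (es p))))"
    by (rule D_unit_es[symmetric]) (intro blinI lr)
  also have "\<dots> = D1 (\<lambda>p q. eps (es y \<bullet> S q) * f p)"
    unfolding S2_es by (rule D_unit_es) (intro blinI lr)
  also have "\<dots> = D1 (\<lambda>p q. eps (es y \<bullet> S (et q)) * f p)"
    by (rule D_unit_et[symmetric]) (intro blinI lr)
  also have "\<dots> = D1 (\<lambda>p q. eps (S (et q) \<bullet> es y) * f p)"
    by (simp only: es_et[symmetric] eps_es_commute[of y])
  also have "\<dots> = D1 (\<lambda>p q. eps (S q \<bullet> es y) * f p)"
    by (rule D_unit_et) (intro blinI lr)
  finally show ?thesis by (simp only: Hs_basis1[OF f])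
qed

lemma Hs_basis_mul: assumes f: "lin f" shows "D1 (\<lambda>p q. f (S q \<bullet> p)) = f unit"
proof -
  note lr = lin_rules lin_linv[OF f]
  have "D1 (\<lambda>p q. f (S q \<bullet> p)) = D1 (\<lambda>p q. f (S (S p) \<bullet> S q))"
    by (rule D_unit_S[symmetric]) (intro blinI lr)
  also have "\<dots> = D1 (\<lambda>p q. f (S (S (es p)) \<bullet> S q))"
    by (rule D_unit_es[symmetric]) (intro blinI lr)
  also have "\<dots> = D1 (\<lambda>p q. f (p \<bullet> S q))"
    unfolding S2_es by (rule D_unit_es) (intro blinI lr)
  also have "\<dots> = f (et unit)" by (rule D_S1[OF f])
  finally show ?thesis by simp
qed

text \<open>
  The source counital map as \<open>S z\<^sub>1 z\<^sub>2\<close>, with the coproduct of \<open>z = a\<close> known from \<open>D_a\<close>.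
\<close>

lemma es_mul_a: "es (es w \<bullet> a) = S a \<bullet> (es w \<bullet> a)"
proof (rule vec_eqI)
  fix \<phi>
  have "pr \<phi> (es (es w \<bullet> a)) = D a (\<lambda>p q. pr \<phi> (S p \<bullet> (es w \<bullet> q)))"
    by (rule es_mul) simp
  also have "\<dots> = D1 (\<lambda>p q. pr \<phi> (S (p \<bullet> a) \<bullet> (es w \<bullet> (q \<bullet> a))))"
    by (rule D_a) (intro blinI lin_rules)
  also have "\<dots> = D1 (\<lambda>p q. pr \<phi> (S (es p \<bullet> a) \<bullet> (es w \<bullet> (q \<bullet> a))))"
    by (rule D_unit_es[symmetric]) (intro blinI lin_rules)
  also have "\<dots> = D1 (\<lambda>p q. pr \<phi> (S a \<bullet> (es w \<bullet> (S (es p) \<bullet> q \<bullet> a))))"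
    by (simp only: S_mul et_es[symmetric] mul_assoc[symmetric])
       (simp only: mul_assoc[of "S a"] et_es_commute)
  also have "\<dots> = D1 (\<lambda>p q. pr \<phi> (S a \<bullet> (es w \<bullet> (S p \<bullet> q \<bullet> a))))"
    by (rule D_unit_es) (intro blinI lin_rules)
  also have "\<dots> = pr \<phi> (S a \<bullet> (es w \<bullet> (es unit \<bullet> a)))"
    by (rule D_S2) (intro lin_rules)
  finally show "pr \<phi> (es (es w \<bullet> a)) = pr \<phi> (S a \<bullet> (es w \<bullet> a))" by (simp add: unit_mul)
qed auto

text \<open>
  Let \<open>b\<^sub>i\<close> and \<open>c\<^sub>i\<close> be the dual bases \<open>u\<^sub>1\<close> and \<open>S u\<^sub>2\<close> of the source subalgebra, so that
  \<open>\<Sum> c\<^sub>i b\<^sub>i = 1\<close>; \<open>b\<close> without index is the inverse of \<open>a\<close>. Then \<open>1 = \<Sum> a c\<^sub>i b (a b\<^sub>i b)\<close>.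
  Expand \<open>a b\<^sub>i b\<close>, which lies in the source subalgebra, as \<open>\<Sum> b\<^sub>j \<epsilon>(c\<^sub>j a b\<^sub>i)\<close> and sum over
  \<open>i\<close> to obtain \<open>\<Sum> a es(c\<^sub>j a) b b\<^sub>j\<close>. With \<open>es(c\<^sub>j a) = S a c\<^sub>j a\<close> this is
  \<open>a S a \<Sum> c\<^sub>j b\<^sub>j = a S a\<close>.
\<close>

lemma a_S_a: "a \<bullet> S a = unit"
proof (rule vec_eqI)
  fix \<phi> define f where "f = pr \<phi>"
  have f: "lin f" by (simp add: f_def)
  note lr = lin_rules lin_linv[OF f]
  have "f unit = f (a \<bullet> (unit \<bullet> b))" by (simp add: unit_mul a_b)
  also have "\<dots> = D1 (\<lambda>p q. f (a \<bullet> (S q \<bullet> p \<bullet> b)))"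
    by (rule Hs_basis_mul[of "\<lambda>z. f (a \<bullet> (z \<bullet> b))", symmetric]) (intro lr)
  also have "\<dots> = D1 (\<lambda>p q. f (a \<bullet> (S q \<bullet> (b \<bullet> a) \<bullet> p \<bullet> b)))"
    by (simp only: b_a unit_mul_mul)
  also have "\<dots> = D1 (\<lambda>p q. f (a \<bullet> (S q \<bullet> (b \<bullet> a) \<bullet> es p \<bullet> b)))"
    by (rule D_unit_es[symmetric]) (intro blinI lr)
  also have "\<dots> = D1 (\<lambda>p q. f (a \<bullet> (S q \<bullet> (b \<bullet> es (a \<bullet> es p \<bullet> b)))))"
    by (simp only: conj_a_es) (simp only: mul_assoc)
  also have "\<dots> = D1 (\<lambda>p q. D1 (\<lambda>r t. eps (S t \<bullet> es (a \<bullet> es p \<bullet> b)) * f (a \<bullet> (S q \<bullet> (b \<bullet> r)))))"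
    by (subst Hs_basis1) (intro lr, rule refl)
  also have "\<dots> = D1 (\<lambda>p q. D1 (\<lambda>r t. eps (S t \<bullet> a \<bullet> es p) * f (a \<bullet> (S q \<bullet> (b \<bullet> r)))))"
    unfolding conj_a_es by (simp only: mul_assoc[symmetric] eps_mul_b)
  also have "\<dots> = D1 (\<lambda>p q. D1 (\<lambda>r t. eps (S t \<bullet> a \<bullet> p) * f (a \<bullet> (S q \<bullet> (b \<bullet> r)))))"
    by (rule D_unit_es) (intro blinI lr)
  also have "\<dots> = D1 (\<lambda>r t. D1 (\<lambda>p q. eps (es (S t \<bullet> a) \<bullet> p) * f (a \<bullet> (S q \<bullet> (b \<bullet> r)))))"
    by (subst D_commute) (simp only: eps_es)
  also have "\<dots> = D1 (\<lambda>r t. f (a \<bullet> (es (S t \<bullet> a) \<bullet> (b \<bullet> r))))"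
    by (subst Hs_basis2[of "\<lambda>z. f (a \<bullet> (z \<bullet> (b \<bullet> _)))"]) (intro lr, rule refl)
  also have "\<dots> = D1 (\<lambda>r t. f (a \<bullet> (es (S (et t) \<bullet> a) \<bullet> (b \<bullet> r))))"
    by (rule D_unit_et[symmetric]) (intro blinI lr)
  also have "\<dots> = D1 (\<lambda>r t. f (a \<bullet> (S a \<bullet> (S (et t) \<bullet> (a \<bullet> b \<bullet> r)))))"
    by (simp only: es_et[symmetric] es_mul_a) (simp only: mul_assoc)
  also have "\<dots> = D1 (\<lambda>r t. f (a \<bullet> (S a \<bullet> (S (et t) \<bullet> r))))"
    unfolding a_b by simp
  also have "\<dots> = D1 (\<lambda>r t. f (a \<bullet> (S a \<bullet> (S t \<bullet> r))))"
    by (rule D_unit_et) (intro blinI lr)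
  also have "\<dots> = f (a \<bullet> (S a \<bullet> unit))"
    by (rule Hs_basis_mul) (intro lr)
  finally show "pr \<phi> (a \<bullet> S a) = pr \<phi> unit" by (simp add: f_def)
qed auto

lemma S_a: "S a = b"
proof -
  have "S a = b \<bullet> (a \<bullet> S a)" by (simp add: mul_assoc[symmetric] b_a)
  then show ?thesis by (simp add: a_S_a mul_unit)
qed

lemma S_b: "S b = a"
proof -
  have "S b \<bullet> b = unit" by (simp add: S_a[symmetric] S_mul[symmetric] a_S_a)
  then have "S b \<bullet> b \<bullet> a = a" by (simp add: unit_mul)
  then show ?thesis by (simp add: mul_assoc b_a)
qed

lemma es_a: "es a = unit"
  using es_mul_a[of unit] by (simp add: unit_mul S_a b_a)

lemma eps_a_mul: "eps (a \<bullet> h) = eps h"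
  using eps_es[of a h] by (simp add: es_a lin_unit[OF lin_eps0])

text \<open>
  The antipode reverses the coproduct of \<open>a\<close>; as \<open>S a = a\<^sup>-\<^sup>1\<close>, this is the coproduct of the
  inverse with factors on the left.
\<close>

lemma D_b: assumes F: "blin F" shows "D b F = D1 (\<lambda>p q. F (b \<bullet> p) (b \<bullet> q))"
proof -
  note lr = lin_rules blin_lin[OF F]
  have "D b F = D a (\<lambda>p q. F (S q) (S p))" unfolding S_a[symmetric] by (rule D_S[OF F])
  also have "\<dots> = D1 (\<lambda>p q. F (b \<bullet> S q) (b \<bullet> S p))"
    by (subst D_a, intro blinI lr) (simp only: S_mul S_a)
  also have "\<dots> = D1 (\<lambda>p q. F (b \<bullet> p) (b \<bullet> q))"
    by (rule D_unit_S) (intro blinI lr)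
  finally show ?thesis .
qed

lemma D_a': assumes F: "blin F" shows "D a F = D1 (\<lambda>p q. F (a \<bullet> p) (a \<bullet> q))"
proof -
  note lr = lin_rules blin_lin[OF F]
  let ?F = "\<lambda>p q. F (a \<bullet> p) (a \<bullet> q)"
  have F': "blin ?F" by (intro blinI lr)
  have "D1 ?F = D (b \<bullet> a) ?F" by (simp only: b_a)
  also have "\<dots> = D b (\<lambda>p q. D a (\<lambda>r t. ?F (p \<bullet> r) (q \<bullet> t)))" by (rule D_mul[OF F'])
  also have "\<dots> = D1 (\<lambda>p q. D a (\<lambda>r t. F (a \<bullet> b \<bullet> (p \<bullet> r)) (a \<bullet> b \<bullet> (q \<bullet> t))))"
    by (subst D_b, intro blinI lr) (simp only: mul_assoc)
  also have "\<dots> = D1 (\<lambda>p q. D a (\<lambda>r t. F (p \<bullet> r) (q \<bullet> t)))"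
    unfolding a_b by simp
  also have "\<dots> = D a F" by (rule D_unit_left[OF F, symmetric])
  finally show ?thesis by (rule sym)
qed

end

section \<open>The fourth power of the antipode in coordinates\<close>

context weak_hopf_coords begin

interpretation mir: structure_constants I "\<lambda>i j k. m j i k" u "\<lambda>k i j. d k j i" e s
  by unfold_locales (rule finite_I)

interpretation dl: structure_constants I "\<lambda>i j k. d k i j" e "\<lambda>k i j. m i j k" u "\<lambda>i j. s j i"
  by unfold_locales (rule finite_I)

lemma right_integral_functional_move:
  assumes \<rho>: "lin \<rho>" and int: "\<And>f x. lin f \<Longrightarrow> D x (\<lambda>p q. f q * \<rho> p) = D x (\<lambda>p q. f (es q) * \<rho> p)"
    and f: "lin f"
  shows "D x (\<lambda>p q. f q * \<rho> (p \<bullet> h)) = D h (\<lambda>p q. f (S q) * \<rho> (x \<bullet> p))"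
  by (rule weak_hopf_coords.integral_functional_move[OF mirror, unfolded mir_simps, OF \<rho> int f])

text \<open>
  The map \<open>x \<mapsto> \<gamma> \<rightharpoonup> x\<close> is multiplicative if the coproduct of \<open>\<gamma>\<close> is \<open>\<Delta> 1 (\<gamma> \<otimes> \<gamma>)\<close> in the dual:
  the factor \<open>\<Delta> 1\<close> contributes a counit, which is absorbed.
\<close>

lemma hit_mul:
  assumes \<gamma>: "\<And>x y. pr \<gamma> (x \<bullet> y) = D x (\<lambda>p q. D y (\<lambda>r t. eps (p \<bullet> r) * (pr \<gamma> q * pr \<gamma> t)))"
    and f: "lin f"
  shows "D (x \<bullet> y) (\<lambda>p q. pr \<gamma> q * f p) = D x (\<lambda>p q. D y (\<lambda>r t. pr \<gamma> q * pr \<gamma> t * f (p \<bullet> r)))"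
proof -
  note lr = lin_rules lin_linv[OF f]
  define X where "X p1 p2 q r1 r2 t = eps (p2 \<bullet> r2) * (pr \<gamma> q * pr \<gamma> t) * f (p1 \<bullet> r1)" for p1 p2 q r1 r2 t
  have "D (x \<bullet> y) (\<lambda>p q. pr \<gamma> q * f p) = D x (\<lambda>p q. D y (\<lambda>r t. pr \<gamma> (q \<bullet> t) * f (p \<bullet> r)))"
    by (rule D_mul) (intro blinI lr f)
  also have "\<dots> = D x (\<lambda>p q. D y (\<lambda>r t. D q (\<lambda>c g. D t (\<lambda>v w. X p c g r v w))))"
    by (simp only: \<gamma> X_def D_scale_right)
  also have "\<dots> = D x (\<lambda>p q. D q (\<lambda>c g. D y (\<lambda>r t. D t (\<lambda>v w. X p c g r v w))))"
    by (intro D_cong D_commute)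
  also have "\<dots> = D x (\<lambda>p q. D p (\<lambda>c g. D y (\<lambda>r t. D t (\<lambda>v w. X c g q r v w))))"
    by (rule coassoc[symmetric])
  also have "\<dots> = D x (\<lambda>p q. D p (\<lambda>c g. D y (\<lambda>r t. D r (\<lambda>v w. X c g q v w t))))"
    by (intro D_cong coassoc[symmetric])
  also have "\<dots> = D x (\<lambda>p q. D y (\<lambda>r t. D p (\<lambda>c g. D r (\<lambda>v w. X c g q v w t))))"
    by (intro D_cong D_commute)
  also have "\<dots> = D x (\<lambda>p q. D y (\<lambda>r t. pr \<gamma> q * pr \<gamma> t * f (p \<bullet> r)))"
  proof (rule D_cong, rule D_cong)
    fix p q r t
    have "D p (\<lambda>c g. D r (\<lambda>v w. X c g q v w t)) = D (p \<bullet> r) (\<lambda>c g. eps g * (pr \<gamma> q * pr \<gamma> t * f c))"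
      by (subst D_mul, intro blinI lr f) (simp only: X_def mult.assoc)
    also have "\<dots> = pr \<gamma> q * pr \<gamma> t * f (p \<bullet> r)" by (rule counit(2)) (intro lr f)
    finally show "D p (\<lambda>c g. D r (\<lambda>v w. X c g q v w t)) = pr \<gamma> q * pr \<gamma> t * f (p \<bullet> r)" .
  qed
  finally show ?thesis .
qed

lemma hit_mul':
  assumes \<gamma>: "\<And>x y. pr \<gamma> (x \<bullet> y) = D x (\<lambda>p q. D y (\<lambda>r t. eps (q \<bullet> t) * (pr \<gamma> p * pr \<gamma> r)))"
    and f: "lin f"
  shows "D (x \<bullet> y) (\<lambda>p q. pr \<gamma> p * f q) = D x (\<lambda>p q. D y (\<lambda>r t. pr \<gamma> p * pr \<gamma> r * f (q \<bullet> t)))"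
proof -
  have "pr \<gamma> (y \<bullet> x) = D x (\<lambda>q p. D y (\<lambda>t r. eps (r \<bullet> p) * (pr \<gamma> q * pr \<gamma> t)))" for x y
    by (subst \<gamma>, subst D_commute) (simp only: mult_ac)
  from weak_hopf_coords.hit_mul[OF mirror, unfolded mir_simps, OF this f, of x y]
  show ?thesis by (subst D_commute) (simp only: mult_ac)
qed

text \<open>
  The counital maps are given by the antipode axioms, which are self-dual; therefore those of
  the dual are the transposes.
\<close>

lemma dual_et: "pr (dl.et \<phi>) x = pr \<phi> (et x)"
proof -
  have "pr x (dl.et \<phi>) = dl.D \<phi> (\<lambda>p q. pr x (dl.mul p (dl.S q)))"
    by (rule weak_hopf_coords.D_S1[OF dual_weak_hopf, symmetric]) simp
  also have "\<dots> = pr \<phi> (et x)"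
    by (simp only: dual_mul' dual_S dual_D_commute dual_D D_S1 lin_pr)
  finally show ?thesis by (simp only: pr_commute[of x])
qed

lemma dual_es: "pr (dl.es \<phi>) x = pr \<phi> (es x)"
proof -
  have "pr x (dl.es \<phi>) = dl.D \<phi> (\<lambda>p q. pr x (dl.mul (dl.S p) q))"
    by (rule weak_hopf_coords.D_S2[OF dual_weak_hopf, symmetric]) simp
  also have "\<dots> = pr \<phi> (es x)"
    by (simp only: dual_mul' dual_S dual_D_commute dual_D D_S2 lin_pr)
  finally show ?thesis by (simp only: pr_commute[of x])
qed

lemma et_S: "et (S x) = S (es x)"
proof (rule vec_eqI)
  fix \<phi>
  have "pr \<phi> (et (S x)) = D (S x) (\<lambda>p q. pr \<phi> (p \<bullet> S q))" by (rule D_S1[symmetric]) simp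
  also have "\<dots> = D x (\<lambda>p q. pr \<phi> (S (S p \<bullet> q)))" 
    unfolding S_mul by (rule D_S) (intro blinI lin_rules)
  also have "\<dots> = pr \<phi> (S (es x))" by (rule D_S2) (intro lin_rules)
  finally show "pr \<phi> (et (S x)) = pr \<phi> (S (es x))" .
qed auto

lemma es_S: "es (S x) = S (et x)"
  by (rule weak_hopf_coords.et_S[OF mirror, unfolded mir_simps])

end

context dual_integrals begin

interpretation dl: structure_constants I "\<lambda>i j k. d k i j" e "\<lambda>k i j. m i j k" u "\<lambda>i j. s j i"
  by unfold_locales (rule finite_I)

text \<open>
  The pair \<open>\<lambda>\<close>, \<open>l\<close> consists of dual integrals for the dual algebra. All results on \<open>a\<close> hold for
  \<open>\<alpha>\<close>.
\<close>

lemma dual_dual_integrals: "dual_integrals I (\<lambda>i j k. d k i j) e (\<lambda>k i j. m i j k) u (\<lambda>i j. s j i) lam l"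
proof (rule dual_integrals.intro[OF dual_weak_hopf dual_integrals_axioms.intro])
  fix \<phi> x
  show "lam \<in> vecs" "l \<in> vecs" by (rule lam_vecs l_vecs)+
  show "pr x (dl.mul \<phi> lam) = pr x (dl.mul (dl.et \<phi>) lam)"
    by (simp only: dual_mul' dual_et) (rule lam_int)
  show "dl.D \<phi> (\<lambda>p q. pr x p * pr l q) = dl.D \<phi> (\<lambda>p q. pr x (dl.et p) * pr l q)"
    unfolding dual_D2 by (simp only: pr_commute[of x] pr_commute[of l] dual_et dual_D) (rule l_int)
  show "dl.D lam (\<lambda>p q. pr x p * pr l q) = pr x dl.unit"
    by (simp only: dual_D2 dual_unit' l_lam)
  show "pr l (dl.mul \<phi> lam) = dl.eps \<phi>"
    by (simp only: dual_mul' dual_eps lam_l)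
  show "dl.S (dl.S (dl.et \<phi>)) = dl.et \<phi>"
    by (rule dl.vec_eqI) (auto simp: dual_S' dual_S dual_et et_S es_S S2_et pr_commute[of _ "dl.et _"])
  show "dl.S (dl.S (dl.es \<phi>)) = dl.es \<phi>"
    by (rule dl.vec_eqI) (auto simp: dual_S' dual_S dual_es et_S es_S S2_es pr_commute[of _ "dl.es _"])
qed

interpretation du: dual_integrals I "\<lambda>i j k. d k i j" e "\<lambda>k i j. m i j k" u "\<lambda>i j. s j i" lam l
  by (rule dual_dual_integrals)

definition alpha :: "'i \<Rightarrow> 'k" where "alpha = du.a"
definition beta :: "'i \<Rightarrow> 'k" where "beta = du.b"

abbreviation AL where "AL \<equiv> pr alpha"
abbreviation BE where "BE \<equiv> pr beta"

lemma alpha: "AL x = L (l \<bullet> x)"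
proof -
  have "pr x alpha = dl.D lam (\<lambda>p q. pr l p * pr x q)" unfolding alpha_def by (rule du.lin_a) simp
  then show ?thesis unfolding dual_D2 by (simp only: pr_commute[of x alpha])
qed

text \<open>
  The value on a product is the coproduct of \<open>\<alpha>\<close> in the dual, for which the two group-like
  identities are \<open>D_a\<close> and \<open>D_a'\<close>.
\<close>

lemma alpha_mul: "AL (x \<bullet> y) = D x (\<lambda>p q. D y (\<lambda>r t. eps (p \<bullet> r) * (AL q * AL t)))"
proof -
  have "AL (x \<bullet> y) = dl.D alpha (\<lambda>p q. pr x p * pr y q)" by (simp only: dual_D2)
  also have "\<dots> = dl.D dl.unit (\<lambda>p q. pr x (dl.mul p alpha) * pr y (dl.mul q alpha))"
    unfolding alpha_def by (rule du.D_a) (intro dl.blinI dl.lin_rules)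
  also have "\<dots> = dl.D dl.unit (\<lambda>p q. D y (\<lambda>r t. D x (\<lambda>c g. pr p c * pr q r * (AL g * AL t))))"
    by (simp only: dual_mul' D_scale[symmetric] D_scale_right[symmetric] mult_ac)
  also have "\<dots> = D y (\<lambda>r t. D x (\<lambda>c g. eps (c \<bullet> r) * (AL g * AL t)))"
    by (simp only: dual_D_commute dl.D_scale_right dual_D dual_unit)
  also have "\<dots> = D x (\<lambda>p q. D y (\<lambda>r t. eps (p \<bullet> r) * (AL q * AL t)))" by (rule D_commute)
  finally show ?thesis .
qed

lemma alpha_mul': "AL (x \<bullet> y) = D x (\<lambda>p q. D y (\<lambda>r t. eps (q \<bullet> t) * (AL p * AL r)))"
proof -
  have "AL (x \<bullet> y) = dl.D alpha (\<lambda>p q. pr x p * pr y q)" by (simp only: dual_D2)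
  also have "\<dots> = dl.D dl.unit (\<lambda>p q. pr x (dl.mul alpha p) * pr y (dl.mul alpha q))"
    unfolding alpha_def by (rule du.D_a') (intro dl.blinI dl.lin_rules)
  also have "\<dots> = dl.D dl.unit (\<lambda>p q. D y (\<lambda>r t. D x (\<lambda>c g. pr p g * pr q t * (AL c * AL r))))"
    by (simp only: dual_mul' D_scale[symmetric] D_scale_right[symmetric] mult_ac)
  also have "\<dots> = D y (\<lambda>r t. D x (\<lambda>c g. eps (g \<bullet> t) * (AL c * AL r)))"
    by (simp only: dual_D_commute dl.D_scale_right dual_D dual_unit)
  also have "\<dots> = D x (\<lambda>p q. D y (\<lambda>r t. eps (q \<bullet> t) * (AL p * AL r)))" by (rule D_commute)
  finally show ?thesis .
qed

lemma beta_mul: "BE (x \<bullet> y) = D x (\<lambda>p q. D y (\<lambda>r t. eps (q \<bullet> t) * (BE p * BE r)))"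
proof -
  have "BE (x \<bullet> y) = dl.D beta (\<lambda>p q. pr x p * pr y q)" by (simp only: dual_D2)
  also have "\<dots> = dl.D dl.unit (\<lambda>p q. pr x (dl.mul beta p) * pr y (dl.mul beta q))"
    unfolding beta_def by (rule du.D_b) (intro dl.blinI dl.lin_rules)
  also have "\<dots> = dl.D dl.unit (\<lambda>p q. D y (\<lambda>r t. D x (\<lambda>c g. pr p g * pr q t * (BE c * BE r))))"
    by (simp only: dual_mul' D_scale[symmetric] D_scale_right[symmetric] mult_ac)
  also have "\<dots> = D y (\<lambda>r t. D x (\<lambda>c g. eps (g \<bullet> t) * (BE c * BE r)))"
    by (simp only: dual_D_commute dl.D_scale_right dual_D dual_unit)
  also have "\<dots> = D x (\<lambda>p q. D y (\<lambda>r t. eps (q \<bullet> t) * (BE p * BE r)))" by (rule D_commute)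
  finally show ?thesis .
qed

lemma alpha_beta: "D x (\<lambda>p q. AL p * BE q) = eps x" and beta_alpha: "D x (\<lambda>p q. BE p * AL q) = eps x"
proof -
  have "dl.mul alpha beta = dl.unit" "dl.mul beta alpha = dl.unit"
    unfolding alpha_def beta_def by (rule du.a_b du.b_a)+
  then have "pr (dl.mul alpha beta) x = pr dl.unit x" "pr (dl.mul beta alpha) x = pr dl.unit x" by simp_all
  then show "D x (\<lambda>p q. AL p * BE q) = eps x" "D x (\<lambda>p q. BE p * AL q) = eps x"
    by (simp_all only: dual_mul dual_unit)
qed

lemma D_a_mul: assumes F: "blin F" shows "D (a \<bullet> x) F = D x (\<lambda>p q. F (a \<bullet> p) (a \<bullet> q))"
proof -
  note lr = lin_rules blin_lin[OF F]
  have "D (a \<bullet> x) F = D a (\<lambda>c g. D x (\<lambda>p q. F (c \<bullet> p) (g \<bullet> q)))" by (rule D_mul[OF F])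
  also have "\<dots> = D1 (\<lambda>c g. D x (\<lambda>p q. F (a \<bullet> (c \<bullet> p)) (a \<bullet> (g \<bullet> q))))"
    by (subst D_a', intro blinI lr) (simp only: mul_assoc)
  also have "\<dots> = D x (\<lambda>p q. F (a \<bullet> p) (a \<bullet> q))"
    by (rule D_unit_left[symmetric]) (intro blinI lr)
  finally show ?thesis .
qed

lemma es_b: "es b = unit"
proof (rule vec_eqI)
  fix \<phi>
  have 1: "eps (b \<bullet> h) = eps h" for h
    using eps_a_mul[of "b \<bullet> h"] by (simp add: mul_assoc[symmetric] a_b lin_unit[OF lin_eps0])
  have "pr \<phi> (es b) = D1 (\<lambda>p q. eps q * pr \<phi> p)" by (simp only: lin_es lin_pr 1)
  also have "\<dots> = pr \<phi> unit" by (rule counit(2)) simp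
  finally show "pr \<phi> (es b) = pr \<phi> unit" .
qed auto

lemma et_a: "et a = unit"
proof (rule vec_eqI)
  fix \<phi>
  have "pr \<phi> (et a) = D1 (\<lambda>p q. eps p * pr \<phi> q)" by (simp only: lin_et lin_pr eps_mul_a)
  also have "\<dots> = pr \<phi> unit" by (rule counit(1)) simp
  finally show "pr \<phi> (et a) = pr \<phi> unit" .
qed auto

text \<open>
  The counterpart of \<open>conj_a_es\<close> for conjugation by the inverse; it follows from
  \<open>es a = es b = 1\<close>.
\<close>

lemma conj_b_es: "es (b \<bullet> (es w \<bullet> a)) = b \<bullet> (es w \<bullet> a)"
proof -
  have "es (b \<bullet> (es w \<bullet> a)) = es (es (es b \<bullet> es w) \<bullet> a)"
    by (simp only: es_es_mul mul_assoc)
  also have "\<dots> = b \<bullet> (es w \<bullet> a)" by (simp only: es_b unit_mul et_vecs es_es es_mul_a S_a)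
  finally show ?thesis .
qed

text \<open>
  By \<open>L_comul\<close> the element \<open>x\<^sub>2 \<lambda>(a x\<^sub>1)\<close> is a combination of \<open>b es(q) a\<close>, which lies in the
  source subalgebra by \<open>conj_b_es\<close> and is fixed by \<open>es\<close>.
\<close>

lemma L_a_right_integral:
  assumes f: "lin f" shows "D x (\<lambda>p q. f q * L (a \<bullet> p)) = D x (\<lambda>p q. f (es q) * L (a \<bullet> p))"
proof -
  have 1: "D x (\<lambda>p q. g q * L (a \<bullet> p)) = D1 (\<lambda>p q. L (p \<bullet> (a \<bullet> x)) * g (b \<bullet> (es (et q) \<bullet> a)))" if g: "lin g" for g
  proof -
    note lr = lin_rules lin_linv[OF g] linv_Sinv
    have "D x (\<lambda>p q. g q * L (a \<bullet> p)) = D x (\<lambda>p q. L (a \<bullet> p) * g (b \<bullet> (a \<bullet> q)))"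
      by (rule D_cong) (simp add: mul_assoc[symmetric] b_a unit_mul)
    also have "\<dots> = D (a \<bullet> x) (\<lambda>p q. L p * g (b \<bullet> q))"
      by (rule D_a_mul[symmetric]) (intro blinI lr lin_pr)
    also have "\<dots> = D1 (\<lambda>p q. L (p \<bullet> (a \<bullet> x)) * g (b \<bullet> (Sinv q \<bullet> a)))"
      by (rule L_comul) (intro lr)
    also have "\<dots> = D1 (\<lambda>p q. L (p \<bullet> (a \<bullet> x)) * g (b \<bullet> (Sinv (et q) \<bullet> a)))"
      by (rule D_unit_et[symmetric]) (intro blinI lr)
    finally show ?thesis by (simp only: Sinv_et)
  qed
  show ?thesis unfolding 1[OF f] 1[OF lin_linv[OF f linv_es0]] conj_b_es ..
qed

text \<open>
  The mirror image of \<open>integral_functional_move\<close> for the right integral functional \<open>x \<mapsto> \<lambda>(a x)\<close>,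
  at \<open>x = l\<close>; the factor \<open>a\<close> disappears on the left of \<open>l\<close> because \<open>a l = et(a) l = l\<close>.
\<close>

lemma L_l_right:
  assumes f: "lin f" shows "D l (\<lambda>p q. L (p \<bullet> h) * f q) = D h (\<lambda>p q. AL p * f (a \<bullet> S q))"
proof -
  note lr = lin_rules lin_linv[OF f]
  have al: "pr \<phi> (a \<bullet> l) = pr \<phi> l" for \<phi> by (simp only: l_int[of _ a] et_a ax_unit)
  have "D l (\<lambda>p q. L (p \<bullet> h) * f q) = D (a \<bullet> l) (\<lambda>p q. L (p \<bullet> h) * f q)"
    by (rule D_arg_cong) (simp only: al)
  also have "\<dots> = D l (\<lambda>p q. f (a \<bullet> q) * L (a \<bullet> (p \<bullet> h)))"
    by (subst D_a_mul, intro blinI lr f) (simp only: mul_assoc mult.commute)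
  also have "\<dots> = D h (\<lambda>p q. f (a \<bullet> S q) * L (a \<bullet> (l \<bullet> p)))"
    by (rule right_integral_functional_move[of "\<lambda>x. L (a \<bullet> x)" "\<lambda>x. f (a \<bullet> x)"]) 
      (intro lr, erule L_a_right_integral, intro lr)
  also have "\<dots> = D h (\<lambda>p q. AL p * f (a \<bullet> S q))"
  proof -
    have "L (a \<bullet> (l \<bullet> p)) = L (l \<bullet> p)" for p
      unfolding mul_assoc[symmetric] by (rule lin_eqI[of "\<lambda>z. L (z \<bullet> p)"]) (intro lr, rule al)
    then show ?thesis by (simp only: alpha mult.commute)
  qed
  finally show ?thesis .
qed

definition hit_l where "hit_l x = DV x (\<lambda>p q. sc (AL q) p)"
definition hit_r where "hit_r x = DV x (\<lambda>p q. sc (BE p) q)"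

lemma lin_hit_l: "lin f \<Longrightarrow> f (hit_l x) = D x (\<lambda>p q. AL q * f p)"
  by (simp add: hit_l_def lin_DV lin_f_sc)

lemma lin_hit_r: "lin f \<Longrightarrow> f (hit_r x) = D x (\<lambda>p q. BE p * f q)"
  by (simp add: hit_r_def lin_DV lin_f_sc)

lemma hit_vecs [simp]: "hit_l x \<in> vecs" "hit_r x \<in> vecs" by (simp_all add: hit_l_def hit_r_def)

lemma hit_l_mul: "hit_l (x \<bullet> y) = hit_l x \<bullet> hit_l y"
proof (rule vec_eqI)
  fix \<phi>
  have "pr \<phi> (hit_l x \<bullet> hit_l y) = D x (\<lambda>p q. AL q * pr \<phi> (p \<bullet> hit_l y))"
    by (rule lin_hit_l) (intro lin_rules)
  also have "\<dots> = D x (\<lambda>p q. D y (\<lambda>r t. AL q * AL t * pr \<phi> (p \<bullet> r)))"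
    by (subst lin_hit_l[of "\<lambda>z. pr \<phi> (_ \<bullet> z)"], intro lin_rules) (simp only: D_scale mult.assoc)
  finally show "pr \<phi> (hit_l (x \<bullet> y)) = pr \<phi> (hit_l x \<bullet> hit_l y)"
    by (simp only: lin_hit_l lin_pr hit_mul[OF alpha_mul lin_pr])
qed auto

lemma hit_r_mul: "hit_r (x \<bullet> y) = hit_r x \<bullet> hit_r y"
proof (rule vec_eqI)
  fix \<phi>
  have "pr \<phi> (hit_r x \<bullet> hit_r y) = D x (\<lambda>p q. BE p * pr \<phi> (q \<bullet> hit_r y))"
    by (rule lin_hit_r) (intro lin_rules)
  also have "\<dots> = D x (\<lambda>p q. D y (\<lambda>r t. BE p * BE r * pr \<phi> (q \<bullet> t)))"
    by (subst lin_hit_r[of "\<lambda>z. pr \<phi> (_ \<bullet> z)"], intro lin_rules) (simp only: D_scale mult.assoc)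
  finally show "pr \<phi> (hit_r (x \<bullet> y)) = pr \<phi> (hit_r x \<bullet> hit_r y)"
    by (simp only: lin_hit_r lin_pr hit_mul'[OF beta_mul lin_pr])
qed auto

text \<open>
  The element \<open>N\<close> is the image of \<open>h\<close> under the Nakayama automorphism of \<open>\<lambda>\<close>. Its two translates
  by \<open>\<alpha>\<close> are \<open>S (S h)\<close> and \<open>b k a\<close>.
\<close>

lemma S4_of_conjugate: assumes k: "k \<in> vecs" shows "S (S (S (S k))) = hit_r (hit_l (b \<bullet> (k \<bullet> a)))"
proof (rule vec_eqI)
  fix \<phi>
  define h where "h = S (S k)"
  have h: "Sinv h = S k" by (simp add: h_def Sinv_S)
  \<comment> \<open>The dual bases solve \<open>\<lambda>(x N) = \<lambda>(h x)\<close> for \<open>N\<close>.\<close>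
  define N where "N = DV l (\<lambda>p q. sc (L (h \<bullet> Sinv p)) q)"
  have N: "L (x \<bullet> N) = L (h \<bullet> x)" for x
  proof -
    have "L (x \<bullet> N) = D l (\<lambda>p q. L (h \<bullet> Sinv p) * L (x \<bullet> q))"
      unfolding N_def by (subst lin_DV[of "\<lambda>z. L (x \<bullet> z)"], intro lin_rules, subst lin_f_sc[of "\<lambda>z. L (x \<bullet> z)"], intro lin_rules, rule refl)
    also have "\<dots> = L (h \<bullet> x)" by (rule frobenius_expand1) (intro lin_rules)
    finally show ?thesis .
  qed
  have 1: "D N (\<lambda>p q. f p * AL q) = f (S (S h))" if f: "lin f" for f
  proof -
    have "D N (\<lambda>p q. f p * AL q) = D l (\<lambda>p q. f (S p) * L (h \<bullet> q))"
      unfolding alpha L_l_S[OF f] N ..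
    also have "\<dots> = f (S (S h))" by (rule S_from_integrals) (intro lin_linv[OF f] lin_rules)
    finally show ?thesis .
  qed
  \<comment> \<open>Cancelling \<open>a\<close> and the antipode expresses \<open>N \<leftharpoonup> \<alpha>\<close> through the left-hand side of
     \<open>L_l_right\<close>.\<close>
  have 2: "D N (\<lambda>p q. AL p * f q) = f (b \<bullet> (k \<bullet> a))" if f: "lin f" for f
  proof -
    note lr = lin_rules lin_linv[OF f] linv_Sinv
    have "D N (\<lambda>p q. AL p * f q) = D N (\<lambda>p q. AL p * f (Sinv (b \<bullet> (a \<bullet> S q))))"
      by (rule D_cong) (simp add: mul_assoc[symmetric] b_a Sinv_S)
    also have "\<dots> = D l (\<lambda>p q. L (p \<bullet> N) * f (Sinv (b \<bullet> q)))"
      by (rule L_l_right[symmetric]) (intro lr)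
    also have "\<dots> = D l (\<lambda>p q. L (S (Sinv h) \<bullet> p) * f (Sinv (b \<bullet> q)))"
      unfolding N by (simp add: h_def S_Sinv)
    also have "\<dots> = f (Sinv (b \<bullet> (Sinv h \<bullet> a)))"
      by (rule L_S_l) (intro lr)
    also have "b \<bullet> (Sinv h \<bullet> a) = S (b \<bullet> (k \<bullet> a))" by (simp add: h S_mul S_a S_b mul_assoc)
    finally show ?thesis by (simp add: Sinv_S)
  qed
  define g where "g z = D z (\<lambda>p q. pr \<phi> p * AL q)" for z
  have g: "lin g" unfolding g_def by (rule lin_D_arg0)
  have T: "pr \<phi> (hit_r (hit_l z)) = D z (\<lambda>p q. BE p * g q)" for z
  proof -
    have "pr \<phi> (hit_r (hit_l z)) = D z (\<lambda>p q. AL q * D p (\<lambda>r t. BE r * pr \<phi> t))"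
      unfolding lin_hit_r[OF lin_pr] by (rule lin_hit_l) (rule lin_D_arg0)
    also have "\<dots> = D z (\<lambda>p q. D p (\<lambda>r t. BE r * (pr \<phi> t * AL q)))"
      by (simp only: D_scale[symmetric] mult.left_commute mult.commute)
    finally show ?thesis unfolding coassoc g_def by (simp only: D_scale)
  qed
  have "pr \<phi> (hit_r (hit_l (b \<bullet> (k \<bullet> a)))) = D N (\<lambda>p q. AL p * D q (\<lambda>r t. BE r * g t))"
    unfolding T by (rule 2[symmetric]) (rule lin_D_arg0)
  also have "\<dots> = D N (\<lambda>p q. D p (\<lambda>r t. AL r * BE t) * g q)"
    by (simp only: D_scale[symmetric] D_scale_right[symmetric] coassoc mult.assoc)
  also have "\<dots> = g N" unfolding alpha_beta by (rule counit(1)[OF g])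
  also have "\<dots> = pr \<phi> (S (S h))" unfolding g_def by (rule 1) simp
  finally show "pr \<phi> (S (S (S (S k)))) = pr \<phi> (hit_r (hit_l (b \<bullet> (k \<bullet> a))))" by (simp only: h_def)
qed auto

text \<open>
  Multiplicativity of \<open>T = \<alpha> \<rightharpoonup> _ \<leftharpoonup> \<alpha>\<^sup>-\<^sup>1\<close> removes the conjugation inside \<open>T\<close> once \<open>T a = a\<close> is
  known, and this is \<open>S4_of_conjugate\<close> at \<open>k = a\<close>, as \<open>S\<^sup>4 a = a\<close>.
\<close>

lemma S4: assumes k: "k \<in> vecs" shows "S (S (S (S k))) = b \<bullet> hit_r (hit_l k) \<bullet> a"
proof -
  let ?T = "\<lambda>x. hit_r (hit_l x)"
  have Tmul: "?T (x \<bullet> y) = ?T x \<bullet> ?T y" for x y by (simp add: hit_l_mul hit_r_mul)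
  have "?T a = ?T (b \<bullet> (a \<bullet> a))" by (simp add: mul_assoc[symmetric] b_a unit_mul)
  also have "\<dots> = a" by (simp add: S4_of_conjugate[symmetric] S_a S_b)
  finally have Ta: "?T a = a" .
  have "a \<bullet> S (S (S (S k))) = ?T a \<bullet> ?T (b \<bullet> (k \<bullet> a))" by (simp add: S4_of_conjugate[OF k] Ta)
  also have "\<dots> = ?T (k \<bullet> a)" by (simp only: Tmul[symmetric] mul_assoc[symmetric] a_b) (simp add: mul_assoc)
  also have "\<dots> = ?T k \<bullet> a" by (simp only: Tmul Ta)
  finally have "b \<bullet> (a \<bullet> S (S (S (S k)))) = b \<bullet> (?T k \<bullet> a)" by simp
  then show ?thesis by (simp add: mul_assoc[symmetric] b_a)
qed

end

section \<open>Tensor products as functionals on bilinear forms\<close>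

lemma fun_vector_space: "vector_space (\<lambda>c (t :: 'b \<Rightarrow> 'k::field) \<beta>. c * t \<beta>)"
  by unfold_locales (auto simp: fun_eq_iff algebra_simps)

lemma vec_space_closed:
  assumes "vec_space V"
  shows "0 \<in> carrier V" "x \<in> carrier V \<Longrightarrow> y \<in> carrier V \<Longrightarrow> x + y \<in> carrier V"
    "x \<in> carrier V \<Longrightarrow> smult V c x \<in> carrier V"
proof -
  interpret vector_space "smult V" by (rule vec_space.ambient[OF assms])
  note s = vec_space.subspace[OF assms]
  show "0 \<in> carrier V" by (rule subspace_0[OF s])
  show "x \<in> carrier V \<Longrightarrow> y \<in> carrier V \<Longrightarrow> x + y \<in> carrier V" by (rule subspace_add[OF s])
  show "x \<in> carrier V \<Longrightarrow> smult V c x \<in> carrier V" by (rule subspace_scale[OF s])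
qed

lemma vec_space_sum:
  assumes "vec_space V" "\<And>i. i \<in> J \<Longrightarrow> f i \<in> carrier V"
  shows "(\<Sum>i\<in>J. f i) \<in> carrier V"
  using assms(2) by (induction J rule: infinite_finite_induct) (auto intro: vec_space_closed[OF assms(1)])

lemma vec_space_sum_list:
  assumes "vec_space V" "\<And>z. z \<in> set xs \<Longrightarrow> f z \<in> carrier V"
  shows "(\<Sum>z\<leftarrow>xs. f z) \<in> carrier V"
  using assms(2) by (induction xs) (auto intro: vec_space_closed[OF assms(1)])

lemma lin_map_scalars:
  "lin_map V scalars f \<longleftrightarrow> (\<forall>x\<in>carrier V. \<forall>y\<in>carrier V. f (x + y) = f x + f y) \<and>
     (\<forall>c. \<forall>x\<in>carrier V. f (smult V c x) = c * f x)"
  by (simp add: lin_map_def scalars_def)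

lemma lin_map_scalarsI:
  assumes "\<And>x y. x \<in> carrier V \<Longrightarrow> y \<in> carrier V \<Longrightarrow> f (x + y) = f x + f y"
    "\<And>c x. x \<in> carrier V \<Longrightarrow> f (smult V c x) = c * f x"
  shows "lin_map V scalars f"
  using assms by (simp add: lin_map_scalars)

lemma lin_map_scalarsD:
  assumes "lin_map V scalars f"
  shows "x \<in> carrier V \<Longrightarrow> y \<in> carrier V \<Longrightarrow> f (x + y) = f x + f y"
    "x \<in> carrier V \<Longrightarrow> f (smult V c x) = c * f x"
  using assms by (simp_all add: lin_map_scalars)

lemma lin_map_zero:
  assumes "vec_space V" "lin_map V scalars f" shows "f 0 = 0"
proof -
  have "f 0 + 0 = f 0 + f 0"
    using lin_map_scalarsD(1)[OF assms(2), of 0 0] vec_space_closed(1)[OF assms(1)] by simp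
  then show ?thesis by (simp only: add_left_cancel)
qed

lemma lin_map_sum:
  assumes V: "vec_space V" and f: "lin_map V scalars f" and "\<And>i. i \<in> J \<Longrightarrow> v i \<in> carrier V"
  shows "f (\<Sum>i\<in>J. v i) = (\<Sum>i\<in>J. f (v i))"
  using assms(3)
  by (induction J rule: infinite_finite_induct)
     (simp_all add: lin_map_zero[OF V f] lin_map_scalarsD[OF f] vec_space_sum[OF V])

lemma lin_map_sum_list:
  assumes V: "vec_space V" and f: "lin_map V scalars f" and "\<And>z. z \<in> set xs \<Longrightarrow> v z \<in> carrier V"
  shows "f (\<Sum>z\<leftarrow>xs. v z) = (\<Sum>z\<leftarrow>xs. f (v z))"
  using assms(3)
  by (induction xs) (simp_all add: lin_map_zero[OF V f] lin_map_scalarsD[OF f] vec_space_sum_list[OF V])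

lemma bilin_scalarsI:
  assumes "\<And>x. x \<in> carrier V \<Longrightarrow> lin_map W scalars (\<mu> x)"
    "\<And>y. y \<in> carrier W \<Longrightarrow> lin_map V scalars (\<lambda>x. \<mu> x y)"
  shows "bilin_map V W scalars \<mu>"
  using assms by (simp add: bilin_map_def)

lemma bilin_mapD:
  assumes "bilin_map V W U \<mu>"
  shows "x \<in> carrier V \<Longrightarrow> lin_map W U (\<mu> x)" "y \<in> carrier W \<Longrightarrow> lin_map V U (\<lambda>x. \<mu> x y)"
    "x \<in> carrier V \<Longrightarrow> y \<in> carrier W \<Longrightarrow> \<mu> x y \<in> carrier U"
  using assms by (auto simp: bilin_map_def lin_map_def)

lemma bilin_scalarsD:
  assumes "bilin_map V W scalars \<mu>"
  shows "x \<in> carrier V \<Longrightarrow> y \<in> carrier W \<Longrightarrow> z \<in> carrier W \<Longrightarrow> \<mu> x (y + z) = \<mu> x y + \<mu> x z"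
    "x \<in> carrier V \<Longrightarrow> y \<in> carrier W \<Longrightarrow> \<mu> x (smult W c y) = c * \<mu> x y"
    "x \<in> carrier V \<Longrightarrow> x' \<in> carrier V \<Longrightarrow> y \<in> carrier W \<Longrightarrow> \<mu> (x + x') y = \<mu> x y + \<mu> x' y"
    "x \<in> carrier V \<Longrightarrow> y \<in> carrier W \<Longrightarrow> \<mu> (smult V c x) y = c * \<mu> x y"
  using lin_map_scalarsD[OF bilin_mapD(1)[OF assms]] lin_map_scalarsD[OF bilin_mapD(2)[OF assms]] by auto

lemma bilin_zero: "bilin_map V W scalars (\<lambda>x y. 0)"
  by (intro bilin_scalarsI lin_map_scalarsI) simp_all

lemma sum_list_fun_apply: "(\<Sum>z\<leftarrow>xs. f z) \<beta> = (\<Sum>z\<leftarrow>xs. f z \<beta>)"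
  by (induction xs) simp_all

text \<open>
  The scalar in a linear combination of pure tensors can be moved into the first factor.
\<close>

lemma tensor_rep:
  fixes V :: "('k::field, 'a::ab_group_add, 'm) vspace_scheme" and W :: "('k, 'b::ab_group_add, 'n) vspace_scheme"
  assumes V: "vec_space V" and t: "t \<in> carrier (tensor_space V W)"
  obtains xs where "set xs \<subseteq> carrier V \<times> carrier W" "t = (\<Sum>(x, y)\<leftarrow>xs. pure_tensor V W x y)"
proof -
  interpret vector_space "\<lambda>c (t :: ('a \<Rightarrow> 'b \<Rightarrow> 'k) \<Rightarrow> 'k) \<beta>. c * t \<beta>" by (rule fun_vector_space)
  have "t \<in> span {pure_tensor V W x y | x y. x \<in> carrier V \<and> y \<in> carrier W}"
    using t by (simp add: tensor_space_def)
  then have "\<exists>xs. set xs \<subseteq> carrier V \<times> carrier W \<and> t = (\<Sum>(x, y)\<leftarrow>xs. pure_tensor V W x y)"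
  proof (induction rule: span_induct_alt)
    case base
    show ?case by (intro exI[of _ "[]"]) simp
  next
    case (step c p t)
    then obtain xs x y where xs: "set xs \<subseteq> carrier V \<times> carrier W" "t = (\<Sum>(x, y)\<leftarrow>xs. pure_tensor V W x y)"
      and p: "p = pure_tensor V W x y" "x \<in> carrier V" "y \<in> carrier W" by blast
    have "(\<lambda>\<beta>. c * p \<beta>) = pure_tensor V W (smult V c x) y"
      using p by (auto simp: pure_tensor_def fun_eq_iff bilin_scalarsD)
    then show ?case using xs p vec_space_closed(3)[OF V]
      by (intro exI[of _ "(smult V c x, y) # xs"]) simp
  qed
  then show thesis using that by blast
qed

lemma tensor_rep_eval:
  assumes "bilin_map V W scalars \<gamma>"
  shows "(\<Sum>(x, y)\<leftarrow>xs. pure_tensor V W x y) \<gamma> = (\<Sum>(x, y)\<leftarrow>xs. \<gamma> x y)"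
  by (induction xs) (auto simp: pure_tensor_def assms)

text \<open>
  Tensors vanish off the bilinear forms by construction, so that they are determined by their
  values on bilinear forms.
\<close>

lemma tensor_not_bilin:
  assumes "vec_space V" "t \<in> carrier (tensor_space V W)" "\<not> bilin_map V W scalars \<gamma>"
  shows "t \<gamma> = 0"
proof -
  obtain xs where "t = (\<Sum>(x, y)\<leftarrow>xs. pure_tensor V W x y)" using tensor_rep[OF assms(1,2)] by metis
  moreover have "(\<Sum>(x, y)\<leftarrow>xs. pure_tensor V W x y) \<gamma> = 0"
    by (induction xs) (auto simp: pure_tensor_def assms)
  ultimately show ?thesis by simp
qed

lemma tensor_zero_form:
  assumes "vec_space V" "t \<in> carrier (tensor_space V W)"
  shows "t (\<lambda>x y. 0) = 0"
proof -
  obtain xs where "t = (\<Sum>(x, y)\<leftarrow>xs. pure_tensor V W x y)" using tensor_rep[OF assms] by metis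
  moreover have "(\<Sum>(x, y)\<leftarrow>xs. pure_tensor V W x y) (\<lambda>x y. 0) = 0"
    by (induction xs) (auto simp: pure_tensor_def)
  ultimately show ?thesis by simp
qed

lemma tensor_cong:
  assumes "vec_space V" "t \<in> carrier (tensor_space V W)"
    and "bilin_map V W scalars \<gamma>" "bilin_map V W scalars \<gamma>'"
    and "\<And>x y. x \<in> carrier V \<Longrightarrow> y \<in> carrier W \<Longrightarrow> \<gamma> x y = \<gamma>' x y"
  shows "t \<gamma> = t \<gamma>'"
proof -
  obtain xs where xs: "set xs \<subseteq> carrier V \<times> carrier W" "t = (\<Sum>(x, y)\<leftarrow>xs. pure_tensor V W x y)"
    using tensor_rep[OF assms(1,2)] by metis
  have "map (\<lambda>(x, y). \<gamma> x y) xs = map (\<lambda>(x, y). \<gamma>' x y) xs" using xs(1) assms(5) by auto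
  then show ?thesis unfolding xs(2) tensor_rep_eval[OF assms(3)] tensor_rep_eval[OF assms(4)]
    by (rule arg_cong[where f=sum_list])
qed

text \<open>
  A presentation of the tensor evaluates to the sum of the values of the form; in particular the
  sum is independent of the presentation, and the description of the lift is proper.
\<close>

lemma tensor_lift_scalar:
  assumes "vec_space V" "t \<in> carrier (tensor_space V W)" "bilin_map V W scalars \<mu>"
  shows "tensor_lift V W \<mu> t = t \<mu>"
proof -
  obtain xs where xs: "set xs \<subseteq> carrier V \<times> carrier W" "t = (\<Sum>(x, y)\<leftarrow>xs. pure_tensor V W x y)"
    using tensor_rep[OF assms(1,2)] by metis
  show ?thesis unfolding tensor_lift_def
  proof (rule the_equality)
    show "\<exists>xs. set xs \<subseteq> carrier V \<times> carrier W \<and>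
        t = (\<Sum>(x, y)\<leftarrow>xs. pure_tensor V W x y) \<and> t \<mu> = (\<Sum>(x, y)\<leftarrow>xs. \<mu> x y)"
      using xs tensor_rep_eval[OF assms(3)] by blast
  qed (auto simp: tensor_rep_eval[OF assms(3)])
qed

text \<open>
  The same for maps into a function space, where the values can be compared pointwise. Tensor
  spaces and the dual are such spaces.
\<close>

lemma tensor_lift_fun:
  assumes "vec_space V" "t \<in> carrier (tensor_space V W)"
    and \<mu>: "\<And>\<beta>. bilin_map V W scalars (\<lambda>x y. \<mu> x y \<beta>)"
  shows "tensor_lift V W \<mu> t = (\<lambda>\<beta>. t (\<lambda>x y. \<mu> x y \<beta>))"
proof -
  have eval: "(\<Sum>(x, y)\<leftarrow>xs. pure_tensor V W x y) (\<lambda>x y. \<mu> x y \<beta>) = (\<Sum>(x, y)\<leftarrow>xs. \<mu> x y) \<beta>" for xs \<beta>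
  proof -
    have "(\<Sum>(x, y)\<leftarrow>xs. pure_tensor V W x y) (\<lambda>x y. \<mu> x y \<beta>) = (\<Sum>(x, y)\<leftarrow>xs. \<mu> x y \<beta>)"
      by (rule tensor_rep_eval[OF \<mu>])
    then show ?thesis by (simp add: sum_list_fun_apply case_prod_unfold)
  qed
  obtain xs where xs: "set xs \<subseteq> carrier V \<times> carrier W" "t = (\<Sum>(x, y)\<leftarrow>xs. pure_tensor V W x y)"
    using tensor_rep[OF assms(1,2)] by metis
  show ?thesis unfolding tensor_lift_def
  proof (rule the_equality)
    show "\<exists>xs. set xs \<subseteq> carrier V \<times> carrier W \<and>
        t = (\<Sum>(x, y)\<leftarrow>xs. pure_tensor V W x y) \<and> (\<lambda>\<beta>. t (\<lambda>x y. \<mu> x y \<beta>)) = (\<Sum>(x, y)\<leftarrow>xs. \<mu> x y)"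
      using xs eval by (intro exI[of _ xs]) (simp add: fun_eq_iff)
  qed (auto simp: eval)
qed

lemma pure_tensor_bilin:
  assumes "vec_space V" "vec_space W"
    and f: "lin_map V' V f" "lin_map W' W g"
  shows "bilin_map V' W' scalars (\<lambda>x y. pure_tensor V W (f x) (g y) \<beta>)"
proof (cases "bilin_map V W scalars \<beta>")
  case True
  then show ?thesis using f
    by (intro bilin_scalarsI lin_map_scalarsI) (auto simp: pure_tensor_def lin_map_def bilin_scalarsD[OF True])
qed (simp add: pure_tensor_def bilin_zero)

lemma pure_tensor_closed:
  fixes V :: "('k::field, 'a::ab_group_add, 'm) vspace_scheme" and W :: "('k, 'b::ab_group_add, 'n) vspace_scheme"
  shows "x \<in> carrier V \<Longrightarrow> y \<in> carrier W \<Longrightarrow> pure_tensor V W x y \<in> carrier (tensor_space V W)"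
proof -
  interpret vector_space "\<lambda>c (t :: ('a \<Rightarrow> 'b \<Rightarrow> 'k) \<Rightarrow> 'k) \<beta>. c * t \<beta>" by (rule fun_vector_space)
  show "x \<in> carrier V \<Longrightarrow> y \<in> carrier W \<Longrightarrow> pure_tensor V W x y \<in> carrier (tensor_space V W)"
    by (auto simp: tensor_space_def intro!: span_base)
qed

lemma tensor_vec_space:
  fixes V :: "('k::field, 'a::ab_group_add, 'm) vspace_scheme" and W :: "('k, 'b::ab_group_add, 'n) vspace_scheme"
  shows "vec_space (tensor_space V W)"
proof -
  interpret vector_space "\<lambda>c (t :: ('a \<Rightarrow> 'b \<Rightarrow> 'k) \<Rightarrow> 'k) \<beta>. c * t \<beta>" by (rule fun_vector_space)
  show ?thesis
  proof (rule vec_space.intro)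
    show "vector_space (smult (tensor_space V W))"
      unfolding tensor_space_def vspace.simps by (rule fun_vector_space)
    show "module.subspace (smult (tensor_space V W)) (carrier (tensor_space V W))"
      unfolding tensor_space_def vspace.simps by (rule subspace_span)
  qed
qed

text \<open>
  Coordinate functionals are needed to see that a lift into an abstract space is well defined.
\<close>

locale based_space =
  fixes V :: "('k::field, 'a::ab_group_add, 'm) vspace_scheme" and I :: "'i set"
    and bv :: "'i \<Rightarrow> 'a" and cv :: "'i \<Rightarrow> 'a \<Rightarrow> 'k"
  assumes space: "vec_space V" and finite_basis: "finite I"
    and basis_closed: "i \<in> I \<Longrightarrow> bv i \<in> carrier V"
    and coord_lin: "i \<in> I \<Longrightarrow> lin_map V scalars (cv i)"
    and coord_basis: "i \<in> I \<Longrightarrow> j \<in> I \<Longrightarrow> cv i (bv j) = (if i = j then 1 else 0)"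
    and basis_expand: "x \<in> carrier V \<Longrightarrow> x = (\<Sum>i\<in>I. smult V (cv i x) (bv i))"
begin

lemmas closed = vec_space_closed[OF space]

lemma functional_expand:
  assumes "lin_map V scalars f" "x \<in> carrier V" shows "f x = (\<Sum>i\<in>I. cv i x * f (bv i))"
proof -
  have "f x = f (\<Sum>i\<in>I. smult V (cv i x) (bv i))" using basis_expand[OF assms(2)] by simp
  also have "\<dots> = (\<Sum>i\<in>I. f (smult V (cv i x) (bv i)))"
    by (rule lin_map_sum[OF space assms(1)]) (intro closed basis_closed)
  finally show ?thesis using lin_map_scalarsD(2)[OF assms(1) basis_closed] by simp
qed

lemma coord_eqI:
  assumes "x \<in> carrier V" "y \<in> carrier V" "\<And>i. i \<in> I \<Longrightarrow> cv i x = cv i y" shows "x = y"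
  using basis_expand[OF assms(1)] basis_expand[OF assms(2)] assms(3) by simp

lemma bilin_coord: "i \<in> I \<Longrightarrow> j \<in> I \<Longrightarrow> bilin_map V V scalars (\<lambda>x y. cv i x * cv j y)"
  by (intro bilin_scalarsI lin_map_scalarsI)
     (auto simp: lin_map_scalarsD[OF coord_lin] algebra_simps)

lemma bilin_expand:
  assumes "bilin_map V V scalars \<gamma>" "x \<in> carrier V" "y \<in> carrier V"
  shows "\<gamma> x y = (\<Sum>i\<in>I. \<Sum>j\<in>I. cv i x * cv j y * \<gamma> (bv i) (bv j))"
proof -
  have "\<gamma> x y = (\<Sum>i\<in>I. cv i x * \<gamma> (bv i) y)"
    by (rule functional_expand[OF bilin_mapD(2)[OF assms(1,3)] assms(2)])
  also have "\<dots> = (\<Sum>i\<in>I. cv i x * (\<Sum>j\<in>I. cv j y * \<gamma> (bv i) (bv j)))"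
    by (intro sum.cong refl arg_cong2[where f="(*)"] functional_expand bilin_mapD(1)[OF assms(1)] basis_closed assms)
  finally show ?thesis by (simp add: sum_distrib_left mult.assoc)
qed

lemma tensor_expand:
  assumes t: "t \<in> carrier (tensor_space V V)" and \<gamma>: "bilin_map V V scalars \<gamma>"
  shows "t \<gamma> = (\<Sum>i\<in>I. \<Sum>j\<in>I. t (\<lambda>x y. cv i x * cv j y) * \<gamma> (bv i) (bv j))"
proof -
  obtain xs where xs: "set xs \<subseteq> carrier V \<times> carrier V" "t = (\<Sum>(x, y)\<leftarrow>xs. pure_tensor V V x y)"
    using tensor_rep[OF space t] by metis
  have "(\<Sum>(x, y)\<leftarrow>xs. \<gamma> x y) = (\<Sum>i\<in>I. \<Sum>j\<in>I. (\<Sum>(x, y)\<leftarrow>xs. cv i x * cv j y) * \<gamma> (bv i) (bv j))"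
    using xs(1) by (induction xs) (auto simp: distrib_right sum.distrib bilin_expand[OF \<gamma>])
  also have "\<dots> = (\<Sum>i\<in>I. \<Sum>j\<in>I. t (\<lambda>x y. cv i x * cv j y) * \<gamma> (bv i) (bv j))"
    unfolding xs(2) by (intro sum.cong refl) (simp add: tensor_rep_eval[OF bilin_coord])
  finally show ?thesis unfolding xs(2) tensor_rep_eval[OF \<gamma>] by (simp only: xs(2)[symmetric])
qed

text \<open>
  Two presentations of a tensor give sums with the same coordinates, because each coordinate of
  the bilinear map is a bilinear form.
\<close>

lemma tensor_lift_functional:
  assumes U: "vec_space U" and t: "t \<in> carrier (tensor_space U W)" and \<mu>: "bilin_map U W V \<mu>"
  shows "tensor_lift U W \<mu> t \<in> carrier V"
    and "lin_map V scalars g \<Longrightarrow> g (tensor_lift U W \<mu> t) = t (\<lambda>x y. g (\<mu> x y))"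
proof -
  have bil: "bilin_map U W scalars (\<lambda>x y. g (\<mu> x y))" if "lin_map V scalars g" for g
    using that \<mu> unfolding bilin_map_def lin_map_def scalars_def by simp
  have ev: "(\<Sum>(x, y)\<leftarrow>xs. \<mu> x y) \<in> carrier V"
      "lin_map V scalars g \<Longrightarrow> g (\<Sum>(x, y)\<leftarrow>xs. \<mu> x y) = (\<Sum>(x, y)\<leftarrow>xs. pure_tensor U W x y) (\<lambda>x y. g (\<mu> x y))"
    if "set xs \<subseteq> carrier U \<times> carrier W" for xs g
  proof -
    show "(\<Sum>(x, y)\<leftarrow>xs. \<mu> x y) \<in> carrier V"
      using that by (intro vec_space_sum_list[OF space]) (auto intro: bilin_mapD(3)[OF \<mu>])
    assume g: "lin_map V scalars g"
    have "g (\<Sum>z\<leftarrow>xs. \<mu> (fst z) (snd z)) = (\<Sum>z\<leftarrow>xs. g (\<mu> (fst z) (snd z)))"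
      using that by (intro lin_map_sum_list[OF space g]) (auto intro!: bilin_mapD(3)[OF \<mu>])
    then show "g (\<Sum>(x, y)\<leftarrow>xs. \<mu> x y) = (\<Sum>(x, y)\<leftarrow>xs. pure_tensor U W x y) (\<lambda>x y. g (\<mu> x y))"
      unfolding tensor_rep_eval[OF bil[OF g]] by (simp add: case_prod_unfold)
  qed
  obtain xs where xs: "set xs \<subseteq> carrier U \<times> carrier W" "t = (\<Sum>(x, y)\<leftarrow>xs. pure_tensor U W x y)"
    using tensor_rep[OF U t] by metis
  have eq: "tensor_lift U W \<mu> t = (\<Sum>(x, y)\<leftarrow>xs. \<mu> x y)"
    unfolding tensor_lift_def
  proof (rule the_equality)
    fix v assume "\<exists>xs. set xs \<subseteq> carrier U \<times> carrier W \<and>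
        t = (\<Sum>(x, y)\<leftarrow>xs. pure_tensor U W x y) \<and> v = (\<Sum>(x, y)\<leftarrow>xs. \<mu> x y)"
    then obtain ys where ys: "set ys \<subseteq> carrier U \<times> carrier W" "t = (\<Sum>(x, y)\<leftarrow>ys. pure_tensor U W x y)"
      "v = (\<Sum>(x, y)\<leftarrow>ys. \<mu> x y)" by blast
    show "v = (\<Sum>(x, y)\<leftarrow>xs. \<mu> x y)"
      unfolding ys(3)
    proof (rule coord_eqI[OF ev(1)[OF ys(1)] ev(1)[OF xs(1)]])
      fix i assume i: "i \<in> I"
      show "cv i (\<Sum>(x, y)\<leftarrow>ys. \<mu> x y) = cv i (\<Sum>(x, y)\<leftarrow>xs. \<mu> x y)"
        unfolding ev(2)[OF ys(1) coord_lin[OF i]] ev(2)[OF xs(1) coord_lin[OF i]]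
        by (simp only: ys(2)[symmetric] xs(2)[symmetric])
    qed
  qed (use xs in blast)
  show "tensor_lift U W \<mu> t \<in> carrier V" unfolding eq by (rule ev(1)[OF xs(1)])
  show "g (tensor_lift U W \<mu> t) = t (\<lambda>x y. g (\<mu> x y))" if "lin_map V scalars g"
    unfolding eq ev(2)[OF xs(1) that] by (simp only: xs(2))
qed

end

text \<open>
  A basis chosen from a finite spanning set, with the coordinates of the representation in it.
\<close>

lemma finite_dimensional_based:
  assumes V: "vec_space V" and fd: "finite_dimensional V"
  obtains B c where "based_space V B (\<lambda>x. x) c"
proof -
  interpret vector_space "smult V" by (rule vec_space.ambient[OF V])
  obtain B0 where B0: "finite B0" "B0 \<subseteq> carrier V" "carrier V = span B0"
    using fd by (auto simp: finite_dimensional_def)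
  obtain B where B: "B \<subseteq> B0" "independent B" "B0 \<subseteq> span B"
    using maximal_independent_subset by blast
  have fin: "finite B" using B B0 finite_subset by blast
  have span: "span B = carrier V"
    using B B0 span_mono[of B B0] span_minimal[OF B(3) subspace_span] by auto
  have "based_space V B (\<lambda>x. x) (\<lambda>i x. representation B x i)"
  proof (rule based_space.intro[OF V fin])
    show "lin_map V scalars (\<lambda>x. representation B x i)" if "i \<in> B" for i
      by (rule lin_map_scalarsI) (simp_all add: span[symmetric] representation_add representation_scale B(2))
    show "representation B j i = (if i = j then 1 else 0)" if "i \<in> B" "j \<in> B" for i j
      using that by (auto simp: representation_basis B(2))
    show "x = (\<Sum>i\<in>B. smult V (representation B x i) i)" if "x \<in> carrier V" for x
      using that sum_representation_eq[OF B(2) _ fin order_refl, of x] by (simp add: span)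
    show "i \<in> carrier V" if "i \<in> B" for i using that B B0 by auto
  qed
  then show thesis by (rule that)
qed

section \<open>Tensor products of linear maps and of algebras\<close>

lemma tensor_lift_fun_closed:
  assumes "vec_space V" "t \<in> carrier (tensor_space V W)"
    and \<mu>: "\<And>\<beta>. bilin_map V W scalars (\<lambda>x y. \<mu> x y \<beta>)"
    and U: "vec_space U" "\<And>x y. x \<in> carrier V \<Longrightarrow> y \<in> carrier W \<Longrightarrow> \<mu> x y \<in> carrier U"
  shows "tensor_lift V W \<mu> t \<in> carrier U"
proof -
  obtain xs where xs: "set xs \<subseteq> carrier V \<times> carrier W" "t = (\<Sum>(x, y)\<leftarrow>xs. pure_tensor V W x y)"
    using tensor_rep[OF assms(1,2)] by metis
  have "t (\<lambda>x y. \<mu> x y \<beta>) = (\<Sum>(x, y)\<leftarrow>xs. \<mu> x y) \<beta>" for \<beta>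
  proof -
    have "t (\<lambda>x y. \<mu> x y \<beta>) = (\<Sum>(x, y)\<leftarrow>xs. \<mu> x y \<beta>)" unfolding xs(2) by (rule tensor_rep_eval[OF \<mu>])
    then show ?thesis by (simp add: sum_list_fun_apply case_prod_unfold)
  qed
  then have "tensor_lift V W \<mu> t = (\<Sum>(x, y)\<leftarrow>xs. \<mu> x y)"
    unfolding tensor_lift_fun[OF assms(1,2) \<mu>] by (simp add: fun_eq_iff)
  also have "\<dots> \<in> carrier U" using xs(1) by (intro vec_space_sum_list[OF U(1)]) (auto intro: U(2))
  finally show ?thesis .
qed

lemma bilin_cong:
  assumes "vec_space V" "vec_space W" "bilin_map V W scalars \<gamma>"
    and "\<And>x y. x \<in> carrier V \<Longrightarrow> y \<in> carrier W \<Longrightarrow> \<gamma>' x y = \<gamma> x y"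
  shows "bilin_map V W scalars \<gamma>'"
  using assms(4) vec_space_closed[OF assms(1)] vec_space_closed[OF assms(2)]
  by (intro bilin_scalarsI lin_map_scalarsI) (simp_all add: bilin_scalarsD[OF assms(3)])

lemma bilin_sum_list:
  assumes "\<And>z. z \<in> set xs \<Longrightarrow> bilin_map V W scalars (\<lambda>x y. F x y z)"
  shows "bilin_map V W scalars (\<lambda>x y. \<Sum>z\<leftarrow>xs. F x y z)"
  using assms
proof (induction xs)
  case Nil
  show ?case by (simp add: bilin_zero)
next
  case (Cons z xs)
  have 1: "bilin_map V W scalars (\<lambda>x y. F x y z)" and 2: "bilin_map V W scalars (\<lambda>x y. \<Sum>z\<leftarrow>xs. F x y z)"
    using Cons by auto
  show ?case
    by (intro bilin_scalarsI lin_map_scalarsI)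
       (simp_all add: bilin_scalarsD[OF 1] bilin_scalarsD[OF 2] algebra_simps)
qed

text \<open>
  Fubini for tensors: a form obtained by evaluating one tensor slot remains bilinear in the
  other.
\<close>

lemma tensor_bilin:
  assumes V: "vec_space V" "vec_space W" and V': "vec_space V'" and t: "t \<in> carrier (tensor_space V' W')"
    and G: "\<And>x y. x \<in> carrier V \<Longrightarrow> y \<in> carrier W \<Longrightarrow> bilin_map V' W' scalars (G x y)"
    and G': "\<And>x' y'. x' \<in> carrier V' \<Longrightarrow> y' \<in> carrier W' \<Longrightarrow> bilin_map V W scalars (\<lambda>x y. G x y x' y')"
  shows "bilin_map V W scalars (\<lambda>x y. t (G x y))"
proof -
  obtain xs where xs: "set xs \<subseteq> carrier V' \<times> carrier W'" "t = (\<Sum>(x, y)\<leftarrow>xs. pure_tensor V' W' x y)"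
    using tensor_rep[OF V' t] by metis
  show ?thesis
  proof (rule bilin_cong[OF V])
    show "bilin_map V W scalars (\<lambda>x y. \<Sum>z\<leftarrow>xs. G x y (fst z) (snd z))"
      using xs(1) by (intro bilin_sum_list G') auto
    show "t (G x y) = (\<Sum>z\<leftarrow>xs. G x y (fst z) (snd z))" if "x \<in> carrier V" "y \<in> carrier W" for x y
      unfolding xs(2) tensor_rep_eval[OF G[OF that]] by (simp add: case_prod_unfold)
  qed
qed

lemma pure_tensor_linear:
  "x \<in> carrier V \<Longrightarrow> y \<in> carrier W \<Longrightarrow> z \<in> carrier W \<Longrightarrow>
     pure_tensor V W x (y + z) = pure_tensor V W x y + pure_tensor V W x z"
  "x \<in> carrier V \<Longrightarrow> y \<in> carrier W \<Longrightarrow>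
     pure_tensor V W x (smult W c y) = smult (tensor_space V W) c (pure_tensor V W x y)"
  "x \<in> carrier V \<Longrightarrow> x' \<in> carrier V \<Longrightarrow> y \<in> carrier W \<Longrightarrow>
     pure_tensor V W (x + x') y = pure_tensor V W x y + pure_tensor V W x' y"
  "x \<in> carrier V \<Longrightarrow> y \<in> carrier W \<Longrightarrow>
     pure_tensor V W (smult V c x) y = smult (tensor_space V W) c (pure_tensor V W x y)"
  by (auto simp: pure_tensor_def fun_eq_iff bilin_scalarsD tensor_space_def)

lemma tensor_space_ops [simp]: "smult (tensor_space V W) c t \<beta> = c * t \<beta>"
  by (simp add: tensor_space_def)

lemma pure_tensor_eval: "bilin_map V W scalars \<beta> \<Longrightarrow> pure_tensor V W x y \<beta> = \<beta> x y"
  by (simp add: pure_tensor_def)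

lemma bilin_add_scale:
  assumes "bilin_map V W scalars \<gamma>" "bilin_map V W scalars \<gamma>'"
  shows "bilin_map V W scalars (\<lambda>x y. \<gamma> x y + \<gamma>' x y)" "bilin_map V W scalars (\<lambda>x y. c * \<gamma> x y)"
  by (intro bilin_scalarsI lin_map_scalarsI; simp add: bilin_scalarsD[OF assms(1)] bilin_scalarsD[OF assms(2)] algebra_simps)+

lemma tensor_form_linear:
  assumes V: "vec_space V" and t: "t \<in> carrier (tensor_space V W)"
    and \<gamma>: "bilin_map V W scalars \<gamma>" "bilin_map V W scalars \<gamma>'"
  shows "t (\<lambda>x y. \<gamma> x y + \<gamma>' x y) = t \<gamma> + t \<gamma>'" "t (\<lambda>x y. c * \<gamma> x y) = c * t \<gamma>"
proof -
  obtain xs where xs: "t = (\<Sum>(x, y)\<leftarrow>xs. pure_tensor V W x y)"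
    using tensor_rep[OF V t] by metis
  note ev = tensor_rep_eval[OF bilin_add_scale(1)[OF \<gamma>]] tensor_rep_eval[OF bilin_add_scale(2)[OF \<gamma>]]
    tensor_rep_eval[OF \<gamma>(1)] tensor_rep_eval[OF \<gamma>(2)]
  show "t (\<lambda>x y. \<gamma> x y + \<gamma>' x y) = t \<gamma> + t \<gamma>'" unfolding xs ev by (induction xs) auto
  show "t (\<lambda>x y. c * \<gamma> x y) = c * t \<gamma>" unfolding xs ev by (induction xs) (auto simp: algebra_simps)
qed

lemma tensor_eval_lin: "lin_map (tensor_space V W) scalars (\<lambda>t. t \<beta>)"
  by (intro lin_map_scalarsI) (simp_all)

lemma tensor_assoc_aux:
  assumes V: "vec_space V" "vec_space W" "vec_space U" and \<gamma>: "bilin_map (tensor_space V W) U scalars \<gamma>"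
  shows "x \<in> carrier V \<Longrightarrow> bilin_map W U scalars (\<lambda>y z. \<gamma> (pure_tensor V W x y) z)"
    and "bilin_map V (tensor_space W U) scalars (\<lambda>x w. w (\<lambda>y z. \<gamma> (pure_tensor V W x y) z))"
proof -
  show 1: "bilin_map W U scalars (\<lambda>y z. \<gamma> (pure_tensor V W x y) z)" if "x \<in> carrier V" for x
    using that by (intro bilin_scalarsI lin_map_scalarsI)
      (simp_all add: pure_tensor_linear bilin_scalarsD[OF \<gamma>] pure_tensor_closed)
  show "bilin_map V (tensor_space W U) scalars (\<lambda>x w. w (\<lambda>y z. \<gamma> (pure_tensor V W x y) z))"
  proof (rule bilin_scalarsI)
    fix w assume w: "w \<in> carrier (tensor_space W U)"
    obtain xs where xs: "set xs \<subseteq> carrier W \<times> carrier U" "w = (\<Sum>(x, y)\<leftarrow>xs. pure_tensor W U x y)"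
      using tensor_rep[OF V(2) w] by metis
    have ev: "w (\<lambda>y z. \<gamma> (pure_tensor V W x y) z) = (\<Sum>(y, z)\<leftarrow>xs. \<gamma> (pure_tensor V W x y) z)"
      if "x \<in> carrier V" for x unfolding xs(2) by (rule tensor_rep_eval[OF 1[OF that]])
    have *: "(\<Sum>(y, z)\<leftarrow>ys. \<gamma> (pure_tensor V W (x + x') y) z) =
        (\<Sum>(y, z)\<leftarrow>ys. \<gamma> (pure_tensor V W x y) z) + (\<Sum>(y, z)\<leftarrow>ys. \<gamma> (pure_tensor V W x' y) z)"
        "(\<Sum>(y, z)\<leftarrow>ys. \<gamma> (pure_tensor V W (smult V c x) y) z) = c * (\<Sum>(y, z)\<leftarrow>ys. \<gamma> (pure_tensor V W x y) z)"
      if "set ys \<subseteq> carrier W \<times> carrier U" "x \<in> carrier V" "x' \<in> carrier V" for x x' c ys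
      using that by (induction ys)
        (auto simp: pure_tensor_linear bilin_scalarsD[OF \<gamma>] pure_tensor_closed algebra_simps)
    show "lin_map V scalars (\<lambda>x. w (\<lambda>y z. \<gamma> (pure_tensor V W x y) z))"
      by (intro lin_map_scalarsI) (simp_all add: ev *[OF xs(1)] vec_space_closed[OF V(1)])
  qed (rule tensor_eval_lin)
qed

lemma tensor_assoc_eval:
  assumes V: "vec_space V" "vec_space W" "vec_space U" and t: "t \<in> carrier (tensor_space V (tensor_space W U))"
  shows "tensor_assoc V W U t \<in> carrier (tensor_space (tensor_space V W) U)"
    and "bilin_map (tensor_space V W) U scalars \<gamma> \<Longrightarrow>
      tensor_assoc V W U t \<gamma> = t (\<lambda>x w. w (\<lambda>y z. \<gamma> (pure_tensor V W x y) z))"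
proof -
  let ?p = "\<lambda>x y z. pure_tensor (tensor_space V W) U (pure_tensor V W x y) z"
  have b1: "bilin_map W U scalars (\<lambda>y z. ?p x y z \<beta>)" if "x \<in> carrier V" for x \<beta>
    by (cases "bilin_map (tensor_space V W) U scalars \<beta>")
       (simp_all add: pure_tensor_def[of "tensor_space V W"] tensor_assoc_aux(1)[OF V] that bilin_zero)
  have inner: "tensor_lift W U (?p x) w = (\<lambda>\<beta>. w (\<lambda>y z. ?p x y z \<beta>))"
    "tensor_lift W U (?p x) w \<in> carrier (tensor_space (tensor_space V W) U)"
    if x: "x \<in> carrier V" and w: "w \<in> carrier (tensor_space W U)" for x w
  proof -
    show "tensor_lift W U (?p x) w = (\<lambda>\<beta>. w (\<lambda>y z. ?p x y z \<beta>))"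
      by (rule tensor_lift_fun[OF V(2) w b1[OF x]])
    show "tensor_lift W U (?p x) w \<in> carrier (tensor_space (tensor_space V W) U)"
      by (rule tensor_lift_fun_closed[OF V(2) w b1[OF x] tensor_vec_space])
         (intro pure_tensor_closed x)
  qed
  have b2': "bilin_map V (tensor_space W U) scalars (\<lambda>x w. w (\<lambda>y z. ?p x y z \<beta>))" for \<beta>
  proof (cases "bilin_map (tensor_space V W) U scalars \<beta>")
    case True
    then show ?thesis using tensor_assoc_aux(2)[OF V True] by (simp add: pure_tensor_def[of "tensor_space V W"])
  next
    case False
    show ?thesis
      by (rule bilin_cong[OF V(1) tensor_vec_space bilin_zero])
         (simp add: pure_tensor_def[of "tensor_space V W"] False tensor_zero_form[OF V(2)])
  qed
  have b2: "bilin_map V (tensor_space W U) scalars (\<lambda>x w. tensor_lift W U (?p x) w \<beta>)" for \<beta>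
    by (rule bilin_cong[OF V(1) tensor_vec_space b2']) (simp add: inner(1))
  show "tensor_assoc V W U t \<in> carrier (tensor_space (tensor_space V W) U)"
    unfolding tensor_assoc_def
    by (rule tensor_lift_fun_closed[OF V(1) t b2 tensor_vec_space inner(2)])
  assume \<gamma>: "bilin_map (tensor_space V W) U scalars \<gamma>"
  have "tensor_assoc V W U t \<gamma> = t (\<lambda>x w. tensor_lift W U (?p x) w \<gamma>)"
    unfolding tensor_assoc_def by (simp only: tensor_lift_fun[OF V(1) t b2])
  also have "\<dots> = t (\<lambda>x w. w (\<lambda>y z. ?p x y z \<gamma>))"
    by (rule tensor_cong[OF V(1) t b2 b2']) (simp only: inner(1))
  finally show "tensor_assoc V W U t \<gamma> = t (\<lambda>x w. w (\<lambda>y z. \<gamma> (pure_tensor V W x y) z))"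
    by (simp add: pure_tensor_eval[OF \<gamma>])
qed

text \<open>
  The part of the structure of an algebra that makes products of tensors computable; it is
  inherited by tensor products.
\<close>

definition bilin_algebra :: "('k::field, 'a::ab_group_add, 'm) alg_scheme \<Rightarrow> bool" where
  "bilin_algebra A \<longleftrightarrow> vec_space A \<and> bilin_map A A A (mult A)"

lemma bilin_algebraD:
  assumes "bilin_algebra A" "x \<in> carrier A" "y \<in> carrier A"
  shows "mult A x y \<in> carrier A"
    "z \<in> carrier A \<Longrightarrow> mult A x (y + z) = mult A x y + mult A x z"
    "z \<in> carrier A \<Longrightarrow> mult A (x + z) y = mult A x y + mult A z y"
    "mult A x (smult A c y) = smult A c (mult A x y)" "mult A (smult A c x) y = smult A c (mult A x y)"
  using assms by (auto simp: bilin_algebra_def bilin_map_def lin_map_def)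

lemma tensor_alg_simps [simp]:
  "carrier (tensor_alg A B) = carrier (tensor_space A B)" "smult (tensor_alg A B) = smult (tensor_space A B)"
  by (simp_all add: tensor_alg_def)

lemma tensor_mult_forms:
  fixes A :: "('k::field, 'a::ab_group_add, 'm) alg_scheme" and B :: "('k, 'b::ab_group_add, 'n) alg_scheme"
  assumes A: "bilin_algebra A" and B: "bilin_algebra B" and \<gamma>: "bilin_map A B scalars \<gamma>"
  shows "x \<in> carrier A \<Longrightarrow> y \<in> carrier B \<Longrightarrow> bilin_map A B scalars (\<lambda>x' y'. \<gamma> (mult A x x') (mult B y y'))"
    and "x' \<in> carrier A \<Longrightarrow> y' \<in> carrier B \<Longrightarrow> bilin_map A B scalars (\<lambda>x y. \<gamma> (mult A x x') (mult B y y'))"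
proof -
  have V: "vec_space A" "vec_space B" using A B by (auto simp: bilin_algebra_def)
  note bs = bilin_algebraD[OF A] bilin_algebraD[OF B] vec_space_closed[OF V(1)] vec_space_closed[OF V(2)]
  show "x \<in> carrier A \<Longrightarrow> y \<in> carrier B \<Longrightarrow> bilin_map A B scalars (\<lambda>x' y'. \<gamma> (mult A x x') (mult B y y'))"
    by (intro bilin_scalarsI lin_map_scalarsI) (simp_all add: bilin_scalarsD[OF \<gamma>] bs)
  show "x' \<in> carrier A \<Longrightarrow> y' \<in> carrier B \<Longrightarrow> bilin_map A B scalars (\<lambda>x y. \<gamma> (mult A x x') (mult B y y'))"
    by (intro bilin_scalarsI lin_map_scalarsI) (simp_all add: bilin_scalarsD[OF \<gamma>] bs)
qed

lemma tensor_mult_eval: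
  fixes A :: "('k::field, 'a::ab_group_add, 'm) alg_scheme" and B :: "('k, 'b::ab_group_add, 'n) alg_scheme"
  assumes A: "bilin_algebra A" and B: "bilin_algebra B"
    and s: "s \<in> carrier (tensor_space A B)" and t: "t \<in> carrier (tensor_space A B)"
  shows "mult (tensor_alg A B) s t \<in> carrier (tensor_space A B)"
    and "bilin_map A B scalars \<gamma> \<Longrightarrow> mult (tensor_alg A B) s t \<gamma> =
       s (\<lambda>x y. t (\<lambda>x' y'. \<gamma> (mult A x x') (mult B y y')))"
proof -
  have V: "vec_space A" "vec_space B" using A B by (auto simp: bilin_algebra_def)
  note bs = bilin_algebraD[OF A] bilin_algebraD[OF B] vec_space_closed[OF V(1)] vec_space_closed[OF V(2)]
  let ?p = "\<lambda>x y x' y'. pure_tensor A B (mult A x x') (mult B y y')"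
  note c1 = tensor_mult_forms(1)[OF A B] and c2 = tensor_mult_forms(2)[OF A B]
  have b1: "bilin_map A B scalars (\<lambda>x' y'. ?p x y x' y' \<beta>)" if "x \<in> carrier A" "y \<in> carrier B" for x y \<beta>
    by (cases "bilin_map A B scalars \<beta>") (simp_all add: pure_tensor_def c1 that bilin_zero)
  have b1': "bilin_map A B scalars (\<lambda>x y. ?p x y x' y' \<beta>)" if "x' \<in> carrier A" "y' \<in> carrier B" for x' y' \<beta>
    by (cases "bilin_map A B scalars \<beta>") (simp_all add: pure_tensor_def c2 that bilin_zero)
  have inner: "tensor_lift A B (?p x y) t = (\<lambda>\<beta>. t (\<lambda>x' y'. ?p x y x' y' \<beta>))"
    "tensor_lift A B (?p x y) t \<in> carrier (tensor_space A B)"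
    if x: "x \<in> carrier A" "y \<in> carrier B" for x y
  proof -
    show "tensor_lift A B (?p x y) t = (\<lambda>\<beta>. t (\<lambda>x' y'. ?p x y x' y' \<beta>))"
      by (rule tensor_lift_fun[OF V(1) t b1[OF x]])
    show "tensor_lift A B (?p x y) t \<in> carrier (tensor_space A B)"
      by (rule tensor_lift_fun_closed[OF V(1) t b1[OF x] tensor_vec_space])
         (intro pure_tensor_closed bs x)
  qed
  have b2': "bilin_map A B scalars (\<lambda>x y. t (\<lambda>x' y'. ?p x y x' y' \<beta>))" for \<beta>
    by (rule tensor_bilin[OF V V(1) t b1 b1'])
  have b2: "bilin_map A B scalars (\<lambda>x y. tensor_lift A B (?p x y) t \<beta>)" for \<beta>
    by (rule bilin_cong[OF V b2']) (simp add: inner(1))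
  have m: "mult (tensor_alg A B) s t = tensor_lift A B (\<lambda>x y. tensor_lift A B (?p x y) t) s"
    by (simp add: tensor_alg_def)
  show "mult (tensor_alg A B) s t \<in> carrier (tensor_space A B)"
    unfolding m by (rule tensor_lift_fun_closed[OF V(1) s b2 tensor_vec_space inner(2)])
  assume \<gamma>: "bilin_map A B scalars \<gamma>"
  have "mult (tensor_alg A B) s t \<gamma> = s (\<lambda>x y. tensor_lift A B (?p x y) t \<gamma>)"
    unfolding m by (simp only: tensor_lift_fun[OF V(1) s b2])
  also have "\<dots> = s (\<lambda>x y. t (\<lambda>x' y'. ?p x y x' y' \<gamma>))"
    by (rule tensor_cong[OF V(1) s b2 b2']) (simp only: inner(1))
  finally show "mult (tensor_alg A B) s t \<gamma> = s (\<lambda>x y. t (\<lambda>x' y'. \<gamma> (mult A x x') (mult B y y')))"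
    by (simp add: pure_tensor_eval[OF \<gamma>])
qed

lemma tensor_eqI:
  assumes "vec_space V" "s \<in> carrier (tensor_space V W)" "t \<in> carrier (tensor_space V W)"
    and "\<And>\<gamma>. bilin_map V W scalars \<gamma> \<Longrightarrow> s \<gamma> = t \<gamma>"
  shows "s = t"
proof
  fix \<gamma> show "s \<gamma> = t \<gamma>"
    using assms(4) tensor_not_bilin[OF assms(1,2)] tensor_not_bilin[OF assms(1,3)]
    by (cases "bilin_map V W scalars \<gamma>") auto
qed

text \<open>
  The constructions depend on carrier and scalars only, so that an algebra and its underlying
  space can be interchanged.
\<close>

lemma bilin_map_cong_space:
  "carrier V = carrier V' \<Longrightarrow> smult V = smult V' \<Longrightarrow> carrier W = carrier W' \<Longrightarrow> smult W = smult W' \<Longrightarrow>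
    bilin_map V W U = bilin_map V' W' U"
  by (auto simp: bilin_map_def lin_map_def fun_eq_iff)

lemma pure_tensor_cong_space:
  "carrier V = carrier V' \<Longrightarrow> smult V = smult V' \<Longrightarrow> carrier W = carrier W' \<Longrightarrow> smult W = smult W' \<Longrightarrow>
    pure_tensor V W = pure_tensor V' W'"
  by (simp add: pure_tensor_def bilin_map_cong_space[of V V' W W'] fun_eq_iff)

lemma tensor_cong_space:
  "carrier V = carrier V' \<Longrightarrow> smult V = smult V' \<Longrightarrow> carrier W = carrier W' \<Longrightarrow> smult W = smult W' \<Longrightarrow>
    tensor_space V W = tensor_space V' W'"
  "carrier V = carrier V' \<Longrightarrow> smult V = smult V' \<Longrightarrow> carrier W = carrier W' \<Longrightarrow> smult W = smult W' \<Longrightarrow>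
    tensor_lift V W = tensor_lift V' W'"
  by (simp_all add: tensor_space_def tensor_lift_def pure_tensor_cong_space[of V V' W W'] fun_eq_iff)

lemma vec_space_cong_space:
  "carrier V = carrier V' \<Longrightarrow> smult V = smult V' \<Longrightarrow> vec_space V \<Longrightarrow> vec_space V'"
  by (simp add: vec_space_def)

lemma bilin_algebra_tensor:
  assumes A: "bilin_algebra A" and B: "bilin_algebra B"
  shows "bilin_algebra (tensor_alg A B)"
proof -
  have V: "vec_space A" "vec_space B" using A B by (auto simp: bilin_algebra_def)
  have vs: "vec_space (tensor_alg A B)"
    by (rule vec_space_cong_space[OF _ _ tensor_vec_space[of A B]]) simp_all
  note ev = tensor_mult_eval[OF A B]
  note cl = vec_space_closed[OF tensor_vec_space[of A B]]
  have 1: "mult (tensor_alg A B) s (t + t') = mult (tensor_alg A B) s t + mult (tensor_alg A B) s t'"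
    "mult (tensor_alg A B) s (smult (tensor_space A B) c t) = smult (tensor_space A B) c (mult (tensor_alg A B) s t)"
    "mult (tensor_alg A B) (t + t') s = mult (tensor_alg A B) t s + mult (tensor_alg A B) t' s"
    "mult (tensor_alg A B) (smult (tensor_space A B) c t) s = smult (tensor_space A B) c (mult (tensor_alg A B) t s)"
    if st: "s \<in> carrier (tensor_space A B)" "t \<in> carrier (tensor_space A B)" "t' \<in> carrier (tensor_space A B)" for s t t' c
  proof -
    have inner: "bilin_map A B scalars (\<lambda>x y. r (\<lambda>x' y'. \<gamma> (mult A x x') (mult B y y')))"
      if "r \<in> carrier (tensor_space A B)" "bilin_map A B scalars \<gamma>" for r \<gamma>
      by (rule tensor_bilin[OF V V(1) that(1) tensor_mult_forms(1)[OF A B that(2)] tensor_mult_forms(2)[OF A B that(2)]])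
    show "mult (tensor_alg A B) s (t + t') = mult (tensor_alg A B) s t + mult (tensor_alg A B) s t'"
    proof (rule tensor_eqI[OF V(1)])
      fix \<gamma> assume \<gamma>: "bilin_map A B scalars \<gamma>"
      show "mult (tensor_alg A B) s (t + t') \<gamma> = (mult (tensor_alg A B) s t + mult (tensor_alg A B) s t') \<gamma>"
        by (simp add: ev(2)[OF _ _ \<gamma>] st cl tensor_form_linear(1)[OF V(1) st(1) inner[OF st(2) \<gamma>] inner[OF st(3) \<gamma>]])
    qed (simp_all add: ev st cl)
    show "mult (tensor_alg A B) s (smult (tensor_space A B) c t) = smult (tensor_space A B) c (mult (tensor_alg A B) s t)"
    proof (rule tensor_eqI[OF V(1)])
      fix \<gamma> assume \<gamma>: "bilin_map A B scalars \<gamma>"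
      show "mult (tensor_alg A B) s (smult (tensor_space A B) c t) \<gamma> =
          smult (tensor_space A B) c (mult (tensor_alg A B) s t) \<gamma>"
        by (simp add: ev(2)[OF _ _ \<gamma>] st cl tensor_form_linear(2)[OF V(1) st(1) inner[OF st(2) \<gamma>] inner[OF st(2) \<gamma>]])
    qed (simp_all add: ev st cl)
    show "mult (tensor_alg A B) (t + t') s = mult (tensor_alg A B) t s + mult (tensor_alg A B) t' s"
      by (rule tensor_eqI[OF V(1), where W=B]) (simp_all add: ev st cl)
    show "mult (tensor_alg A B) (smult (tensor_space A B) c t) s = smult (tensor_space A B) c (mult (tensor_alg A B) t s)"
      by (rule tensor_eqI[OF V(1), where W=B]) (simp_all add: ev st cl)
  qed
  show ?thesis unfolding bilin_algebra_def
    by (intro conjI vs) (auto simp: bilin_map_def lin_map_def 1 ev(1))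
qed

section \<open>Structure constants of a weak Hopf algebra\<close>

lemma bilin_prod:
  assumes "lin_map V scalars f" "lin_map W scalars g"
  shows "bilin_map V W scalars (\<lambda>x y. f x * g y)"
  by (intro bilin_scalarsI lin_map_scalarsI)
     (simp_all add: lin_map_scalarsD[OF assms(1)] lin_map_scalarsD[OF assms(2)] algebra_simps)

lemma lin_map_comp: "lin_map U V f \<Longrightarrow> lin_map V W g \<Longrightarrow> lin_map U W (\<lambda>x. g (f x))"
  by (simp add: lin_map_def)

lemma bilin_map_comp: "bilin_map U V W \<mu> \<Longrightarrow> lin_map W X g \<Longrightarrow> bilin_map U V X (\<lambda>x y. g (\<mu> x y))"
  by (simp add: bilin_map_def lin_map_def)

lemma bilin_map_comp2:
  "bilin_map U V W \<mu> \<Longrightarrow> lin_map U' U f \<Longrightarrow> lin_map V' V g \<Longrightarrow> bilin_map U' V' W (\<lambda>x y. \<mu> (f x) (g y))"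
  by (simp add: bilin_map_def lin_map_def)

lemma lin_map_id: "lin_map V V (\<lambda>x. x)" by (simp add: lin_map_def)

locale based_weak_hopf = weak_hopf_algebra H + based_space H B "\<lambda>x. x" cv
  for H :: "('k::field, 'a::ab_group_add) weak_hopf" (structure) and B :: "'a set" and cv :: "'a \<Rightarrow> 'a \<Rightarrow> 'k"
begin

abbreviation HH where "HH \<equiv> tensor_space H H"

lemma algH: "bilin_algebra H"
  unfolding bilin_algebra_def by (intro conjI space mult_bilin)

lemmas mul_rules = bilin_algebraD[OF algH]

lemma algHH: "bilin_algebra (tensor_square H)" by (rule bilin_algebra_tensor[OF algH algH])

lemma spHH: "vec_space HH" by (rule tensor_vec_space)

lemma sq_simps:
  "pure_tensor (tensor_square H) H = pure_tensor HH H" "pure_tensor H (tensor_square H) = pure_tensor H HH"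
  "tensor_lift (tensor_square H) H = tensor_lift HH H"
  "tensor_space (tensor_square H) H = tensor_space HH H"
  "bilin_map (tensor_square H) H = bilin_map HH H"
  by (simp_all add: pure_tensor_cong_space[of "tensor_square H" HH H H] pure_tensor_cong_space[of H H "tensor_square H" HH]
    tensor_cong_space[of "tensor_square H" HH H H] bilin_map_cong_space[of "tensor_square H" HH H H] fun_eq_iff)

lemma comult_lin: "lin_map H HH \<Delta>"
  using comult_linear by (simp add: lin_map_def)

lemma comult_closed: "x \<in> carrier H \<Longrightarrow> \<Delta> x \<in> carrier HH"
  using comult_lin by (simp add: lin_map_def)

lemma antipode_closed: "x \<in> carrier H \<Longrightarrow> antipode H x \<in> carrier H"
  using antipode_linear by (simp add: lin_map_def)

lemma comult_eval_lin: "lin_map H scalars (\<lambda>h. \<Delta> h \<gamma>)"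
  by (rule lin_map_comp[OF comult_lin tensor_eval_lin])

text \<open>
  Passage from coordinates to elements and, for functionals, from coefficients to functionals;
  \<open>vec\<close> is the inverse of \<open>el\<close>.
\<close>

definition el :: "('a \<Rightarrow> 'k) \<Rightarrow> 'a" where "el x = (\<Sum>i\<in>B. x i \<odot> i)"

definition fnl :: "('a \<Rightarrow> 'k) \<Rightarrow> 'a \<Rightarrow> 'k" where "fnl \<phi> h = (\<Sum>i\<in>B. \<phi> i * cv i h)"

definition sc_m :: "'a \<Rightarrow> 'a \<Rightarrow> 'a \<Rightarrow> 'k" where "sc_m i j k = cv k (i \<cdot> j)"
definition sc_u :: "'a \<Rightarrow> 'k" where "sc_u k = cv k \<one>"
definition sc_d :: "'a \<Rightarrow> 'a \<Rightarrow> 'a \<Rightarrow> 'k" where "sc_d k i j = \<Delta> k (\<lambda>x y. cv i x * cv j y)"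
definition sc_s :: "'a \<Rightarrow> 'a \<Rightarrow> 'k" where "sc_s i j = cv j (antipode H i)"

interpretation co: structure_constants B sc_m sc_u sc_d "\<epsilon>" sc_s
  by unfold_locales (rule finite_basis)

lemma el_closed [simp]: "el x \<in> carrier H"
  unfolding el_def by (intro vec_space_sum[OF space] closed basis_closed)

lemma functional_el: "lin_map H scalars g \<Longrightarrow> g (el x) = (\<Sum>i\<in>B. x i * g i)"
  unfolding el_def
  by (subst lin_map_sum[OF space], assumption, rule closed(3)[OF basis_closed], assumption)
     (simp add: lin_map_scalarsD basis_closed)

lemma cv_el: "i \<in> B \<Longrightarrow> cv i (el x) = x i"
  by (simp add: functional_el[OF coord_lin] coord_basis if_distrib[of "\<lambda>z. _ * z"] finite_basis cong: if_cong)

lemma pr_functional: "lin_map H scalars g \<Longrightarrow> co.pr g x = g (el x)"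
  by (simp add: functional_el co.pr_def mult.commute)

lemma fnl_lin: "lin_map H scalars (fnl \<phi>)"
  unfolding fnl_def
  by (intro lin_map_scalarsI)
     (simp_all add: lin_map_scalarsD[OF coord_lin] distrib_left sum.distrib sum_distrib_left mult.left_commute)

lemma pr_el: "co.pr \<phi> x = fnl \<phi> (el x)"
  by (simp add: fnl_def cv_el co.pr_def)

lemma el_bas: "i \<in> B \<Longrightarrow> el (co.bas i) = i"
  by (rule coord_eqI) (simp_all add: basis_closed cv_el coord_basis co.bas_def)

definition vec :: "'a \<Rightarrow> 'a \<Rightarrow> 'k" where "vec h = (\<lambda>i. if i \<in> B then cv i h else 0)"

lemma vec_vecs [simp]: "vec h \<in> co.vecs" by (simp add: vec_def co.vecs_def)

lemma el_vec: "h \<in> carrier H \<Longrightarrow> el (vec h) = h"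
  by (rule coord_eqI) (simp_all add: cv_el vec_def)

lemma vec_el: "x \<in> co.vecs \<Longrightarrow> vec (el x) = x"
  by (auto simp: vec_def cv_el co.vecs_def)

lemma el_mul: "el (co.mul x y) = el x \<cdot> el y"
proof (rule coord_eqI)
  fix k assume k: "k \<in> B"
  have "cv k (el x \<cdot> el y) = (\<Sum>i\<in>B. \<Sum>j\<in>B. cv i (el x) * cv j (el y) * cv k (i \<cdot> j))"
    by (rule bilin_expand[OF bilin_map_comp[OF mult_bilin coord_lin[OF k]] el_closed el_closed])
  then show "cv k (el (co.mul x y)) = cv k (el x \<cdot> el y)"
    using k by (simp add: cv_el co.mul_def sc_m_def)
qed (simp_all add: mul_rules)

lemma el_unit: "el co.unit = \<one>"
  by (rule coord_eqI) (simp_all add: cv_el co.unit_def sc_u_def one_closed)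

lemma el_S: "el (co.S x) = antipode H (el x)"
proof (rule coord_eqI)
  fix k assume k: "k \<in> B"
  have "cv k (antipode H (el x)) = (\<Sum>i\<in>B. x i * cv k (antipode H i))"
    by (rule functional_el[OF lin_map_comp[OF antipode_linear coord_lin[OF k]]])
  then show "cv k (el (co.S x)) = cv k (antipode H (el x))" using k by (simp add: cv_el co.S_def sc_s_def)
qed (simp_all add: antipode_closed)

lemma eps_el: "co.eps x = \<epsilon> (el x)"
  by (simp add: co.eps_def pr_functional[OF counit_linear])

lemma comult_D:
  assumes \<gamma>: "bilin_map H H scalars \<gamma>"
  shows "\<Delta> (el x) \<gamma> = co.D x (\<lambda>p q. \<gamma> (el p) (el q))"
  unfolding tensor_expand[OF comult_closed[OF el_closed] \<gamma>] co.D_def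
  by (intro sum.cong refl) (simp add: functional_el[OF comult_eval_lin] sc_d_def el_bas)

lemma sweedler_scalar:
  assumes "bilin_map H H scalars \<mu>" shows "sweedler H \<mu> (el x) = co.D x (\<lambda>p q. \<mu> (el p) (el q))"
  unfolding sweedler_def tensor_lift_scalar[OF space comult_closed[OF el_closed] assms] by (rule comult_D[OF assms])

lemma sweedler_functional:
  assumes \<mu>: "bilin_map H H H \<mu>"
  shows "h \<in> carrier H \<Longrightarrow> sweedler H \<mu> h \<in> carrier H"
    and "lin_map H scalars g \<Longrightarrow> g (sweedler H \<mu> (el x)) = co.D x (\<lambda>p q. g (\<mu> (el p) (el q)))"
  unfolding sweedler_def
  by (rule tensor_lift_functional(1)[OF space comult_closed \<mu>], assumption)
     (simp only: tensor_lift_functional(2)[OF space comult_closed[OF el_closed] \<mu>] comult_D[OF bilin_map_comp[OF \<mu>]])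

lemma bilin_scale_left: "lin_map H scalars f \<Longrightarrow> bilin_map H H H (\<lambda>x y. f x \<odot> y)"
  and bilin_scale_right: "lin_map H scalars f \<Longrightarrow> bilin_map H H H (\<lambda>x y. f y \<odot> x)"
proof -
  interpret v: vector_space "smult H" by (rule ambient)
  show "lin_map H scalars f \<Longrightarrow> bilin_map H H H (\<lambda>x y. f x \<odot> y)"
    "lin_map H scalars f \<Longrightarrow> bilin_map H H H (\<lambda>x y. f y \<odot> x)"
    by (auto simp: bilin_map_def lin_map_def scalars_def closed v.scale_right_distrib v.scale_left_distrib
        v.scale_left_commute mult.commute)
qed

lemma functional_scale: "lin_map H scalars g \<Longrightarrow> h \<in> carrier H \<Longrightarrow> g (c \<odot> h) = c * g h"
  by (rule lin_map_scalarsD(2))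

lemma mul_lin: "x \<in> carrier H \<Longrightarrow> lin_map H H (\<lambda>y. x \<cdot> y)" "y \<in> carrier H \<Longrightarrow> lin_map H H (\<lambda>x. x \<cdot> y)"
  using mult_bilin by (auto simp: bilin_map_def)

text \<open>
  Test forms on \<open>(H \<otimes> H) \<otimes> H\<close>, enough to read off the axioms with three tensor factors.
\<close>

definition form3 :: "('a \<Rightarrow> 'k) \<Rightarrow> ('a \<Rightarrow> 'k) \<Rightarrow> ('a \<Rightarrow> 'k) \<Rightarrow> ('a, 'a, 'k) tensor \<Rightarrow> 'a \<Rightarrow> 'k" where
  "form3 f g h = (\<lambda>t z. t (\<lambda>x y. f x * g y) * h z)"

lemma form3_bilin: "lin_map H scalars h \<Longrightarrow> bilin_map HH H scalars (form3 f g h)"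
  unfolding form3_def by (intro bilin_prod tensor_eval_lin)

lemma comult_left_eval:
  assumes h: "h \<in> carrier H"
  shows "comult_left H h \<in> carrier (tensor_space HH H)"
    and "bilin_map HH H scalars \<gamma> \<Longrightarrow> comult_left H h \<gamma> = \<Delta> h (\<lambda>x y. \<gamma> (\<Delta> x) y)"
proof -
  have b: "bilin_map H H scalars (\<lambda>x y. pure_tensor HH H (\<Delta> x) y \<beta>)" for \<beta>
    by (rule pure_tensor_bilin[OF spHH space comult_lin lin_map_id])
  have e: "comult_left H h = tensor_lift H H (\<lambda>x y. pure_tensor HH H (\<Delta> x) y) (\<Delta> h)"
    by (simp add: comult_left_def tensor_map_def sq_simps)
  show "comult_left H h \<in> carrier (tensor_space HH H)"
    unfolding e by (rule tensor_lift_fun_closed[OF space comult_closed[OF h] b tensor_vec_space])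
      (intro pure_tensor_closed comult_closed)
  show "bilin_map HH H scalars \<gamma> \<Longrightarrow> comult_left H h \<gamma> = \<Delta> h (\<lambda>x y. \<gamma> (\<Delta> x) y)"
    unfolding e by (simp add: tensor_lift_fun[OF space comult_closed[OF h] b] pure_tensor_eval)
qed

lemma comult_right_eval:
  assumes h: "h \<in> carrier H" and \<gamma>: "bilin_map HH H scalars \<gamma>"
  shows "comult_right H h \<gamma> = \<Delta> h (\<lambda>x y. \<Delta> y (\<lambda>y z. \<gamma> (pure_tensor H H x y) z))"
proof -
  have b: "bilin_map H H scalars (\<lambda>x y. pure_tensor H HH x (\<Delta> y) \<beta>)" for \<beta>
    by (rule pure_tensor_bilin[OF space spHH lin_map_id comult_lin])
  let ?t = "tensor_lift H H (\<lambda>x y. pure_tensor H HH x (\<Delta> y)) (\<Delta> h)"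
  have t: "?t \<in> carrier (tensor_space H HH)"
    by (rule tensor_lift_fun_closed[OF space comult_closed[OF h] b tensor_vec_space])
      (intro pure_tensor_closed comult_closed)
  have "comult_right H h \<gamma> = tensor_assoc H H H ?t \<gamma>"
    by (simp add: comult_right_def tensor_map_def sq_simps)
  also have "\<dots> = ?t (\<lambda>x w. w (\<lambda>y z. \<gamma> (pure_tensor H H x y) z))"
    by (rule tensor_assoc_eval(2)[OF space space space t \<gamma>])
  also have "\<dots> = \<Delta> h (\<lambda>x y. \<Delta> y (\<lambda>y z. \<gamma> (pure_tensor H H x y) z))"
    by (simp add: tensor_lift_fun[OF space comult_closed[OF h] b]
        pure_tensor_eval[OF tensor_assoc_aux(2)[OF space space space \<gamma>]])
  finally show ?thesis .
qed

lemma square_mult_eval: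
  assumes "s \<in> carrier HH" "t \<in> carrier HH" "bilin_map H H scalars \<gamma>"
  shows "(s \<cdot>\<^bsub>tensor_square H\<^esub> t) \<gamma> = s (\<lambda>x y. t (\<lambda>x' y'. \<gamma> (x \<cdot> x') (y \<cdot> y')))"
  by (rule tensor_mult_eval(2)[OF algH algH assms])

lemma mult_form1: "bilin_map H H scalars \<gamma> \<Longrightarrow> x \<in> carrier H \<Longrightarrow> y \<in> carrier H \<Longrightarrow>
    bilin_map H H scalars (\<lambda>x' y'. \<gamma> (x \<cdot> x') (y \<cdot> y'))"
  and mult_form2: "bilin_map H H scalars \<gamma> \<Longrightarrow> x \<in> carrier H \<Longrightarrow> y \<in> carrier H \<Longrightarrow>
    bilin_map H H scalars (\<lambda>x' y'. \<gamma> (x' \<cdot> x) (y' \<cdot> y))"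
  by (rule tensor_mult_forms(1)[OF algH algH]; assumption) (rule tensor_mult_forms(2)[OF algH algH]; assumption)

lemma mult_form3: 
  assumes "bilin_map H H scalars \<gamma>" "t \<in> carrier HH"
  shows "bilin_map H H scalars (\<lambda>x y. t (\<lambda>x' y'. \<gamma> (x \<cdot> x') (y \<cdot> y')))"
  by (rule tensor_bilin[OF space space space assms(2) mult_form1[OF assms(1)] mult_form2[OF assms(1)]])

text \<open>
  Each axiom is tested on products of functionals; both sides become Sweedler sums over basis
  elements.
\<close>

lemma coords_weak_hopf: "weak_hopf_coords B sc_m sc_u sc_d \<epsilon> sc_s"
proof (rule weak_hopf_coords.intro[OF co.structure_constants_axioms weak_hopf_coords_axioms.intro])
  fix x y z \<phi> \<psi> \<chi>
  let ?f = "fnl \<phi>" and ?g = "fnl \<psi>" and ?h = "fnl \<chi>"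
  note bil = bilin_prod[OF fnl_lin fnl_lin]
  have b2: "bilin_map H H scalars (\<lambda>x y. \<Delta> x (\<lambda>x y. ?f x * ?g y) * ?h y)"
    "bilin_map H H scalars (\<lambda>x y. ?f x * \<Delta> y (\<lambda>y z. ?g y * ?h z))"
    by (intro bilin_prod comult_eval_lin fnl_lin)+
  have left: "comult_left H (el x) (form3 ?f ?g ?h) = co.D x (\<lambda>p q. co.D p (\<lambda>r t. co.pr \<phi> r * co.pr \<psi> t * co.pr \<chi> q))" for x
    unfolding comult_left_eval(2)[OF el_closed form3_bilin[OF fnl_lin]] unfolding form3_def comult_D[OF b2(1)] comult_D[OF bil]
    by (simp only: pr_el co.D_scale_right)
  have right: "comult_right H (el x) (form3 ?f ?g ?h) = co.D x (\<lambda>p q. co.D q (\<lambda>r t. co.pr \<phi> p * co.pr \<psi> r * co.pr \<chi> t))" for x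
  proof -
    have "comult_right H (el x) (form3 ?f ?g ?h) = \<Delta> (el x) (\<lambda>x y. ?f x * \<Delta> y (\<lambda>y z. ?g y * ?h z))"
    proof -
      have 1: "\<Delta> y (\<lambda>y z. form3 ?f ?g ?h (pure_tensor H H x y) z) = ?f x * \<Delta> y (\<lambda>y z. ?g y * ?h z)"
        if "y \<in> carrier H" for x y
        using tensor_form_linear(2)[OF space comult_closed[OF that] bil bil, of "?f x" \<psi> \<chi>]
        by (simp add: form3_def pure_tensor_eval[OF bil] mult.assoc)
      show ?thesis
        unfolding comult_right_eval[OF el_closed form3_bilin[OF fnl_lin]]
      proof (rule tensor_cong[OF space comult_closed[OF el_closed] _ b2(2)])
        show "bilin_map H H scalars (\<lambda>x y. \<Delta> y (\<lambda>y z. form3 ?f ?g ?h (pure_tensor H H x y) z))"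
          by (rule bilin_cong[OF space space b2(2)]) (rule 1)
      qed (rule 1)
    qed
    then show ?thesis unfolding comult_D[OF b2(2)] comult_D[OF bil]
      by (simp only: pr_el co.D_scale mult.assoc)
  qed
  show "co.pr \<phi> (co.mul (co.mul x y) z) = co.pr \<phi> (co.mul x (co.mul y z))"
    by (simp add: pr_el el_mul mult_assoc)
  show coassoc': "co.D x (\<lambda>p q. co.D p (\<lambda>r t. co.pr \<phi> r * co.pr \<psi> t * co.pr \<chi> q)) =
      co.D x (\<lambda>p q. co.D q (\<lambda>r t. co.pr \<phi> p * co.pr \<psi> r * co.pr \<chi> t))" for x
    unfolding left[symmetric] right[symmetric] by (simp add: coassoc)
  show "co.pr \<phi> (co.mul co.unit x) = co.pr \<phi> x" "co.pr \<phi> (co.mul x co.unit) = co.pr \<phi> x"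
    by (simp_all add: pr_el el_mul el_unit one_left one_right)
  show "co.D x (\<lambda>p q. co.eps p * co.pr \<phi> q) = co.pr \<phi> x"
  proof -
    have "?f (sweedler H (\<lambda>x y. \<epsilon> x \<odot> y) (el x)) = co.D x (\<lambda>p q. ?f (\<epsilon> (el p) \<odot> el q))"
      by (rule sweedler_functional(2)[OF bilin_scale_left[OF counit_linear] fnl_lin])
    then show ?thesis by (simp add: counit_left functional_scale[OF fnl_lin] pr_el eps_el)
  qed
  show "co.D x (\<lambda>p q. co.eps q * co.pr \<phi> p) = co.pr \<phi> x"
  proof -
    have "?f (sweedler H (\<lambda>x y. \<epsilon> y \<odot> x) (el x)) = co.D x (\<lambda>p q. ?f (\<epsilon> (el q) \<odot> el p))"
      by (rule sweedler_functional(2)[OF bilin_scale_right[OF counit_linear] fnl_lin])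
    then show ?thesis by (simp add: counit_right functional_scale[OF fnl_lin] pr_el eps_el)
  qed
  show "co.D (co.mul x y) (\<lambda>p q. co.pr \<phi> p * co.pr \<psi> q) =
      co.D x (\<lambda>p q. co.D y (\<lambda>r t. co.pr \<phi> (co.mul p r) * co.pr \<psi> (co.mul q t)))"
  proof -
    have "co.D (co.mul x y) (\<lambda>p q. co.pr \<phi> p * co.pr \<psi> q) = \<Delta> (el x \<cdot> el y) (\<lambda>x y. ?f x * ?g y)"
      unfolding el_mul[symmetric] comult_D[OF bil] by (simp only: pr_el)
    also have "\<dots> = \<Delta> (el x) (\<lambda>x y'. \<Delta> (el y) (\<lambda>x' y''. ?f (x \<cdot> x') * ?g (y' \<cdot> y'')))"
      unfolding comult_mult[OF el_closed el_closed]
      by (rule square_mult_eval[OF comult_closed[OF el_closed] comult_closed[OF el_closed] bil])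
    also have "\<dots> = co.D x (\<lambda>p q. co.D y (\<lambda>r t. ?f (el p \<cdot> el r) * ?g (el q \<cdot> el t)))"
      unfolding comult_D[OF mult_form3[OF bil comult_closed[OF el_closed]]]
        comult_D[OF mult_form1[OF bil el_closed el_closed]] ..
    finally show ?thesis by (simp only: pr_el el_mul)
  qed
  let ?P = "pure_tensor HH H (\<Delta> \<one>) \<one>" and ?R = "pure_tensor H HH \<one> (\<Delta> \<one>)"
  let ?Q = "tensor_assoc H H H ?R"
  have P: "?P \<in> carrier (tensor_space HH H)" by (intro pure_tensor_closed comult_closed one_closed)
  have R: "?R \<in> carrier (tensor_space H HH)" by (intro pure_tensor_closed comult_closed one_closed)
  have Q: "?Q \<in> carrier (tensor_space HH H)" by (rule tensor_assoc_eval(1)[OF space space space R])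
  have Qe: "?Q \<gamma> = \<Delta> \<one> (\<lambda>y z. \<gamma> (pure_tensor H H \<one> y) z)" if "bilin_map HH H scalars \<gamma>" for \<gamma>
    unfolding tensor_assoc_eval(2)[OF space space space R that]
    by (rule pure_tensor_eval[OF tensor_assoc_aux(2)[OF space space space that]])
  note cube = tensor_mult_eval(2)[OF algHH algH, unfolded tensor_alg_simps sq_simps, simplified]
  note f3 = form3_bilin[OF fnl_lin, of ?f ?g \<chi>]
  have f3': "bilin_map (tensor_square H) H scalars (form3 ?f ?g ?h)" using f3 by (simp add: sq_simps)
  note cf = tensor_mult_forms[OF algHH algH f3', unfolded sq_simps tensor_alg_simps]
  have pe: "pure_tensor H H \<one> y \<in> carrier HH" if "y \<in> carrier H" for y
    by (intro pure_tensor_closed one_closed that)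
  have comul_one: "comult_left H \<one> (form3 ?f ?g ?h) = co.D co.unit (\<lambda>p q. co.D q (\<lambda>r t. co.pr \<phi> p * co.pr \<psi> r * co.pr \<chi> t))"
    unfolding coassoc'[symmetric] left[symmetric] el_unit ..
  have D1: "\<Delta> \<one> \<gamma> = co.D co.unit (\<lambda>p q. \<gamma> (el p) (el q))" if "bilin_map H H scalars \<gamma>" for \<gamma>
    using comult_D[OF that, of co.unit] by (simp only: el_unit)
  have c1: "\<Delta> \<one> \<in> carrier HH" by (intro comult_closed one_closed)
  show "co.D co.unit (\<lambda>p q. co.D q (\<lambda>r t. co.pr \<phi> p * co.pr \<psi> r * co.pr \<chi> t)) =
       co.D co.unit (\<lambda>p q. co.D co.unit (\<lambda>r t. co.pr \<phi> p * co.pr \<psi> (co.mul q r) * co.pr \<chi> t))"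
  proof -
    have "comult_left H \<one> (form3 ?f ?g ?h) = ?P (\<lambda>X y. ?Q (\<lambda>X' y'. form3 ?f ?g ?h (X \<cdot>\<^bsub>tensor_square H\<^esub> X') (y \<cdot> y')))"
      unfolding comult_one_1 sq_simps by (rule cube[OF P Q f3])
    also have "\<dots> = ?Q (\<lambda>X' y'. form3 ?f ?g ?h (\<Delta> \<one> \<cdot>\<^bsub>tensor_square H\<^esub> X') (\<one> \<cdot> y'))"
      by (rule pure_tensor_eval) (rule tensor_bilin[OF spHH space spHH Q cf])
    also have "\<dots> = \<Delta> \<one> (\<lambda>y z. form3 ?f ?g ?h (\<Delta> \<one> \<cdot>\<^bsub>tensor_square H\<^esub> pure_tensor H H \<one> y) (\<one> \<cdot> z))"
      by (rule Qe) (rule cf(1)[OF c1 one_closed])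
    also have "\<dots> = co.D co.unit (\<lambda>r t. form3 ?f ?g ?h (\<Delta> \<one> \<cdot>\<^bsub>tensor_square H\<^esub> pure_tensor H H \<one> (el r)) (\<one> \<cdot> el t))"
      by (rule D1) (rule tensor_assoc_aux(1)[OF space space space cf(1)[OF c1 one_closed] one_closed])
    also have "\<dots> = co.D co.unit (\<lambda>r t. co.D co.unit (\<lambda>p q. co.pr \<phi> p * co.pr \<psi> (co.mul q r) * co.pr \<chi> t))"
    proof (rule co.D_cong)
      fix r t
      have "(\<Delta> \<one> \<cdot>\<^bsub>tensor_square H\<^esub> pure_tensor H H \<one> (el r)) (\<lambda>x y. ?f x * ?g y) =
          \<Delta> \<one> (\<lambda>x y. ?f (x \<cdot> \<one>) * ?g (y \<cdot> el r))"
        unfolding square_mult_eval[OF c1 pe[OF el_closed] bil]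
        by (rule tensor_cong[OF space c1 _ mult_form2[OF bil one_closed el_closed]])
           (rule mult_form3[OF bil pe[OF el_closed]], rule pure_tensor_eval, rule mult_form1[OF bil])
      also have "\<dots> = co.D co.unit (\<lambda>p q. ?f (el p \<cdot> \<one>) * ?g (el q \<cdot> el r))"
        by (rule D1) (rule mult_form2[OF bil one_closed el_closed])
      finally show "form3 ?f ?g ?h (\<Delta> \<one> \<cdot>\<^bsub>tensor_square H\<^esub> pure_tensor H H \<one> (el r)) (\<one> \<cdot> el t) =
          co.D co.unit (\<lambda>p q. co.pr \<phi> p * co.pr \<psi> (co.mul q r) * co.pr \<chi> t)"
        unfolding form3_def by (simp add: pr_el el_mul one_left one_right co.D_scale_right)
    qed
    finally show ?thesis unfolding comul_one by (subst co.D_commute)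
  qed
  show "co.D co.unit (\<lambda>p q. co.D q (\<lambda>r t. co.pr \<phi> p * co.pr \<psi> r * co.pr \<chi> t)) =
       co.D co.unit (\<lambda>p q. co.D co.unit (\<lambda>r t. co.pr \<phi> p * co.pr \<psi> (co.mul r q) * co.pr \<chi> t))"
  proof -
    have "comult_left H \<one> (form3 ?f ?g ?h) = ?Q (\<lambda>X y. ?P (\<lambda>X' y'. form3 ?f ?g ?h (X \<cdot>\<^bsub>tensor_square H\<^esub> X') (y \<cdot> y')))"
      unfolding comult_one_2 sq_simps by (rule cube[OF Q P f3])
    also have "\<dots> = ?Q (\<lambda>X y. form3 ?f ?g ?h (X \<cdot>\<^bsub>tensor_square H\<^esub> \<Delta> \<one>) (y \<cdot> \<one>))"
    proof (rule tensor_cong[OF spHH Q _ cf(2)[OF c1 one_closed]])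
      show "bilin_map HH H scalars (\<lambda>X y. ?P (\<lambda>X' y'. form3 ?f ?g ?h (X \<cdot>\<^bsub>tensor_square H\<^esub> X') (y \<cdot> y')))"
        by (rule tensor_bilin[OF spHH space spHH P cf])
      show "?P (\<lambda>X' y'. form3 ?f ?g ?h (X \<cdot>\<^bsub>tensor_square H\<^esub> X') (y \<cdot> y')) =
          form3 ?f ?g ?h (X \<cdot>\<^bsub>tensor_square H\<^esub> \<Delta> \<one>) (y \<cdot> \<one>)" if "X \<in> carrier HH" "y \<in> carrier H" for X y
        by (rule pure_tensor_eval) (rule cf(1)[OF that])
    qed
    also have "\<dots> = \<Delta> \<one> (\<lambda>y z. form3 ?f ?g ?h (pure_tensor H H \<one> y \<cdot>\<^bsub>tensor_square H\<^esub> \<Delta> \<one>) (z \<cdot> \<one>))"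
      by (rule Qe) (rule cf(2)[OF c1 one_closed])
    also have "\<dots> = co.D co.unit (\<lambda>r t. form3 ?f ?g ?h (pure_tensor H H \<one> (el r) \<cdot>\<^bsub>tensor_square H\<^esub> \<Delta> \<one>) (el t \<cdot> \<one>))"
      by (rule D1) (rule tensor_assoc_aux(1)[OF space space space cf(2)[OF c1 one_closed] one_closed])
    also have "\<dots> = co.D co.unit (\<lambda>r t. co.D co.unit (\<lambda>p q. co.pr \<phi> p * co.pr \<psi> (co.mul r q) * co.pr \<chi> t))"
    proof (rule co.D_cong)
      fix r t
      have "(pure_tensor H H \<one> (el r) \<cdot>\<^bsub>tensor_square H\<^esub> \<Delta> \<one>) (\<lambda>x y. ?f x * ?g y) =
          \<Delta> \<one> (\<lambda>x y. ?f (\<one> \<cdot> x) * ?g (el r \<cdot> y))"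
        unfolding square_mult_eval[OF pe[OF el_closed] c1 bil]
        by (rule pure_tensor_eval) (rule mult_form3[OF bil c1])
      also have "\<dots> = co.D co.unit (\<lambda>p q. ?f (\<one> \<cdot> el p) * ?g (el r \<cdot> el q))"
        by (rule D1) (rule mult_form1[OF bil one_closed el_closed])
      finally show "form3 ?f ?g ?h (pure_tensor H H \<one> (el r) \<cdot>\<^bsub>tensor_square H\<^esub> \<Delta> \<one>) (el t \<cdot> \<one>) =
          co.D co.unit (\<lambda>p q. co.pr \<phi> p * co.pr \<psi> (co.mul r q) * co.pr \<chi> t)"
        unfolding form3_def by (simp add: pr_el el_mul one_left one_right co.D_scale_right)
    qed
    finally show ?thesis unfolding comul_one by (subst co.D_commute)
  qed
  note epsl = lin_map_comp[OF mul_lin(1)[OF el_closed] counit_linear] lin_map_comp[OF mul_lin(2)[OF el_closed] counit_linear]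
  show "co.eps (co.mul (co.mul x y) z) = co.D y (\<lambda>p q. co.eps (co.mul x p) * co.eps (co.mul q z))"
    unfolding eps_el el_mul counit_mult_1[OF el_closed el_closed el_closed]
    by (rule sweedler_scalar) (intro bilin_prod epsl)
  show "co.eps (co.mul (co.mul x y) z) = co.D y (\<lambda>p q. co.eps (co.mul x q) * co.eps (co.mul p z))"
    unfolding eps_el el_mul counit_mult_2[OF el_closed el_closed el_closed]
    by (rule sweedler_scalar) (subst mult.commute, intro bilin_prod epsl)
  have Sb: "bilin_map H H H (\<lambda>x y. x \<cdot> antipode H y)" "bilin_map H H H (\<lambda>x y. antipode H x \<cdot> y)"
    by (rule bilin_map_comp2[OF mult_bilin lin_map_id antipode_linear] bilin_map_comp2[OF mult_bilin antipode_linear lin_map_id])+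
  have ph: "pure_tensor H H h \<one> \<in> carrier HH" "pure_tensor H H \<one> h \<in> carrier HH" if "h \<in> carrier H" for h
    using that by (auto intro: pure_tensor_closed one_closed)
  note tm = tensor_mult_eval(1)[OF algH algH]
  show "co.D x (\<lambda>p q. co.pr \<phi> (co.mul p (co.S q))) = co.D co.unit (\<lambda>p q. co.eps (co.mul p x) * co.pr \<phi> q)"
  proof -
    have b: "bilin_map H H scalars (\<lambda>x y. \<epsilon> x * ?f y)" by (intro bilin_prod counit_linear fnl_lin)
    have "co.D x (\<lambda>p q. co.pr \<phi> (co.mul p (co.S q))) = ?f (sweedler H (\<lambda>x y. x \<cdot> antipode H y) (el x))"
      unfolding sweedler_functional(2)[OF Sb(1) fnl_lin] by (simp only: pr_el el_mul el_S)
    also have "\<dots> = (\<Delta> \<one> \<cdot>\<^bsub>tensor_square H\<^esub> pure_tensor H H (el x) \<one>) (\<lambda>x y. ?f (\<epsilon> x \<odot> y))"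
      unfolding antipode_1[OF el_closed]
      by (rule tensor_lift_functional(2)[OF space tm[OF c1 ph(1)[OF el_closed]] bilin_scale_left[OF counit_linear] fnl_lin])
    also have "\<dots> = (\<Delta> \<one> \<cdot>\<^bsub>tensor_square H\<^esub> pure_tensor H H (el x) \<one>) (\<lambda>x y. \<epsilon> x * ?f y)"
      by (rule tensor_cong[OF space tm[OF c1 ph(1)[OF el_closed]] bilin_map_comp[OF bilin_scale_left[OF counit_linear] fnl_lin] b])
         (rule functional_scale[OF fnl_lin])
    also have "\<dots> = \<Delta> \<one> (\<lambda>a b. \<epsilon> (a \<cdot> el x) * ?f (b \<cdot> \<one>))"
      unfolding square_mult_eval[OF c1 ph(1)[OF el_closed] b]
      by (rule tensor_cong[OF space c1 mult_form3[OF b ph(1)[OF el_closed]] mult_form2[OF b el_closed one_closed]])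
         (rule pure_tensor_eval, rule mult_form1[OF b])
    also have "\<dots> = co.D co.unit (\<lambda>p q. co.eps (co.mul p x) * co.pr \<phi> q)"
      unfolding D1[OF mult_form2[OF b el_closed one_closed]] by (simp add: eps_el el_mul pr_el one_right)
    finally show ?thesis .
  qed
  show "co.D x (\<lambda>p q. co.pr \<phi> (co.mul (co.S p) q)) = co.D co.unit (\<lambda>p q. co.eps (co.mul x q) * co.pr \<phi> p)"
  proof -
    have b: "bilin_map H H scalars (\<lambda>x y. ?f x * \<epsilon> y)" by (intro bilin_prod counit_linear fnl_lin)
    have "co.D x (\<lambda>p q. co.pr \<phi> (co.mul (co.S p) q)) = ?f (sweedler H (\<lambda>x y. antipode H x \<cdot> y) (el x))"
      unfolding sweedler_functional(2)[OF Sb(2) fnl_lin] by (simp only: pr_el el_mul el_S)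
    also have "\<dots> = (pure_tensor H H \<one> (el x) \<cdot>\<^bsub>tensor_square H\<^esub> \<Delta> \<one>) (\<lambda>x y. ?f (\<epsilon> y \<odot> x))"
      unfolding antipode_2[OF el_closed]
      by (rule tensor_lift_functional(2)[OF space tm[OF ph(2)[OF el_closed] c1] bilin_scale_right[OF counit_linear] fnl_lin])
    also have "\<dots> = (pure_tensor H H \<one> (el x) \<cdot>\<^bsub>tensor_square H\<^esub> \<Delta> \<one>) (\<lambda>x y. ?f x * \<epsilon> y)"
      by (rule tensor_cong[OF space tm[OF ph(2)[OF el_closed] c1] bilin_map_comp[OF bilin_scale_right[OF counit_linear] fnl_lin] b])
         (simp add: functional_scale[OF fnl_lin])
    also have "\<dots> = \<Delta> \<one> (\<lambda>a b. ?f (\<one> \<cdot> a) * \<epsilon> (el x \<cdot> b))"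
      unfolding square_mult_eval[OF ph(2)[OF el_closed] c1 b]
      by (rule pure_tensor_eval[OF mult_form3[OF b c1]])
    also have "\<dots> = co.D co.unit (\<lambda>p q. co.eps (co.mul x q) * co.pr \<phi> p)"
      unfolding D1[OF mult_form1[OF b one_closed el_closed]] by (simp add: eps_el el_mul pr_el one_left mult.commute)
    finally show ?thesis .
  qed
  show "co.pr \<phi> (co.S x) = co.D x (\<lambda>p q. co.D p (\<lambda>r t. co.pr \<phi> (co.mul (co.mul (co.S r) t) (co.S q))))"
  proof -
    define M where "M = tensor_lift H H (\<lambda>x y. antipode H x \<cdot> y)"
    have M: "M t \<in> carrier H" "lin_map H scalars g \<Longrightarrow> g (M t) = t (\<lambda>x y. g (antipode H x \<cdot> y))"
      if "t \<in> carrier HH" for t g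
      unfolding M_def by (rule tensor_lift_functional[OF space that Sb(2)])+
    have M_lin: "lin_map HH H M"
      unfolding lin_map_def
    proof (intro conjI ballI allI)
      fix t t' c assume t: "t \<in> carrier HH" "t' \<in> carrier HH"
      show "M t \<in> carrier H" by (rule M(1)[OF t(1)])
      show "M (t + t') = M t + M t'"
        by (rule coord_eqI)
           (simp_all add: M t vec_space_closed[OF spHH] closed coord_lin lin_map_scalarsD(1)[OF coord_lin])
      show "M (c \<odot>\<^bsub>HH\<^esub> t) = c \<odot> M t"
        by (rule coord_eqI)
           (simp_all add: M t vec_space_closed[OF spHH] closed coord_lin lin_map_scalarsD(2)[OF coord_lin])
    qed
    note mu = bilin_map_comp2[OF mult_bilin M_lin antipode_linear]
    have "co.pr \<phi> (co.S x) = ?f (tensor_lift HH H (\<lambda>t z. M t \<cdot> antipode H z) (comult_left H (el x)))"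
      unfolding pr_el el_S antipode_3[OF el_closed] M_def sq_simps ..
    also have "\<dots> = comult_left H (el x) (\<lambda>t z. ?f (M t \<cdot> antipode H z))"
      by (rule tensor_lift_functional(2)[OF spHH comult_left_eval(1)[OF el_closed] mu fnl_lin])
    also have "\<dots> = \<Delta> (el x) (\<lambda>x y. ?f (M (\<Delta> x) \<cdot> antipode H y))"
      by (rule comult_left_eval(2)[OF el_closed bilin_map_comp[OF mu fnl_lin]])
    also have "\<dots> = co.D x (\<lambda>p q. ?f (M (\<Delta> (el p)) \<cdot> antipode H (el q)))"
      by (rule comult_D[OF bilin_map_comp[OF bilin_map_comp2[OF mu comult_lin lin_map_id] fnl_lin]])
    also have "\<dots> = co.D x (\<lambda>p q. co.D p (\<lambda>r t. co.pr \<phi> (co.mul (co.mul (co.S r) t) (co.S q))))"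
    proof (rule co.D_cong)
      fix p q
      have l: "lin_map H scalars (\<lambda>v. ?f (v \<cdot> antipode H (el q)))"
        by (rule lin_map_comp[OF mul_lin(2)[OF antipode_closed[OF el_closed]] fnl_lin])
      have "?f (M (\<Delta> (el p)) \<cdot> antipode H (el q)) = \<Delta> (el p) (\<lambda>x y. ?f (antipode H x \<cdot> y \<cdot> antipode H (el q)))"
        by (rule M(2)[OF comult_closed[OF el_closed] l])
      also have "\<dots> = co.D p (\<lambda>r t. ?f (antipode H (el r) \<cdot> el t \<cdot> antipode H (el q)))"
        by (rule comult_D[OF bilin_map_comp[OF Sb(2) l]])
      finally show "?f (M (\<Delta> (el p)) \<cdot> antipode H (el q)) =
          co.D p (\<lambda>r t. co.pr \<phi> (co.mul (co.mul (co.S r) t) (co.S q)))"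
        by (simp only: pr_el el_mul el_S)
    qed
    finally show ?thesis .
  qed
qed

end

section \<open>The dual algebra and the passage from coordinates\<close>

context based_weak_hopf begin

interpretation co: structure_constants B sc_m sc_u sc_d "\<epsilon>" sc_s
  by unfold_locales (rule finite_basis)

interpretation co: weak_hopf_coords B sc_m sc_u sc_d "\<epsilon>" sc_s
  by (rule coords_weak_hopf)

abbreviation K where "K \<equiv> dual H"

lemma K_simps:
  "carrier K = {\<phi>. lin_map H scalars \<phi> \<and> (\<forall>x. x \<notin> carrier H \<longrightarrow> \<phi> x = 0)}"
  "smult K c \<phi> = (\<lambda>x. c * \<phi> x)"
  "mult K \<phi> \<psi> = (\<lambda>h. if h \<in> carrier H then sweedler H (\<lambda>x y. \<phi> x * \<psi> y) h else 0)"
  "one K = (\<lambda>h. if h \<in> carrier H then \<epsilon> h else 0)"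
  "counit K \<phi> = \<phi> \<one>"
  by (simp_all add: dual_def dual_alg_def)

lemma K_smult_apply: "smult K c \<phi> h = c * \<phi> h" by (simp add: K_simps)

lemma K_lin: "\<phi> \<in> carrier K \<Longrightarrow> lin_map H scalars \<phi>" and K_outside: "\<phi> \<in> carrier K \<Longrightarrow> x \<notin> carrier H \<Longrightarrow> \<phi> x = 0"
  by (auto simp: K_simps)

lemma K_space: "vec_space K"
proof (rule vec_space.intro)
  interpret v: vector_space "\<lambda>c (t :: 'a \<Rightarrow> 'k) \<beta>. c * t \<beta>" by (rule fun_vector_space)
  have s: "smult K = (\<lambda>c t \<beta>. c * t \<beta>)" by (intro ext) (simp add: K_simps)
  show "vector_space (smult K)" unfolding s by (rule fun_vector_space)
  show "module.subspace (smult K) (carrier K)"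
    unfolding s by (rule v.subspaceI) (auto simp: K_simps lin_map_scalars algebra_simps)
qed

definition restr :: "('a \<Rightarrow> 'k) \<Rightarrow> 'a \<Rightarrow> 'k" where "restr f = (\<lambda>h. if h \<in> carrier H then f h else 0)"

lemma restr_closed: "lin_map H scalars f \<Longrightarrow> restr f \<in> carrier K"
  unfolding K_simps by (auto simp: restr_def lin_map_scalars closed)

lemma restr_el [simp]: "restr f (el x) = f (el x)" by (simp add: restr_def)

lemma K_eqI: "\<phi> \<in> carrier K \<Longrightarrow> \<psi> \<in> carrier K \<Longrightarrow> (\<And>x. \<phi> (el x) = \<psi> (el x)) \<Longrightarrow> \<phi> = \<psi>"
proof
  fix h assume a: "\<phi> \<in> carrier K" "\<psi> \<in> carrier K" "\<And>x. \<phi> (el x) = \<psi> (el x)"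
  show "\<phi> h = \<psi> h"
    using a(3)[of "vec h"] K_outside[OF a(1)] K_outside[OF a(2)] by (cases "h \<in> carrier H") (auto simp: el_vec)
qed

lemma K_based: "based_space K B (\<lambda>i. restr (cv i)) (\<lambda>i \<phi>. \<phi> i)"
proof (rule based_space.intro[OF K_space finite_basis])
  fix i j
  show "restr (cv i) \<in> carrier K" if "i \<in> B" by (rule restr_closed[OF coord_lin[OF that]])
  show "lin_map K scalars (\<lambda>\<phi>. \<phi> i)" by (intro lin_map_scalarsI) (auto simp: K_simps)
  show "restr (cv j) i = (if i = j then 1 else 0)" if "i \<in> B" "j \<in> B"
    using that by (auto simp: restr_def basis_closed coord_basis)
next
  fix \<phi> assume \<phi>: "\<phi> \<in> carrier K"
  show "\<phi> = (\<Sum>i\<in>B. smult K (\<phi> i) (restr (cv i)))"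
  proof (rule K_eqI[OF \<phi>])
    show "(\<Sum>i\<in>B. smult K (\<phi> i) (restr (cv i))) \<in> carrier K"
      by (intro vec_space_sum[OF K_space] vec_space_closed[OF K_space] restr_closed coord_lin)
    fix x
    have ev: "(\<Sum>i\<in>J. f i) h = (\<Sum>i\<in>J. f i h)" if "finite J" for J and f :: "'a \<Rightarrow> 'a \<Rightarrow> 'k" and h
      using that by (induction J rule: finite_induct) auto
    show "\<phi> (el x) = (\<Sum>i\<in>B. smult K (\<phi> i) (restr (cv i))) (el x)"
      unfolding ev[OF finite_basis] by (simp add: K_simps functional_el[OF K_lin[OF \<phi>]] cv_el mult.commute)
  qed
qed

interpretation kb: based_space K B "\<lambda>i. restr (cv i)" "\<lambda>i \<phi>. \<phi> i" by (rule K_based)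

lemma K_eval_lin: "lin_map K scalars (\<lambda>\<phi>. \<phi> h)" by (intro lin_map_scalarsI) (auto simp: K_simps)

lemma mult_expand:
  assumes "lin_map H scalars f" "h \<in> carrier H" "g \<in> carrier H"
  shows "f (h \<cdot> g) = (\<Sum>i\<in>B. \<Sum>j\<in>B. cv i h * cv j g * f (i \<cdot> j))"
  by (rule bilin_expand[OF bilin_map_comp[OF mult_bilin assms(1)] assms(2,3)])

text \<open>
  The comultiplication of the dual is a definite description. The tensor with coefficients
  \<open>\<phi>(i j)\<close> in the dual basis satisfies it, and any solution agrees with this tensor on all
  bilinear forms, since its coefficients in the dual basis are evaluations at pairs of basis
  vectors.
\<close>

lemma dual_comult:
  assumes \<phi>: "\<phi> \<in> carrier K"
  shows "comult K \<phi> \<in> carrier (tensor_space K K)"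
    and "bilin_map K K scalars \<gamma> \<Longrightarrow>
      comult K \<phi> \<gamma> = (\<Sum>i\<in>B. \<Sum>j\<in>B. \<phi> (i \<cdot> j) * \<gamma> (restr (cv i)) (restr (cv j)))"
proof -
  have cs: "tensor_space (dual_alg H) (dual_alg H) = tensor_space K K" "tensor_lift (dual_alg H) (dual_alg H) = tensor_lift K K"
    by (rule tensor_cong_space; simp add: dual_def)+
  define t0 where "t0 = (\<Sum>i\<in>B. \<Sum>j\<in>B. smult (tensor_space K K) (\<phi> (i \<cdot> j)) (pure_tensor K K (restr (cv i)) (restr (cv j))))"
  note tv = tensor_vec_space[of K K]
  have t0: "t0 \<in> carrier (tensor_space K K)"
    unfolding t0_def by (intro vec_space_sum[OF tv] vec_space_closed[OF tv] pure_tensor_closed kb.basis_closed)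
  have t0_eval: "t0 \<gamma> = (\<Sum>i\<in>B. \<Sum>j\<in>B. \<phi> (i \<cdot> j) * \<gamma> (restr (cv i)) (restr (cv j)))"
    if "bilin_map K K scalars \<gamma>" for \<gamma>
  proof -
    have "t0 \<gamma> = (\<Sum>i\<in>B. (\<Sum>j\<in>B. smult (tensor_space K K) (\<phi> (i \<cdot> j)) (pure_tensor K K (restr (cv i)) (restr (cv j)))) \<gamma>)"
      unfolding t0_def
      by (rule lin_map_sum[OF tv tensor_eval_lin]) 
         (intro vec_space_sum[OF tv] vec_space_closed[OF tv] pure_tensor_closed kb.basis_closed)
    also have "\<dots> = (\<Sum>i\<in>B. \<Sum>j\<in>B. smult (tensor_space K K) (\<phi> (i \<cdot> j)) (pure_tensor K K (restr (cv i)) (restr (cv j))) \<gamma>)"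
      by (intro sum.cong refl lin_map_sum[OF tv tensor_eval_lin] vec_space_closed[OF tv] pure_tensor_closed kb.basis_closed)
    finally show ?thesis by (simp add: pure_tensor_eval[OF that])
  qed
  have bil: "bilin_map K K scalars (\<lambda>\<psi> \<chi>. \<psi> h * \<chi> g)" for h g by (intro bilin_prod K_eval_lin)
  have cm: "comult K \<phi> = (THE t. t \<in> carrier (tensor_space (dual_alg H) (dual_alg H)) \<and>
      (\<forall>h\<in>carrier H. \<forall>g\<in>carrier H.
        tensor_lift (dual_alg H) (dual_alg H) (\<lambda>\<psi> \<chi>. \<psi> h * \<chi> g) t = \<phi> (h \<cdot> g)))"
    by (simp add: dual_def)
  have "comult K \<phi> = t0"
    unfolding cm cs
  proof (rule the_equality, intro conjI ballI)
    show "t0 \<in> carrier (tensor_space K K)" by (rule t0)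
    fix h g assume hg: "h \<in> carrier H" "g \<in> carrier H"
    have "tensor_lift K K (\<lambda>\<psi> \<chi>. \<psi> h * \<chi> g) t0 = (\<Sum>i\<in>B. \<Sum>j\<in>B. \<phi> (i \<cdot> j) * (cv i h * cv j g))"
      unfolding tensor_lift_scalar[OF K_space t0 bil] t0_eval[OF bil] using hg by (simp add: restr_def)
    then show "tensor_lift K K (\<lambda>\<psi> \<chi>. \<psi> h * \<chi> g) t0 = \<phi> (h \<cdot> g)"
      by (simp add: mult_expand[OF K_lin[OF \<phi>] hg] mult.commute)
  next
    fix t assume t: "t \<in> carrier (tensor_space K K) \<and>
      (\<forall>h\<in>carrier H. \<forall>g\<in>carrier H. tensor_lift K K (\<lambda>\<psi> \<chi>. \<psi> h * \<chi> g) t = \<phi> (h \<cdot> g))"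
    then have tc: "t \<in> carrier (tensor_space K K)" by blast
    have ev: "t (\<lambda>\<psi> \<chi>. \<psi> h * \<chi> g) = \<phi> (h \<cdot> g)" if "h \<in> carrier H" "g \<in> carrier H" for h g
      using t that tensor_lift_scalar[OF K_space tc bil, of h g] by simp
    show "t = t0"
    proof (rule tensor_eqI[OF K_space tc t0])
      fix \<gamma> assume \<gamma>: "bilin_map K K scalars \<gamma>"
      show "t \<gamma> = t0 \<gamma>"
        unfolding kb.tensor_expand[OF tc \<gamma>] t0_eval[OF \<gamma>] by (intro sum.cong refl) (simp add: ev basis_closed)
    qed
  qed
  then show "comult K \<phi> \<in> carrier (tensor_space K K)"
    "bilin_map K K scalars \<gamma> \<Longrightarrow>
      comult K \<phi> \<gamma> = (\<Sum>i\<in>B. \<Sum>j\<in>B. \<phi> (i \<cdot> j) * \<gamma> (restr (cv i)) (restr (cv j)))"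
    using t0 t0_eval by simp_all
qed

lemma dual_comult_pair:
  assumes \<phi>: "\<phi> \<in> carrier K" and h: "h \<in> carrier H" "g \<in> carrier H"
  shows "comult K \<phi> (\<lambda>\<psi> \<chi>. \<psi> h * \<chi> g) = \<phi> (h \<cdot> g)"
  using h by (simp add: dual_comult(2)[OF \<phi> bilin_prod[OF K_eval_lin K_eval_lin]] restr_def
      mult_expand[OF K_lin[OF \<phi>] h] mult.commute)

lemma dual_comult_pair_outside:
  assumes \<phi>: "\<phi> \<in> carrier K" and h: "g \<notin> carrier H"
  shows "comult K \<phi> (\<lambda>\<psi> \<chi>. \<psi> h * \<chi> g) = 0"
  using h by (simp add: dual_comult(2)[OF \<phi> bilin_prod[OF K_eval_lin K_eval_lin]] restr_def)

lemma dual_mult_eval: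
  assumes "lin_map H scalars \<phi>" "lin_map H scalars \<psi>"
  shows "mult K \<phi> \<psi> (el x) = co.D x (\<lambda>p q. \<phi> (el p) * \<psi> (el q))"
  unfolding K_simps by (simp add: sweedler_scalar[OF bilin_prod[OF assms]])

lemma dual_mult_closed:
  assumes "lin_map H scalars \<phi>" "lin_map H scalars \<psi>"
  shows "mult K \<phi> \<psi> \<in> carrier K"
proof -
  have "mult K \<phi> \<psi> = restr (\<lambda>h. \<Delta> h (\<lambda>x y. \<phi> x * \<psi> y))"
    unfolding K_simps restr_def
    by (auto simp: fun_eq_iff sweedler_def tensor_lift_scalar[OF space comult_closed bilin_prod[OF assms]])
  then show ?thesis by (simp add: restr_closed[OF comult_eval_lin])
qed

lemma dual_one_closed: "one K \<in> carrier K"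
  using restr_closed[OF counit_linear] by (simp add: K_simps(4) restr_def)

lemma one_el: "one K (el x) = \<epsilon> (el x)" by (simp add: K_simps(4))

lemma algK: "bilin_algebra K"
proof -
  note kc = vec_space_closed[OF K_space]
  have ps: "(\<phi> + \<psi>) h = \<phi> h + \<psi> h" for \<phi> \<psi> :: "'a \<Rightarrow> 'k" and h by simp
  have "mult K \<phi> (\<psi> + \<psi>') = mult K \<phi> \<psi> + mult K \<phi> \<psi>'" "mult K (\<psi> + \<psi>') \<phi> = mult K \<psi> \<phi> + mult K \<psi>' \<phi>"
    "mult K \<phi> (smult K c \<psi>) = smult K c (mult K \<phi> \<psi>)" "mult K (smult K c \<psi>) \<phi> = smult K c (mult K \<psi> \<phi>)"
    if "\<phi> \<in> carrier K" "\<psi> \<in> carrier K" "\<psi>' \<in> carrier K" for \<phi> \<psi> \<psi>' c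
    by (rule K_eqI; simp add: that kc dual_mult_closed dual_mult_eval K_lin ps K_smult_apply distrib_left distrib_right
        co.D_add co.D_scale mult.assoc mult.left_commute[of _ c])+
  moreover have "mult K \<phi> \<psi> \<in> carrier K" if "\<phi> \<in> carrier K" "\<psi> \<in> carrier K" for \<phi> \<psi>
    using that by (simp add: dual_mult_closed K_lin)
  ultimately show ?thesis unfolding bilin_algebra_def bilin_map_def lin_map_def using K_space by blast
qed

lemma el_et: "el (co.et x) = counital_t H (el x)"
proof -
  have b: "bilin_map H H H (\<lambda>p q. \<epsilon> (p \<cdot> el x) \<odot> q)"
    by (rule bilin_scale_left[OF lin_map_comp[OF mul_lin(2)[OF el_closed] counit_linear]])
  have c: "counital_t H (el x) \<in> carrier H"
    unfolding counital_t_def by (rule sweedler_functional(1)[OF b one_closed])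
  show ?thesis
  proof (rule coord_eqI[OF el_closed c])
    fix i assume i: "i \<in> B"
    have "cv i (counital_t H (el x)) = co.D co.unit (\<lambda>p q. \<epsilon> (el p \<cdot> el x) * cv i (el q))"
      unfolding counital_t_def el_unit[symmetric] sweedler_functional(2)[OF b coord_lin[OF i]]
      by (simp add: functional_scale[OF coord_lin[OF i]])
    then show "cv i (el (co.et x)) = cv i (counital_t H (el x))"
      using co.lin_et[OF co.lin_pr, of "cv i" x] by (simp add: pr_functional[OF coord_lin[OF i]] eps_el el_mul)
  qed
qed

lemma el_es: "el (co.es x) = counital_s H (el x)"
proof -
  have b: "bilin_map H H H (\<lambda>p q. \<epsilon> (el x \<cdot> q) \<odot> p)"
    by (rule bilin_scale_right[OF lin_map_comp[OF mul_lin(1)[OF el_closed] counit_linear]])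
  have c: "counital_s H (el x) \<in> carrier H"
    unfolding counital_s_def by (rule sweedler_functional(1)[OF b one_closed])
  show ?thesis
  proof (rule coord_eqI[OF el_closed c])
    fix i assume i: "i \<in> B"
    have "cv i (counital_s H (el x)) = co.D co.unit (\<lambda>p q. \<epsilon> (el x \<cdot> el q) * cv i (el p))"
      unfolding counital_s_def el_unit[symmetric] sweedler_functional(2)[OF b coord_lin[OF i]]
      by (simp add: functional_scale[OF coord_lin[OF i]])
    then show "cv i (el (co.es x)) = cv i (counital_s H (el x))"
      using co.lin_es[OF co.lin_pr, of "cv i" x] by (simp add: pr_functional[OF coord_lin[OF i]] eps_el el_mul)
  qed
qed

lemma counital_closed: "x \<in> carrier H \<Longrightarrow> counital_t H x \<in> carrier H" "x \<in> carrier H \<Longrightarrow> counital_s H x \<in> carrier H"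
  using el_closed[of "co.et (vec x)"] el_closed[of "co.es (vec x)"] by (simp_all add: el_et el_es el_vec)

text \<open>
  Both sides are \<open>\<epsilon>(u\<^sub>1 x) \<phi>(u\<^sub>2)\<close>, with \<open>u\<close> the unit: on the left this arises from \<open>\<Delta> \<epsilon>\<close>, whose
  coefficients in the dual basis are \<open>\<epsilon>(i j)\<close>.
\<close>

lemma dual_counital_t:
  assumes \<phi>: "\<phi> \<in> carrier K"
  shows "counital_t K \<phi> \<in> carrier K" and "counital_t K \<phi> (el x) = co.pr \<phi> (co.et x)"
proof -
  define c where "c \<psi> = co.D co.unit (\<lambda>p q. \<psi> (el p) * \<phi> (el q))" for \<psi> :: "'a \<Rightarrow> 'k"
  have c: "counit K (mult K \<psi> \<phi>) = c \<psi>" if "\<psi> \<in> carrier K" for \<psi>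
    using dual_mult_eval[OF K_lin[OF that] K_lin[OF \<phi>], of co.unit] by (simp add: K_simps(5) el_unit c_def)
  have clin: "lin_map K scalars (\<lambda>\<psi>. counit K (mult K \<psi> \<phi>))"
    by (intro lin_map_scalarsI)
       (simp_all add: c vec_space_closed[OF K_space], simp_all add: c_def K_simps(2) distrib_right co.D_add co.D_scale mult.assoc)
  have b: "bilin_map K K scalars (\<lambda>\<psi> \<chi>. (smult K (counit K (mult K \<psi> \<phi>)) \<chi>) h)" for h
    unfolding K_simps(2) by (intro bilin_prod clin K_eval_lin)
  show "counital_t K \<phi> \<in> carrier K"
    unfolding counital_t_def sweedler_def
    by (rule tensor_lift_fun_closed[OF K_space dual_comult(1)[OF dual_one_closed] b K_space])
       (intro vec_space_closed[OF K_space])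
  have "counital_t K \<phi> (el x) = comult K (one K) (\<lambda>\<psi> \<chi>. counit K (mult K \<psi> \<phi>) * \<chi> (el x))"
    unfolding counital_t_def sweedler_def tensor_lift_fun[OF K_space dual_comult(1)[OF dual_one_closed] b]
    by (simp add: K_simps(2))
  also have "\<dots> = (\<Sum>i\<in>B. \<Sum>j\<in>B. \<epsilon> (i \<cdot> j) * (c (restr (cv i)) * cv j (el x)))"
    unfolding dual_comult(2)[OF dual_one_closed bilin_prod[OF clin K_eval_lin]]
    by (intro sum.cong refl) (simp add: c restr_closed coord_lin K_simps(4) mul_rules basis_closed)
  also have "\<dots> = co.D co.unit (\<lambda>p q. (\<Sum>i\<in>B. \<Sum>j\<in>B. cv i (el p) * cv j (el x) * \<epsilon> (i \<cdot> j)) * \<phi> (el q))"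
    unfolding c_def by (simp add: sum_distrib_left sum_distrib_right co.D_sum co.D_scale[symmetric] co.D_scale_right[symmetric] mult_ac)
  also have "\<dots> = co.D co.unit (\<lambda>p q. \<epsilon> (el p \<cdot> el x) * \<phi> (el q))"
    by (simp only: mult_expand[OF counit_linear el_closed el_closed])
  also have "\<dots> = co.pr \<phi> (co.et x)"
    using co.lin_et[OF co.lin_pr, of \<phi> x] by (simp only: pr_functional[OF K_lin[OF \<phi>]] eps_el el_mul)
  finally show "counital_t K \<phi> (el x) = co.pr \<phi> (co.et x)" .
qed

lemma dual_hit_left_eval:
  assumes "\<phi> \<in> carrier K" "h \<in> carrier H" "x \<in> carrier H"
  shows "dual_hit_left H h \<phi> x = \<phi> (x \<cdot> h)"
proof -
  have b: "bilin_map K K scalars (\<lambda>\<psi> \<chi>. (smult K (\<chi> h) \<psi>) x)" for x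
    unfolding K_simps(2) by (subst mult.commute) (intro bilin_prod K_eval_lin)
  show ?thesis
    unfolding dual_hit_left_def sweedler_def tensor_lift_fun[OF K_space dual_comult(1)[OF assms(1)] b]
    using dual_comult_pair[OF assms(1,3,2)] by (simp add: K_simps(2) mult.commute)
qed

lemma dual_hit_right_eval:
  assumes "\<phi> \<in> carrier K" "h \<in> carrier H"
  shows "dual_hit_right H \<phi> h = restr (\<lambda>x. \<phi> (h \<cdot> x))"
proof -
  have b: "bilin_map K K scalars (\<lambda>\<psi> \<chi>. (smult K (\<psi> h) \<chi>) x)" for x
    unfolding K_simps(2) by (intro bilin_prod K_eval_lin)
  show ?thesis
    unfolding dual_hit_right_def sweedler_def tensor_lift_fun[OF K_space dual_comult(1)[OF assms(1)] b]
    by (rule ext)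
       (simp add: K_simps(2) restr_def dual_comult_pair[OF assms] dual_comult_pair_outside[OF assms(1)])
qed

lemma el_inj: "el x = el y \<Longrightarrow> x \<in> co.vecs \<Longrightarrow> y \<in> co.vecs \<Longrightarrow> x = y"
  using vec_el by metis

lemma hit_left_functional:
  assumes "lin_map H scalars \<phi>"
  shows "h \<in> carrier H \<Longrightarrow> hit_left H \<phi> h \<in> carrier H"
    "lin_map H scalars g \<Longrightarrow> g (hit_left H \<phi> (el x)) = co.D x (\<lambda>p q. \<phi> (el q) * g (el p))"
    "h \<in> carrier H \<Longrightarrow> hit_right H h \<phi> \<in> carrier H"
    "lin_map H scalars g \<Longrightarrow> g (hit_right H (el x) \<phi>) = co.D x (\<lambda>p q. \<phi> (el p) * g (el q))"
  unfolding hit_left_def hit_right_def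
  by (simp_all add: sweedler_functional[OF bilin_scale_left[OF assms]] sweedler_functional[OF bilin_scale_right[OF assms]]
      functional_scale)

lemma blin_el: "bilin_map H H scalars \<gamma> \<Longrightarrow> co.blin (\<lambda>p q. \<gamma> (el p) (el q))"
proof (rule co.blinI)
  have l: "co.lin (\<lambda>x. g (el x))" if "lin_map H scalars g" for g
    using co.lin_pr[of g] by (simp only: pr_functional[OF that, symmetric])
  show "bilin_map H H scalars \<gamma> \<Longrightarrow> co.lin (\<lambda>x. \<gamma> (el x) (el y))"
    "bilin_map H H scalars \<gamma> \<Longrightarrow> co.lin (\<lambda>y. \<gamma> (el x) (el y))" for x y
    by (rule l[OF bilin_mapD(2)], assumption, rule el_closed)
       (rule l[OF bilin_mapD(1)], assumption, rule el_closed)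
qed

lemma alg_inv_eqI:
  assumes "bilin_algebra A" "x \<in> carrier A" "y \<in> carrier A"
    and "mult A x y = one A" "mult A y x = one A"
    and "\<And>z w. z \<in> carrier A \<Longrightarrow> w \<in> carrier A \<Longrightarrow> mult A (mult A z x) w = mult A z (mult A x w)"
    and "\<And>z. z \<in> carrier A \<Longrightarrow> mult A (one A) z = z" "\<And>z. z \<in> carrier A \<Longrightarrow> mult A z (one A) = z"
  shows "alg_inv A x = y"
  unfolding alg_inv_def
proof (rule the_equality)
  fix z assume z: "z \<in> carrier A \<and> mult A x z = one A \<and> mult A z x = one A"
  have "z = mult A (mult A y x) z" using z assms(5,7) by simp
  also have "\<dots> = y" using z assms(3,6,8) by simp
  finally show "z = y" .
qed (use assms in simp)

text \<open>
  Values of the counital maps lie in \<open>H_min H\<close>, as the other factor of the product can be taken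
  to be 1.
\<close>

lemma S2_counital:
  assumes S2: "\<forall>x\<in>H_min H. (antipode H ^^ 2) x = x" and z: "z \<in> carrier H"
  shows "antipode H (antipode H (counital_t H z)) = counital_t H z"
    and "antipode H (antipode H (counital_s H z)) = counital_s H z"
proof -
  interpret v: vector_space "smult H" by (rule ambient)
  have one: "\<one> = counital_t H \<one>" "\<one> = counital_s H \<one>"
    using el_et[of co.unit] el_es[of co.unit] by (simp_all add: el_unit)
  have "counital_t H z \<cdot> counital_s H \<one> \<in> H_min H" "counital_t H \<one> \<cdot> counital_s H z \<in> H_min H"
    unfolding H_min_def base_t_def base_s_def using z one_closed by (blast intro: v.span_base)+
  then have "counital_t H z \<in> H_min H" "counital_s H z \<in> H_min H"
    by (simp_all add: one[symmetric] one_left one_right counital_closed z)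
  then show "antipode H (antipode H (counital_t H z)) = counital_t H z"
    "antipode H (antipode H (counital_s H z)) = counital_s H z"
    using S2 by (auto simp: numeral_2_eq_2)
qed

lemma integrals_in_coordinates:
  assumes S2: "\<forall>x\<in>H_min H. (antipode H ^^ 2) x = x"
    and l: "l \<in> left_integrals H" and lam: "lam \<in> left_integrals K"
    and lam_l: "hit_left H lam l = \<one>" and l_lam: "dual_hit_left H l lam = one K"
  shows "dual_integrals B sc_m sc_u sc_d \<epsilon> sc_s (vec l) (\<lambda>i. if i \<in> B then lam i else 0)"
proof (rule dual_integrals.intro[OF coords_weak_hopf dual_integrals_axioms.intro])
  have lc: "l \<in> carrier H" and lamc: "lam \<in> carrier K"
    using l lam by (auto simp: left_integrals_def)
  have l_el: "el (vec l) = l" by (rule el_vec[OF lc])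
  have L: "co.pr (\<lambda>i. if i \<in> B then lam i else 0) x = lam (el x)" for x
    using pr_functional[OF K_lin[OF lamc], of x] by (simp add: co.pr_def cong: sum.cong)
  fix \<phi> x
  show "vec l \<in> co.vecs" "(\<lambda>i. if i \<in> B then lam i else 0) \<in> co.vecs" by (simp_all add: co.vecs_def vec_def)
  show "co.pr \<phi> (co.mul x (vec l)) = co.pr \<phi> (co.mul (co.et x) (vec l))"
    using l by (simp add: pr_el el_mul l_el el_et left_integrals_def)
  let ?f = "restr (fnl \<phi>)"
  have f: "?f \<in> carrier K" by (rule restr_closed[OF fnl_lin])
  have "mult K ?f lam (el x) = mult K (counital_t K ?f) lam (el x)"
    using lam f by (simp add: left_integrals_def)
  then show "co.D x (\<lambda>p q. co.pr \<phi> p * co.pr (\<lambda>i. if i \<in> B then lam i else 0) q) =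
      co.D x (\<lambda>p q. co.pr \<phi> (co.et p) * co.pr (\<lambda>i. if i \<in> B then lam i else 0) q)"
    unfolding dual_mult_eval[OF K_lin[OF f] K_lin[OF lamc]]
      dual_mult_eval[OF K_lin[OF dual_counital_t(1)[OF f]] K_lin[OF lamc]] dual_counital_t(2)[OF f]
      pr_functional[OF K_lin[OF f]] restr_el L pr_el[of \<phi>] .
  show "co.D (vec l) (\<lambda>p q. co.pr \<phi> p * co.pr (\<lambda>i. if i \<in> B then lam i else 0) q) = co.pr \<phi> co.unit"
    using hit_left_functional(2)[OF K_lin[OF lamc] fnl_lin, of \<phi> "vec l"]
    by (simp add: l_el lam_l L pr_el el_unit mult.commute)
  show "co.pr (\<lambda>i. if i \<in> B then lam i else 0) (co.mul x (vec l)) = co.eps x"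
    using dual_hit_left_eval[OF lamc lc el_closed, of x] by (simp add: l_lam L el_mul l_el eps_el K_simps(4))
  show "co.S (co.S (co.et x)) = co.et x" "co.S (co.S (co.es x)) = co.es x"
    by (rule el_inj; simp add: el_S el_et el_es S2_counital[OF S2 el_closed])+
qed

text \<open>
  What remains is to translate the identities for \<open>a\<close> and \<open>\<alpha>\<close> into equations between tensors,
  which are tested on bilinear forms.
\<close>

lemma fourth_power_of_antipode:
  assumes S2: "\<forall>x\<in>H_min H. (antipode H ^^ 2) x = x"
    and l: "l \<in> left_integrals H" and lam: "lam \<in> left_integrals K"
    and lam_l: "hit_left H lam l = \<one>" and l_lam: "dual_hit_left H l lam = one K"
    and \<alpha>: "\<alpha> = dual_hit_right H lam l" and a: "a = hit_right H l lam"
  shows "\<alpha> \<in> group_likes K" and "a \<in> group_likes H"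
    and "h \<in> carrier H \<Longrightarrow> (antipode H ^^ 4) h =
       alg_inv H a \<cdot> hit_right H (hit_left H \<alpha> h) (alg_inv K \<alpha>) \<cdot> a"
proof -
  define lv where "lv = vec l"
  define lamv where "lamv = (\<lambda>i. if i \<in> B then lam i else 0)"
  have lc: "l \<in> carrier H" and lamc: "lam \<in> carrier K"
    using l lam by (auto simp: left_integrals_def)
  have l_el: "el lv = l" unfolding lv_def by (rule el_vec[OF lc])
  have L: "co.pr lamv x = lam (el x)" for x
    using pr_functional[OF K_lin[OF lamc], of x] by (simp add: co.pr_def lamv_def cong: sum.cong)
  interpret di: dual_integrals B sc_m sc_u sc_d "\<epsilon>" sc_s lv lamv
    unfolding lv_def lamv_def by (rule integrals_in_coordinates[OF S2 l lam lam_l l_lam])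
  define bb where "bb = el di.b"
  have a_el: "el di.a = a"
  proof (rule coord_eqI[OF el_closed])
    show "a \<in> carrier H" unfolding a by (rule hit_left_functional(3)[OF K_lin[OF lamc] lc])
    fix i assume i: "i \<in> B"
    show "cv i (el di.a) = cv i a"
      using di.lin_a[OF co.lin_pr, of "cv i"] hit_left_functional(4)[OF K_lin[OF lamc] coord_lin[OF i], of lv]
      by (simp add: pr_functional[OF coord_lin[OF i]] L a l_el)
  qed
  have ab: "a \<cdot> bb = \<one>" "bb \<cdot> a = \<one>"
    unfolding bb_def a_el[symmetric] el_mul[symmetric] by (simp_all only: di.a_b di.b_a el_unit)
  have ac: "a \<in> carrier H" and bc: "bb \<in> carrier H" by (simp_all add: a_el[symmetric] bb_def)
  have ainv: "alg_inv H a = bb"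
    by (rule alg_inv_eqI[OF algH ac bc ab]) (simp_all add: mult_assoc ac one_left one_right)
  have c1: "\<Delta> \<one> \<in> carrier HH" by (intro comult_closed one_closed)
  have paa: "pure_tensor H H a a \<in> carrier HH" by (intro pure_tensor_closed ac)
  show "a \<in> group_likes H"
    unfolding group_likes_def alg_units_def
  proof (intro CollectI conjI bexI[of _ bb] ac bc ab)
    show "\<Delta> a = pure_tensor H H a a \<cdot>\<^bsub>tensor_square H\<^esub> \<Delta> \<one>"
    proof (rule tensor_eqI[OF space comult_closed[OF ac] tensor_mult_eval(1)[OF algH algH paa c1]])
      fix \<gamma> assume g: "bilin_map H H scalars \<gamma>"
      have "(pure_tensor H H a a \<cdot>\<^bsub>tensor_square H\<^esub> \<Delta> \<one>) \<gamma> = \<Delta> \<one> (\<lambda>x' y'. \<gamma> (a \<cdot> x') (a \<cdot> y'))"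
        unfolding square_mult_eval[OF paa c1 g] by (rule pure_tensor_eval[OF mult_form3[OF g c1]])
      also have "\<dots> = co.D co.unit (\<lambda>p q. \<gamma> (el (co.mul di.a p)) (el (co.mul di.a q)))"
        using comult_D[OF mult_form1[OF g ac ac], of co.unit] by (simp add: el_unit el_mul a_el)
      also have "\<dots> = co.D di.a (\<lambda>p q. \<gamma> (el p) (el q))" by (rule di.D_a'[OF blin_el[OF g], symmetric])
      also have "\<dots> = \<Delta> a \<gamma>" using comult_D[OF g, of di.a] by (simp add: a_el)
      finally show "\<Delta> a \<gamma> = (pure_tensor H H a a \<cdot>\<^bsub>tensor_square H\<^esub> \<Delta> \<one>) \<gamma>" by (rule sym)
    qed
    show "\<Delta> a = \<Delta> \<one> \<cdot>\<^bsub>tensor_square H\<^esub> pure_tensor H H a a"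
    proof (rule tensor_eqI[OF space comult_closed[OF ac] tensor_mult_eval(1)[OF algH algH c1 paa]])
      fix \<gamma> assume g: "bilin_map H H scalars \<gamma>"
      have "(\<Delta> \<one> \<cdot>\<^bsub>tensor_square H\<^esub> pure_tensor H H a a) \<gamma> = \<Delta> \<one> (\<lambda>x y. \<gamma> (x \<cdot> a) (y \<cdot> a))"
        unfolding square_mult_eval[OF c1 paa g]
        by (rule tensor_cong[OF space c1 mult_form3[OF g paa] mult_form2[OF g ac ac]])
           (rule pure_tensor_eval, rule mult_form1[OF g])
      also have "\<dots> = co.D co.unit (\<lambda>p q. \<gamma> (el (co.mul p di.a)) (el (co.mul q di.a)))"
        using comult_D[OF mult_form2[OF g ac ac], of co.unit] by (simp add: el_unit el_mul a_el)
      also have "\<dots> = co.D di.a (\<lambda>p q. \<gamma> (el p) (el q))" by (rule di.D_a[OF blin_el[OF g], symmetric])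
      also have "\<dots> = \<Delta> a \<gamma>" using comult_D[OF g, of di.a] by (simp add: a_el)
      finally show "\<Delta> a \<gamma> = (\<Delta> \<one> \<cdot>\<^bsub>tensor_square H\<^esub> pure_tensor H H a a) \<gamma>" by (rule sym)
    qed
  qed
  define be where "be = restr (fnl di.beta)"
  have \<alpha>_restr: "\<alpha> = restr (\<lambda>x. lam (l \<cdot> x))" unfolding \<alpha> by (rule dual_hit_right_eval[OF lamc lc])
  have \<alpha>c: "\<alpha> \<in> carrier K" unfolding \<alpha>_restr by (rule restr_closed[OF lin_map_comp[OF mul_lin(1)[OF lc] K_lin[OF lamc]]])
  have bec: "be \<in> carrier K" unfolding be_def by (rule restr_closed[OF fnl_lin])
  have \<alpha>_el: "co.pr di.alpha x = \<alpha> (el x)" for x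
    by (simp add: di.alpha L el_mul l_el \<alpha>_restr)
  have be_el: "co.pr di.beta x = be (el x)" for x by (simp add: be_def pr_el)
  have \<alpha>be: "mult K \<alpha> be = one K" "mult K be \<alpha> = one K"
    by (rule K_eqI[OF dual_mult_closed dual_one_closed]; 
        simp add: K_lin \<alpha>c bec dual_mult_eval \<alpha>_el[symmetric] be_el[symmetric] di.alpha_beta di.beta_alpha one_el eps_el)+
  have one_mult: "mult K (one K) \<psi> = \<psi>" "mult K \<psi> (one K) = \<psi>" if "\<psi> \<in> carrier K" for \<psi>
  proof -
    have c: "co.D x (\<lambda>p q. \<epsilon> (el p) * \<psi> (el q)) = \<psi> (el x)" "co.D x (\<lambda>p q. \<psi> (el p) * \<epsilon> (el q)) = \<psi> (el x)" for x
      using co.counit[OF co.lin_pr, of x \<psi>] by (simp_all only: pr_functional[OF K_lin[OF that]] eps_el mult.commute[of "\<psi> _"])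
    show "mult K (one K) \<psi> = \<psi>" "mult K \<psi> (one K) = \<psi>"
      by (rule K_eqI[OF dual_mult_closed that]; simp add: K_lin dual_one_closed that dual_mult_eval one_el c)+
  qed
  have mult_assoc_K: "mult K (mult K \<psi> \<alpha>) \<chi> = mult K \<psi> (mult K \<alpha> \<chi>)" if "\<psi> \<in> carrier K" "\<chi> \<in> carrier K" for \<psi> \<chi>
    by (rule K_eqI)
       (simp_all add: dual_mult_closed dual_mult_eval K_lin that \<alpha>c co.D_scale[symmetric] co.D_scale_right[symmetric] co.coassoc mult.assoc)
  have \<alpha>inv: "alg_inv K \<alpha> = be"
    by (rule alg_inv_eqI[OF algK \<alpha>c bec \<alpha>be]) (simp_all add: mult_assoc_K one_mult)
  note k1 = dual_comult(1)[OF dual_one_closed]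
  have p\<alpha>: "pure_tensor K K \<alpha> \<alpha> \<in> carrier (tensor_space K K)" by (intro pure_tensor_closed \<alpha>c)
  \<comment> \<open>The coefficients \<open>\<epsilon>(i j)\<close> of \<open>\<Delta> \<epsilon>\<close> recombine with the coordinates to the counit of a
     product.\<close>
  have spread: "(\<Sum>i\<in>B. \<Sum>j\<in>B. \<epsilon> (i \<cdot> j) * (co.D x (\<lambda>p q. X p q * cv i (el (f p q))) * co.D y (\<lambda>p q. Y p q * cv j (el (g p q))))) =
      co.D x (\<lambda>p q. co.D y (\<lambda>r t. \<epsilon> (el (f p q) \<cdot> el (g r t)) * (X p q * Y r t)))" for x y X Y f g
  proof -
    have pair: "e * (co.D x F * co.D y G) = co.D x (\<lambda>p q. co.D y (\<lambda>r t. e * (F p q * G r t)))" for e F G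
      by (simp only: co.D_scale co.D_scale_right mult.assoc)
    show ?thesis
      unfolding pair mult_expand[OF counit_linear el_closed el_closed] sum_distrib_right co.D_sum[symmetric]
      by (simp only: mult_ac)
  qed
  \<comment> \<open>Both group-like equations for \<open>\<alpha>\<close> have this shape, with \<open>F\<close> the multiplication by \<open>\<alpha>\<close> from
     one side.\<close>
  have group: "comult K \<alpha> \<gamma> = comult K (one K) (\<lambda>x y. \<gamma> (F x) (F y))"
    if \<gamma>: "bilin_map K K scalars \<gamma>" and b: "bilin_map K K scalars (\<lambda>x y. \<gamma> (F x) (F y))"
      and Fc: "\<And>x. x \<in> carrier K \<Longrightarrow> F x \<in> carrier K"
      and F: "\<And>k l. k \<in> B \<Longrightarrow> l \<in> B \<Longrightarrow> (\<Sum>i\<in>B. \<Sum>j\<in>B. \<epsilon> (i \<cdot> j) * (F (restr (cv i)) k * F (restr (cv j)) l)) = \<alpha> (k \<cdot> l)"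
    for \<gamma> F
  proof -
    have "comult K (one K) (\<lambda>x y. \<gamma> (F x) (F y)) =
      (\<Sum>i\<in>B. \<Sum>j\<in>B. \<epsilon> (i \<cdot> j) * \<gamma> (F (restr (cv i))) (F (restr (cv j))))"
      unfolding dual_comult(2)[OF dual_one_closed b]
      by (intro sum.cong refl) (simp add: K_simps(4) mul_rules basis_closed)
    also have "\<dots> = (\<Sum>i\<in>B. \<Sum>j\<in>B. \<Sum>k\<in>B. \<Sum>l\<in>B.
        \<epsilon> (i \<cdot> j) * (F (restr (cv i)) k * F (restr (cv j)) l) * \<gamma> (restr (cv k)) (restr (cv l)))"
      by (intro sum.cong refl, subst kb.bilin_expand[OF \<gamma> Fc Fc])
         (simp_all add: kb.basis_closed sum_distrib_left mult.assoc)
    also have "\<dots> = (\<Sum>k\<in>B. \<Sum>l\<in>B. \<Sum>i\<in>B. \<Sum>j\<in>B.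
        \<epsilon> (i \<cdot> j) * (F (restr (cv i)) k * F (restr (cv j)) l) * \<gamma> (restr (cv k)) (restr (cv l)))"
    proof -
      have sw: "(\<Sum>i\<in>B. \<Sum>j\<in>B. \<Sum>k\<in>B. \<Sum>l\<in>B. Z i j k l) = (\<Sum>k\<in>B. \<Sum>l\<in>B. \<Sum>i\<in>B. \<Sum>j\<in>B. Z i j k l)"
        for Z :: "'a \<Rightarrow> 'a \<Rightarrow> 'a \<Rightarrow> 'a \<Rightarrow> 'k"
      proof -
        have pairs: "(\<Sum>i\<in>B. \<Sum>j\<in>B. f i j) = (\<Sum>p\<in>B \<times> B. f (fst p) (snd p))" for f :: "'a \<Rightarrow> 'a \<Rightarrow> 'k"
          by (simp add: sum.cartesian_product case_prod_beta)
        show ?thesis unfolding pairs by (rule sum.swap)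
      qed
      show ?thesis by (rule sw)
    qed
    also have "\<dots> = (\<Sum>k\<in>B. \<Sum>l\<in>B. \<alpha> (k \<cdot> l) * \<gamma> (restr (cv k)) (restr (cv l)))"
      by (intro sum.cong refl) (simp add: sum_distrib_right[symmetric] F)
    also have "\<dots> = comult K \<alpha> \<gamma>" by (rule dual_comult(2)[OF \<alpha>c \<gamma>, symmetric])
    finally show ?thesis by (rule sym)
  qed
  show "\<alpha> \<in> group_likes K"
    unfolding group_likes_def alg_units_def
  proof (intro CollectI conjI bexI[of _ be] \<alpha>c bec \<alpha>be)
    show "comult K \<alpha> = mult (tensor_square K) (pure_tensor K K \<alpha> \<alpha>) (comult K (one K))"
    proof (rule tensor_eqI[OF K_space dual_comult(1)[OF \<alpha>c] tensor_mult_eval(1)[OF algK algK p\<alpha> k1]])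
      fix \<gamma> assume g: "bilin_map K K scalars \<gamma>"
      note forms = tensor_mult_forms[OF algK algK g]
      have "mult (tensor_square K) (pure_tensor K K \<alpha> \<alpha>) (comult K (one K)) \<gamma> =
          comult K (one K) (\<lambda>x' y'. \<gamma> (mult K \<alpha> x') (mult K \<alpha> y'))"
        unfolding tensor_mult_eval(2)[OF algK algK p\<alpha> k1 g]
        by (rule pure_tensor_eval[OF tensor_bilin[OF K_space K_space K_space k1 forms]])
      also have "\<dots> = comult K \<alpha> \<gamma>"
      proof (rule group[OF g forms(1)[OF \<alpha>c \<alpha>c], symmetric])
        show "mult K \<alpha> x \<in> carrier K" if "x \<in> carrier K" for x using that by (simp add: dual_mult_closed K_lin \<alpha>c)
        fix k l assume kl: "k \<in> B" "l \<in> B"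
        have e: "mult K \<alpha> (restr (cv i)) k = co.D (co.bas k) (\<lambda>p q. co.pr di.alpha p * cv i (el q))"
          if "i \<in> B" "k \<in> B" for i k
          using dual_mult_eval[OF K_lin[OF \<alpha>c] K_lin[OF restr_closed[OF coord_lin[OF that(1)]]], of "co.bas k"] that(2)
          by (simp add: el_bas \<alpha>_el)
        have "(\<Sum>i\<in>B. \<Sum>j\<in>B. \<epsilon> (i \<cdot> j) * (mult K \<alpha> (restr (cv i)) k * mult K \<alpha> (restr (cv j)) l)) =
          (\<Sum>i\<in>B. \<Sum>j\<in>B. \<epsilon> (i \<cdot> j) * (co.D (co.bas k) (\<lambda>p q. co.pr di.alpha p * cv i (el q)) *
            co.D (co.bas l) (\<lambda>p q. co.pr di.alpha p * cv j (el q))))"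
          by (intro sum.cong refl) (simp only: e kl)
        also have "\<dots> = co.D (co.bas k) (\<lambda>p q. co.D (co.bas l) (\<lambda>r t. \<epsilon> (el q \<cdot> el t) * (co.pr di.alpha p * co.pr di.alpha r)))"
          by (rule spread)
        also have "\<dots> = co.pr di.alpha (co.mul (co.bas k) (co.bas l))"
          by (simp only: di.alpha_mul' eps_el el_mul)
        also have "\<dots> = \<alpha> (k \<cdot> l)" by (simp add: \<alpha>_el el_mul el_bas kl)
        finally show "(\<Sum>i\<in>B. \<Sum>j\<in>B. \<epsilon> (i \<cdot> j) * (mult K \<alpha> (restr (cv i)) k * mult K \<alpha> (restr (cv j)) l)) = \<alpha> (k \<cdot> l)" .
      qed
      finally show "comult K \<alpha> \<gamma> = mult (tensor_square K) (pure_tensor K K \<alpha> \<alpha>) (comult K (one K)) \<gamma>" by (rule sym)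
    qed
    show "comult K \<alpha> = mult (tensor_square K) (comult K (one K)) (pure_tensor K K \<alpha> \<alpha>)"
    proof (rule tensor_eqI[OF K_space dual_comult(1)[OF \<alpha>c] tensor_mult_eval(1)[OF algK algK k1 p\<alpha>]])
      fix \<gamma> assume g: "bilin_map K K scalars \<gamma>"
      note forms = tensor_mult_forms[OF algK algK g]
      have "mult (tensor_square K) (comult K (one K)) (pure_tensor K K \<alpha> \<alpha>) \<gamma> =
          comult K (one K) (\<lambda>x' y'. \<gamma> (mult K x' \<alpha>) (mult K y' \<alpha>))"
        unfolding tensor_mult_eval(2)[OF algK algK k1 p\<alpha> g]
      proof (rule tensor_cong[OF K_space k1 _ forms(2)[OF \<alpha>c \<alpha>c]])
        show "bilin_map K K scalars (\<lambda>x y. pure_tensor K K \<alpha> \<alpha> (\<lambda>x' y'. \<gamma> (mult K x x') (mult K y y')))"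
          by (rule tensor_bilin[OF K_space K_space K_space p\<alpha> forms])
        show "pure_tensor K K \<alpha> \<alpha> (\<lambda>x' y'. \<gamma> (mult K x x') (mult K y y')) = \<gamma> (mult K x \<alpha>) (mult K y \<alpha>)"
          if "x \<in> carrier K" "y \<in> carrier K" for x y
          by (rule pure_tensor_eval[OF forms(1)[OF that]])
      qed
      also have "\<dots> = comult K \<alpha> \<gamma>"
      proof (rule group[OF g forms(2)[OF \<alpha>c \<alpha>c], symmetric])
        show "mult K x \<alpha> \<in> carrier K" if "x \<in> carrier K" for x using that by (simp add: dual_mult_closed K_lin \<alpha>c)
        fix k l assume kl: "k \<in> B" "l \<in> B"
        have e: "mult K (restr (cv i)) \<alpha> k = co.D (co.bas k) (\<lambda>p q. co.pr di.alpha q * cv i (el p))"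
          if "i \<in> B" "k \<in> B" for i k
          using dual_mult_eval[OF K_lin[OF restr_closed[OF coord_lin[OF that(1)]]] K_lin[OF \<alpha>c], of "co.bas k"] that(2)
          by (simp add: el_bas \<alpha>_el mult.commute)
        have "(\<Sum>i\<in>B. \<Sum>j\<in>B. \<epsilon> (i \<cdot> j) * (mult K (restr (cv i)) \<alpha> k * mult K (restr (cv j)) \<alpha> l)) =
          (\<Sum>i\<in>B. \<Sum>j\<in>B. \<epsilon> (i \<cdot> j) * (co.D (co.bas k) (\<lambda>p q. co.pr di.alpha q * cv i (el p)) *
            co.D (co.bas l) (\<lambda>p q. co.pr di.alpha q * cv j (el p))))"
          by (intro sum.cong refl) (simp only: e kl)
        also have "\<dots> = co.D (co.bas k) (\<lambda>p q. co.D (co.bas l) (\<lambda>r t. \<epsilon> (el p \<cdot> el r) * (co.pr di.alpha q * co.pr di.alpha t)))"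
          by (rule spread)
        also have "\<dots> = co.pr di.alpha (co.mul (co.bas k) (co.bas l))"
          by (simp only: di.alpha_mul eps_el el_mul)
        also have "\<dots> = \<alpha> (k \<cdot> l)" by (simp add: \<alpha>_el el_mul el_bas kl)
        finally show "(\<Sum>i\<in>B. \<Sum>j\<in>B. \<epsilon> (i \<cdot> j) * (mult K (restr (cv i)) \<alpha> k * mult K (restr (cv j)) \<alpha> l)) = \<alpha> (k \<cdot> l)" .
      qed
      finally show "comult K \<alpha> \<gamma> = mult (tensor_square K) (comult K (one K)) (pure_tensor K K \<alpha> \<alpha>) \<gamma>" by (rule sym)
    qed
  qed
  assume h: "h \<in> carrier H"
  have hl: "el (di.hit_l x) = hit_left H \<alpha> (el x)" and hr: "el (di.hit_r x) = hit_right H (el x) be" for x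
    by (rule coord_eqI;
        simp add: hit_left_functional[OF K_lin[OF \<alpha>c]] hit_left_functional[OF K_lin[OF bec]] coord_lin
          pr_functional[OF coord_lin, symmetric];
        simp add: di.lin_hit_l di.lin_hit_r pr_functional[OF coord_lin] \<alpha>_el be_el)+
  have "antipode H (antipode H (antipode H (antipode H h))) = el (co.S (co.S (co.S (co.S (vec h)))))"
    by (simp add: el_S el_vec h)
  also have "\<dots> = bb \<cdot> hit_right H (hit_left H \<alpha> h) be \<cdot> a"
    by (simp add: di.S4 el_mul hl hr el_vec h a_el bb_def)
  finally show "(antipode H ^^ 4) h = alg_inv H a \<cdot> hit_right H (hit_left H \<alpha> h) (alg_inv K \<alpha>) \<cdot> a"
    by (simp add: ainv \<alpha>inv eval_nat_numeral)
qed

end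

theorem theorem5p13:
  fixes H :: "('k::field, 'a::ab_group_add) weak_hopf"
    and l a :: 'a
    and lam \<alpha> :: "'a \<Rightarrow> 'k"
  assumes "weak_hopf_algebra H"
    and "finite_dimensional H"
    and "frobenius_algebra H"
    and "\<forall>x\<in>H_min H. (antipode H ^^ 2) x = x"
    and "l \<in> left_integrals H"
    and "lam \<in> left_integrals (dual H)"
    and "hit_left H lam l = \<one>\<^bsub>H\<^esub>"
    and "dual_hit_left H l lam = \<one>\<^bsub>dual H\<^esub>"
    and "\<alpha> = dual_hit_right H lam l"
    and "a = hit_right H l lam"
  shows "\<alpha> \<in> group_likes (dual H) \<and> a \<in> group_likes H \<and>
    (\<forall>h\<in>carrier H. (antipode H ^^ 4) h =
       alg_inv H a \<cdot>\<^bsub>H\<^esub> hit_right H (hit_left H \<alpha> h) (alg_inv (dual H) \<alpha>) \<cdot>\<^bsub>H\<^esub> a)"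
proof -
  interpret weak_hopf_algebra H by (rule assms(1))
  obtain B cv where "based_space H B (\<lambda>x. x) cv"
    by (rule finite_dimensional_based[OF vec_space_axioms assms(2)])
  then interpret based_weak_hopf H B cv
    by (intro based_weak_hopf.intro weak_hopf_algebra_axioms)
  note conclusion = fourth_power_of_antipode[OF assms(4-10)]
  show ?thesis by (intro conjI ballI conclusion)
qed

end
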